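(* Let $N \ge 2$, $0 < p, p_1, \dots, p_N \le \infty$, $0 < q, q_1, \dots, q_N \le \infty$ and $s, s_1, \dots, s_N \in \mathbb{R}$. Let $$m = \min\left\{\frac{n}{p}, \frac{n}{2}\right\} - \sum_{j=1}^N \max\left\{\frac{n}{p_j}, \frac{n}{2}\right\} + \sum_{j=1}^N s_j - s.$$ If $$\mathrm{Op}(S^m_{0,0}(\mathbb{R}^n, N)) \subset B(B^{s_1}_{p_1, q_1} \times \dots \times B^{s_N}_{p_N, q_N} \to B^s_{p,q}),$$ that is, if for every $\sigma \in S^m_{0,0}(\mathbb{R}^n, N)$ the operator $T_\sigma$ is bounded from $B^{s_1}_{p_1, q_1} \times \dots \times B^{s_N}_{p_N, q_N}$ to $B^s_{p,q}$, then $$s_j \le \max\left\{\frac{n}{p_j}, \frac{n}{2}\right\}, \quad j = 1, \dots, N, \qquad \text{and} \qquad s \ge -\max\left\{\frac{n}{p'}, \frac{n}{2}\right\}.$$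
   Context: All function spaces are on $\mathbb{R}^n$; $\mathcal{S}$ is the Schwartz space and $\mathcal{S}'$ the space of tempered distributions; $\mathbb{N}_0 = \{0,1,2,\dots\}$; $1/\infty = 0$ and $n/\infty = 0$. The conjugate exponent $p'$ is defined by $1/p + 1/p' = 1$ if $1 < p \le \infty$ and $p' = \infty$ if $0 < p \le 1$. The Fourier transform is $\widehat{f}(\xi) = \int_{\mathbb{R}^n} e^{-i\xi\cdot x} f(x)\,dx$, with inverse $\mathcal{F}^{-1} f(x) = (2\pi)^{-n}\int_{\mathbb{R}^n} e^{ix\cdot\xi} f(\xi)\,d\xi$. Symbol class: for $m \in \mathbb{R}$, $S^m_{0,0}(\mathbb{R}^n, N)$ is the set of all $\sigma = \sigma(x, \xi_1, \dots, \xi_N) \in C^\infty((\mathbb{R}^n)^{N+1})$ such that for all multi-indices $\alpha, \beta_1, \dots, \beta_N \in \mathbb{N}_0^n$ there is a constant $C_{\alpha,\beta_1,\dots,\beta_N}$ with $$|\partial_x^\alpha \partial_{\xi_1}^{\beta_1} \cdots \partial_{\xi_N}^{\beta_N} \sigma(x, \xi_1, \dots, \xi_N)| \le C_{\alpha,\beta_1,\dots,\beta_N} (1 + |\xi_1| + \dots + |\xi_N|)^m .$$ Multilinear pseudo-differential operator: for $f_1, \dots, f_N \in \mathcal{S}(\mathbb{R}^n)$, $$T_\sigma(f_1, \dots, f_N)(x) = \frac{1}{(2\pi)^{Nn}} \int_{(\mathbb{R}^n)^N} e^{ix\cdot(\xi_1 + \dots + \xi_N)} \sigma(x, \xi_1,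 \dots, \xi_N) \prod_{j=1}^N \widehat{f_j}(\xi_j)\, d\xi_1 \cdots d\xi_N .$$ Boundedness: for quasi-normed function spaces $X_1, \dots, X_N, Y$ on $\mathbb{R}^n$, $T_\sigma$ is bounded from $X_1 \times \dots \times X_N$ to $Y$ if there is $C > 0$ such that $\|T_\sigma(f_1, \dots, f_N)\|_Y \le C \prod_{j=1}^N \|f_j\|_{X_j}$ for all $f_j \in \mathcal{S} \cap X_j$, $j = 1, \dots, N$. One writes $\mathrm{Op}(S^m_{0,0}(\mathbb{R}^n,N)) \subset B(X_1 \times \dots \times X_N \to Y)$ if $T_\sigma$ is bounded from $X_1 \times \dots \times X_N$ to $Y$ for all $\sigma \in S^m_{0,0}(\mathbb{R}^n, N)$. Besov spaces: let $\psi_k \in \mathcal{S}(\mathbb{R}^n)$, $k \ge 0$, satisfy $\operatorname{supp}\psi_0 \subset \{|\xi| \le 2\}$, $\operatorname{supp}\psi_k \subset \{2^{k-1} \le |\xi| \le 2^{k+1}\}$ for $k \ge 1$, $\|\partial^\alpha \psi_k\|_{L^\infty} \le C_\alpha 2^{-k|\alpha|}$ for all $\alpha \in \mathbb{N}_0^n$, $k \ge 0$, and $\sum_{k=0}^\infty \psi_k = 1$ on $\mathbb{R}^n$. With $\psi_k(D) f = \mathcal{F}^{-1}[\psi_k \widehat{f}]$, for $0 < p, q \le \infty$ and $s \in \mathbb{R}$ the space $B^s_{p,q}$ is the set of $f \in \mathcal{S}'(\mathbb{R}^n)$ such that $\|f\|_{B^s_{p,q}} = \big\| 2^{ks} \|\psi_k(D)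 f\|_{L^p} \big\|_{\ell^q_k(\mathbb{N}_0)} < \infty$ (different choices of $\{\psi_k\}$ give equivalent quasi-norms). *)

theory Defs
  imports "HOL-Probability.Essential_Supremum"
begin

section \<open>Partial derivatives, smooth functions, Schwartz functions\<close>

fun iter_partial :: "'a list \<Rightarrow> ('a::euclidean_space \<Rightarrow> complex) \<Rightarrow> 'a \<Rightarrow> complex" where
  "iter_partial [] f = f"
| "iter_partial (b # bs) f = (\<lambda>x. frechet_derivative (iter_partial bs f) (at x) b)"

text \<open>All iterated partial derivatives, of every order, exist as Frechet differentiable
  functions; this is C-infinity on the whole space.\<close>

definition smooth :: "('a::euclidean_space \<Rightarrow> complex) \<Rightarrow> bool" where
  "smooth f \<longleftrightarrow> (\<forall>bs. set bs \<subseteq> Basis \<longrightarrow> iter_partial bs f differentiable_on UNIV)"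

text \<open>A multi-index on a Euclidean space assigns a natural number to every coordinate direction,
  that is, to every vector in \<^const>\<open>Basis\<close>; its values outside \<^const>\<open>Basis\<close> are never used.
  On the product \<open>(real^'n) \<times> ((real^'n)^'N)\<close> such a function is exactly a tuple of multi-indices
  \<open>(\<alpha>, \<beta>\<^sub>1, \<dots>, \<beta>\<^sub>N)\<close>. The order in which the partial derivatives are taken is immaterial for
  smooth functions, so an arbitrary enumeration of \<^const>\<open>Basis\<close> is fixed.\<close>

definition basis_enum :: "'a::euclidean_space list" where
  "basis_enum = (SOME bs. distinct bs \<and> set bs = Basis)"

definition multi_partial :: "('a \<Rightarrow> nat) \<Rightarrow> ('a::euclidean_space \<Rightarrow> complex) \<Rightarrow> 'a \<Rightarrow> complex" where
  "multi_partial \<alpha> = iter_partial (concat (map (\<lambda>b. replicate (\<alpha> b) b) basis_enum))"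

definition multi_order :: "('a::euclidean_space \<Rightarrow> nat) \<Rightarrow> nat" where
  "multi_order \<alpha> = (\<Sum>b\<in>Basis. \<alpha> b)"

lemma basis_enum: "distinct (basis_enum :: 'a::euclidean_space list)"
  "set (basis_enum :: 'a list) = Basis"
proof -
  have "\<exists>bs :: 'a list. distinct bs \<and> set bs = Basis"
    using finite_distinct_list[OF finite_Basis] by blast
  from someI_ex[OF this] show "distinct (basis_enum :: 'a list)" "set (basis_enum :: 'a list) = Basis"
    unfolding basis_enum_def by blast+
qed

definition schwartz :: "('a::euclidean_space \<Rightarrow> complex) set" where
  "schwartz = {f. smooth f \<and>
     (\<forall>k \<alpha>. \<exists>C. \<forall>x. (1 + norm x) ^ k * norm (multi_partial \<alpha> f x) \<le> C)}"

definition schwartz_seminorm ::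
  "nat \<Rightarrow> ('a \<Rightarrow> nat) \<Rightarrow> ('a::euclidean_space \<Rightarrow> complex) \<Rightarrow> real" where
  "schwartz_seminorm k \<alpha> f = (SUP x. (1 + norm x) ^ k * norm (multi_partial \<alpha> f x))"

section \<open>Fourier transform and tempered distributions\<close>

definition fourier :: "(real^'n \<Rightarrow> complex) \<Rightarrow> real^'n \<Rightarrow> complex" where
  "fourier f \<xi> = (LINT x|lborel. cis (- (\<xi> \<bullet> x)) * f x)"

definition inv_fourier :: "(real^'n \<Rightarrow> complex) \<Rightarrow> real^'n \<Rightarrow> complex" where
  "inv_fourier f x = complex_of_real (1 / (2 * pi) ^ CARD('n)) * (LINT \<xi>|lborel. cis (x \<bullet> \<xi>) * f \<xi>)"

text \<open>Distributions are functionals on \<^const>\<open>schwartz\<close>; their values on other functions are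
  irrelevant. Since the Schwartz space is metrizable, continuity is sequential continuity, and by
  linearity it suffices to have it at the origin.\<close>

type_synonym 'n dist = "(real^'n \<Rightarrow> complex) \<Rightarrow> complex"

definition tempered :: "'n::finite dist \<Rightarrow> bool" where
  "tempered u \<longleftrightarrow>
     (\<forall>\<phi>\<in>schwartz. \<forall>\<eta>\<in>schwartz. u (\<lambda>x. \<phi> x + \<eta> x) = u \<phi> + u \<eta>) \<and>
     (\<forall>c. \<forall>\<phi>\<in>schwartz. u (\<lambda>x. c * \<phi> x) = c * u \<phi>) \<and>
     (\<forall>\<Phi> :: nat \<Rightarrow> _. (\<forall>i. \<Phi> i \<in> schwartz) \<and>
        (\<forall>k \<alpha>. (\<lambda>i. schwartz_seminorm k \<alpha> (\<Phi> i)) \<longlonglongrightarrow> 0) \<longrightarrow> (\<lambda>i. u (\<Phi> i)) \<longlonglongrightarrow> 0)"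

definition dist_of :: "(real^'n \<Rightarrow> complex) \<Rightarrow> 'n::finite dist" where
  "dist_of g = (\<lambda>\<phi>. LINT x|lborel. g x * \<phi> x)"

definition dist_fourier :: "'n::finite dist \<Rightarrow> 'n dist" where
  "dist_fourier u = (\<lambda>\<phi>. u (fourier \<phi>))"

definition dist_inv_fourier :: "'n::finite dist \<Rightarrow> 'n dist" where
  "dist_inv_fourier u = (\<lambda>\<phi>. u (inv_fourier \<phi>))"

definition dist_mult :: "(real^'n \<Rightarrow> complex) \<Rightarrow> 'n::finite dist \<Rightarrow> 'n dist" where
  "dist_mult \<psi> u = (\<lambda>\<phi>. u (\<lambda>\<xi>. \<psi> \<xi> * \<phi> \<xi>))"

definition fourier_multiplier :: "(real^'n \<Rightarrow> complex) \<Rightarrow> 'n::finite dist \<Rightarrow> 'n dist" where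
  "fourier_multiplier \<psi> u = dist_inv_fourier (dist_mult \<psi> (dist_fourier u))"

definition represents :: "(real^'n \<Rightarrow> complex) \<Rightarrow> 'n::finite dist \<Rightarrow> bool" where
  "represents g u \<longleftrightarrow> g \<in> borel_measurable lborel \<and>
     (\<forall>\<phi>\<in>schwartz. integrable lborel (\<lambda>x. g x * \<phi> x) \<and> u \<phi> = dist_of g \<phi>)"

section \<open>Lebesgue and Besov quasi-norms\<close>

text \<open>Exponents live in \<^typ>\<open>ennreal\<close>, where \<open>a / \<infinity> = 0\<close>. The following power is meant for
  exponents \<open>r > 0\<close>; then \<open>0\<^sup>r = 0\<close> and \<open>\<infinity>\<^sup>r = \<infinity>\<close>.\<close>

definition epowr :: "ennreal \<Rightarrow> real \<Rightarrow> ennreal" where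
  "epowr a r = (if a = \<infinity> then \<infinity> else ennreal (enn2real a powr r))"

definition Lp_norm :: "ennreal \<Rightarrow> (real^'n \<Rightarrow> complex) \<Rightarrow> ennreal" where
  "Lp_norm p g =
     (if p = \<infinity> then esssup lborel (\<lambda>x. ennreal (norm (g x)))
      else epowr (\<integral>\<^sup>+x. ennreal (norm (g x) powr enn2real p) \<partial>lborel) (1 / enn2real p))"

definition lq_norm :: "ennreal \<Rightarrow> (nat \<Rightarrow> ennreal) \<Rightarrow> ennreal" where
  "lq_norm q a =
     (if q = \<infinity> then (SUP k. a k)
      else epowr (\<Sum>k. epowr (a k) (enn2real q)) (1 / enn2real q))"

text \<open>The quasi-norm of a distribution is that of the function representing it (which is
  unique almost everywhere), and \<open>\<infinity>\<close> if there is no such function.\<close>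

definition dist_Lp_norm :: "ennreal \<Rightarrow> 'n::finite dist \<Rightarrow> ennreal" where
  "dist_Lp_norm p u = (INF g\<in>{g. represents g u}. Lp_norm p g)"

definition littlewood_paley :: "(nat \<Rightarrow> real^'n::finite \<Rightarrow> complex) \<Rightarrow> bool" where
  "littlewood_paley \<psi> \<longleftrightarrow>
     (\<forall>k. \<psi> k \<in> schwartz) \<and>
     closure {\<xi>. \<psi> 0 \<xi> \<noteq> 0} \<subseteq> {\<xi>. norm \<xi> \<le> 2} \<and>
     (\<forall>k\<ge>1. closure {\<xi>. \<psi> k \<xi> \<noteq> 0} \<subseteq> {\<xi>. 2 ^ (k - 1) \<le> norm \<xi> \<and> norm \<xi> \<le> 2 ^ (k + 1)}) \<and>
     (\<forall>\<alpha>. \<exists>C. \<forall>k \<xi>. norm (multi_partial \<alpha> (\<psi> k) \<xi>) \<le> C * 2 powr (- (real k * real (multi_order \<alpha>)))) \<and>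
     (\<forall>\<xi>. (\<lambda>k. \<psi> k \<xi>) sums 1)"

definition besov_norm ::
  "(nat \<Rightarrow> real^'n::finite \<Rightarrow> complex) \<Rightarrow> real \<Rightarrow> ennreal \<Rightarrow> ennreal \<Rightarrow> 'n dist \<Rightarrow> ennreal" where
  "besov_norm \<psi> s p q u =
     lq_norm q (\<lambda>k. ennreal (2 powr (real k * s)) * dist_Lp_norm p (fourier_multiplier (\<psi> k) u))"

text \<open>A quasi-normed space of distributions is given by its quasi-norm, extended by \<open>\<infinity>\<close>.\<close>

definition space_of :: "('n::finite dist \<Rightarrow> ennreal) \<Rightarrow> 'n dist set" where
  "space_of X = {u. tempered u \<and> X u < \<infinity>}"

section \<open>Multilinear pseudo-differential operators\<close>

text \<open>The integer \<open>N\<close> is the cardinality of the index type \<open>'N\<close>, and \<open>\<xi> $ j\<close> is \<open>\<xi>\<^sub>j\<close>.\<close>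

definition symbol_class :: "real \<Rightarrow> ((real^'n::finite) \<times> ((real^'n)^'N::finite) \<Rightarrow> complex) set" where
  "symbol_class m = {\<sigma>. smooth \<sigma> \<and>
     (\<forall>\<alpha>. \<exists>C. \<forall>x \<xi>. norm (multi_partial \<alpha> \<sigma> (x, \<xi>)) \<le> C * (1 + (\<Sum>j\<in>UNIV. norm (\<xi> $ j))) powr m)}"

definition pseudo_diff ::
  "((real^'n::finite) \<times> ((real^'n)^'N::finite) \<Rightarrow> complex) \<Rightarrow>
   ('N \<Rightarrow> real^'n \<Rightarrow> complex) \<Rightarrow> real^'n \<Rightarrow> complex" where
  "pseudo_diff \<sigma> f x =
     complex_of_real (1 / (2 * pi) ^ (CARD('N) * CARD('n))) *
     (LINT \<xi>|lborel. cis (x \<bullet> (\<Sum>j\<in>UNIV. \<xi> $ j)) * \<sigma> (x, \<xi>) * (\<Prod>j\<in>UNIV. fourier (f j) (\<xi> $ j)))"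

definition bounded_operator ::
  "(('N::finite \<Rightarrow> real^'n::finite \<Rightarrow> complex) \<Rightarrow> real^'n \<Rightarrow> complex) \<Rightarrow>
   ('N \<Rightarrow> 'n dist \<Rightarrow> ennreal) \<Rightarrow> ('n dist \<Rightarrow> ennreal) \<Rightarrow> bool" where
  "bounded_operator T X Y \<longleftrightarrow>
     (\<exists>C>0. \<forall>f. (\<forall>j. f j \<in> schwartz \<and> dist_of (f j) \<in> space_of (X j)) \<longrightarrow>
        Y (dist_of (T f)) \<le> ennreal C * (\<Prod>j\<in>UNIV. X j (dist_of (f j))))"

definition Op_subset_B ::
  "real \<Rightarrow> ('N::finite \<Rightarrow> 'n::finite dist \<Rightarrow> ennreal) \<Rightarrow> ('n dist \<Rightarrow> ennreal) \<Rightarrow> bool" where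
  "Op_subset_B m X Y \<longleftrightarrow>
     (\<forall>\<sigma> :: (real^'n) \<times> ((real^'n)^'N) \<Rightarrow> complex. \<sigma> \<in> symbol_class m \<longrightarrow>
        bounded_operator (pseudo_diff \<sigma>) X Y)"

section \<open>Exponents\<close>

definition conj_exponent :: "ennreal \<Rightarrow> ennreal" where
  "conj_exponent p = (if p \<le> 1 then \<infinity> else 1 / (1 - 1 / p))"

lemma conj_exponent: "1 / p + 1 / conj_exponent p = 1" if "1 < p"
proof -
  have "1 / p \<le> 1"
    using that less_trans[OF zero_less_one that] by (intro divide_le_posI_ennreal) auto
  moreover have inv_inv: "inverse (inverse x) = x" for x :: ennreal
  proof (cases x)
    case (real r)
    then show ?thesis by (cases "r = 0") (auto simp: inverse_ennreal)
  qed auto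
  moreover have "1 / conj_exponent p = 1 - 1 / p"
    using that by (simp add: conj_exponent_def divide_ennreal_def not_le inv_inv)
  ultimately show ?thesis by simp
qed

text \<open>The real number \<open>n / p\<close> for \<open>0 < p \<le> \<infinity>\<close>, where \<open>n\<close> is the cardinality of \<open>'n\<close>.\<close>

definition dim_over :: "'n::finite itself \<Rightarrow> ennreal \<Rightarrow> real" where
  "dim_over _ p = enn2real (of_nat CARD('n) / p)"

end

theory Submission
  imports Defs "HOL-Probability.Probability"
begin

text \<open>
  Suppose \<open>s\<^sub>j > max (n / p\<^sub>j) (n / 2)\<close> for some \<open>j\<close>. Freeze the \<open>j\<close>-th input at a fixed
  low-frequency function and let the other inputs and the output live at frequency about \<open>2\<^sup>k\<close>;
  the exponent \<open>m\<close> is then too large for an \<open>N - 1\<close>-linear operator. Similarly, if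
  \<open>s < min (n / p) (n / 2) - n = - max (n / p') (n / 2)\<close>, let all inputs live at frequency \<open>2\<^sup>k\<close> while
  the output stays at low frequency.

  The symbol is a sum of translates of one bump over lattice points \<open>(\<nu>\<^sub>1, \<dots>, \<nu>\<^sub>N)\<close> with arbitrary
  signs; such sums always belong to the class as long as the coefficients have the right size. An
  input whose Fourier transform equals \<open>\<plusminus>1\<close> near each of about \<open>2 powr (k n)\<close> lattice points has smallest
  \<open>L\<^sup>p\<close> quasi-norm when it is concentrated at a point (all signs equal, \<open>p \<le> 2\<close>) or spread over the unit ball
  (Rudin-Shapiro signs, \<open>p > 2\<close>), namely about \<open>2 powr (k (n - max (n / p) (n / 2)))\<close>; for the output one makes
  the opposite choice. The symbol undoes the signs of the inputs and imposes those of the output, so that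
  the output is an explicit exponential sum, and letting \<open>k\<close> tend to infinity compares the exponents.
  No bump function has to be constructed: the given function \<open>\<psi>\<^sub>0\<close> serves as one.
\<close>

section \<open>Smooth functions\<close>

text \<open>The constant in the assumed bound depends on the symbol, so testing a different symbol
  for each \<open>k\<close> would give nothing as \<open>k\<close> grows. A single symbol has to
  contain the configurations of all scales. It can, because the frequency in one slot determines
  \<open>k\<close>, and a test input of scale \<open>k\<close> then meets no node of another scale.

  The gain that breaks the bound is a count. One slot is determined by the others and the prescribed
  total frequency, so each output frequency is reached from \<open>2 powr (k * n * card J)\<close>
  combinations of the free slots, and the symbol lines all of them up with one sign. Together with
  the coefficient size \<open>2 powr (k * m)\<close> this gives the size of the output; the other
  side is the product of the input quasi-norms.

  For exponents below 1 neither Minkowski's nor Young's inequality is available. Upper bounds are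
  therefore pointwise decay estimates, and lower bounds come from pigeonholing on sets where a
  function is large. The pieces of the output need no bound from above, since it is enough that one
  of them is large.\<close>

abbreviation dpart :: "'a::euclidean_space \<Rightarrow> ('a \<Rightarrow> complex) \<Rightarrow> 'a \<Rightarrow> complex" where
  "dpart v f \<equiv> \<lambda>x. frechet_derivative f (at x) v"

text \<open>Directions are arbitrary vectors here, not only those in \<open>Basis\<close>: a linear
  change of variables sends a basis direction to an arbitrary one, and in this form the chain rule
  stays within the class. The notion agrees with \<open>smooth\<close>.\<close>

definition smooth_all :: "('a::euclidean_space \<Rightarrow> complex) \<Rightarrow> bool" where
  "smooth_all f \<longleftrightarrow> (\<forall>vs x. iter_partial vs f differentiable (at x))"

lemma iter_partial_snoc: "iter_partial (vs @ [v]) f = iter_partial vs (dpart v f)"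
  by (induction vs) auto

lemma iter_partial_append: "iter_partial (us @ vs) f = iter_partial us (iter_partial vs f)"
  by (induction us) auto

lemma smooth_all_differentiable: "smooth_all f \<Longrightarrow> f differentiable (at x)"
  unfolding smooth_all_def by (metis iter_partial.simps(1))

lemma smooth_all_dpart: "smooth_all f \<Longrightarrow> smooth_all (dpart v f)"
  unfolding smooth_all_def iter_partial_snoc[symmetric] by blast

lemma smooth_all_iter_partial: "smooth_all f \<Longrightarrow> smooth_all (iter_partial vs f)"
  unfolding smooth_all_def iter_partial_append[symmetric] by blast

lemma smooth_all_has_derivative:
  "smooth_all f \<Longrightarrow> (f has_derivative (\<lambda>v. dpart v f x)) (at x)"
  using smooth_all_differentiable frechet_derivative_works by blast

lemma smooth_all_continuous: "smooth_all f \<Longrightarrow> continuous_on A f"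
  by (meson continuous_at_imp_continuous_on differentiable_imp_continuous_within smooth_all_differentiable)

lemma smooth_all_measurable: "smooth_all f \<Longrightarrow> f \<in> borel_measurable borel"
  using smooth_all_continuous borel_measurable_continuous_onI by blast

lemma smooth_all_coinduct:
  assumes "P f" and step: "\<And>g. P g \<Longrightarrow> (\<forall>x. g differentiable (at x)) \<and> (\<forall>v. P (dpart v g))"
  shows "smooth_all f"
proof -
  have "P (iter_partial vs f)" for vs
    by (induction vs) (use assms in auto)
  then show ?thesis using step unfolding smooth_all_def by blast
qed

lemma smooth_all_smooth: "smooth_all f \<Longrightarrow> smooth f"
  unfolding smooth_all_def smooth_def
  by (simp add: differentiable_at_imp_differentiable_on)

lemma dpart_eqI: "(f has_derivative f') (at x) \<Longrightarrow> dpart v f x = f' v"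
  by (metis frechet_derivative_at)

text \<open>Differentiating a product gives a sum of products, so the coinductive proof of smoothness
  works up to the algebra generated by a set of functions.\<close>

inductive deriv_alg :: "(('a::euclidean_space \<Rightarrow> complex) \<Rightarrow> bool) \<Rightarrow> ('a \<Rightarrow> complex) \<Rightarrow> bool" for B where
  deriv_alg_base: "B f \<Longrightarrow> deriv_alg B f"
| deriv_alg_const: "deriv_alg B (\<lambda>x. c)"
| deriv_alg_add: "deriv_alg B f \<Longrightarrow> deriv_alg B g \<Longrightarrow> deriv_alg B (\<lambda>x. f x + g x)"
| deriv_alg_mult: "deriv_alg B f \<Longrightarrow> deriv_alg B g \<Longrightarrow> deriv_alg B (\<lambda>x. f x * g x)"
| deriv_alg_cnj: "deriv_alg B f \<Longrightarrow> deriv_alg B (\<lambda>x. cnj (f x))"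

lemma deriv_alg_sum: "finite I \<Longrightarrow> (\<And>i. i \<in> I \<Longrightarrow> deriv_alg B (f i)) \<Longrightarrow> deriv_alg B (\<lambda>x. \<Sum>i\<in>I. f i x)"
  by (induction I rule: finite_induct) (auto intro: deriv_alg.intros)

lemma deriv_alg_dpart:
  assumes "deriv_alg B f" and base: "\<And>f. B f \<Longrightarrow> (\<forall>x. f differentiable (at x)) \<and> (\<forall>v. deriv_alg B (dpart v f))"
  shows "(\<forall>x. f differentiable (at x)) \<and> (\<forall>v. deriv_alg B (dpart v f))"
  using assms(1)
proof induction
  case (deriv_alg_base f) then show ?case using base by blast
next
  case (deriv_alg_const c) then show ?case by (simp add: deriv_alg.intros)
next
  case (deriv_alg_add f g)
  have d: "((\<lambda>x. f x + g x) has_derivative (\<lambda>v. dpart v f x + dpart v g x)) (at x)" for x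
    using deriv_alg_add.IH frechet_derivative_works by (intro has_derivative_add) blast+
  have "dpart v (\<lambda>x. f x + g x) = (\<lambda>x. dpart v f x + dpart v g x)" for v
    using dpart_eqI[OF d] by blast
  then show ?case using d deriv_alg_add.IH by (auto simp: differentiable_def intro: deriv_alg.intros)
next
  case (deriv_alg_mult f g)
  have d: "((\<lambda>x. f x * g x) has_derivative (\<lambda>v. f x * dpart v g x + dpart v f x * g x)) (at x)" for x
    using deriv_alg_mult.IH frechet_derivative_works by (intro has_derivative_mult) blast+
  have "dpart v (\<lambda>x. f x * g x) = (\<lambda>x. f x * dpart v g x + dpart v f x * g x)" for v
    using dpart_eqI[OF d] by blast
  then show ?case using d deriv_alg_mult by (auto simp: differentiable_def intro!: deriv_alg.intros(3,4))
next
  case (deriv_alg_cnj f)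
  have d: "((\<lambda>x. cnj (f x)) has_derivative (\<lambda>v. cnj (dpart v f x))) (at x)" for x
    using deriv_alg_cnj.IH frechet_derivative_works by (intro has_derivative_cnj) blast
  have "dpart v (\<lambda>x. cnj (f x)) = (\<lambda>x. cnj (dpart v f x))" for v
    using dpart_eqI[OF d] by blast
  then show ?case using d deriv_alg_cnj by (auto simp: differentiable_def intro!: deriv_alg.intros(5))
qed

lemma deriv_alg_smooth_all:
  assumes "deriv_alg B f" and base: "\<And>f. B f \<Longrightarrow> (\<forall>x. f differentiable (at x)) \<and> (\<forall>v. deriv_alg B (dpart v f))"
  shows "smooth_all f"
  by (rule smooth_all_coinduct[where P="deriv_alg B"]) (use assms deriv_alg_dpart[OF _ base] in blast)+

text \<open>Taking the smooth functions themselves as generators turns the closure rules of the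
  algebra into closure rules for smooth functions, without a Leibniz formula for higher
  derivatives.\<close>

lemma deriv_alg_smooth_all_iff: "deriv_alg smooth_all f \<longleftrightarrow> smooth_all f"
proof
  assume f: "deriv_alg smooth_all f"
  show "smooth_all f"
    by (rule deriv_alg_smooth_all[OF f]) (auto intro: deriv_alg_base smooth_all_dpart smooth_all_differentiable)
qed (rule deriv_alg_base)

lemma smooth_all_const: "smooth_all (\<lambda>x. c)"
  using deriv_alg_const[of smooth_all] by (simp only: deriv_alg_smooth_all_iff)

lemma smooth_all_add: "smooth_all f \<Longrightarrow> smooth_all g \<Longrightarrow> smooth_all (\<lambda>x. f x + g x)"
  using deriv_alg_add[of smooth_all] by (simp only: deriv_alg_smooth_all_iff)

lemma smooth_all_mult: "smooth_all f \<Longrightarrow> smooth_all g \<Longrightarrow> smooth_all (\<lambda>x. f x * g x)"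
  using deriv_alg_mult[of smooth_all] by (simp only: deriv_alg_smooth_all_iff)

lemma smooth_all_cnj: "smooth_all f \<Longrightarrow> smooth_all (\<lambda>x. cnj (f x))"
  using deriv_alg_cnj[of smooth_all] by (simp only: deriv_alg_smooth_all_iff)

lemma smooth_all_sum: "finite I \<Longrightarrow> (\<And>i. i \<in> I \<Longrightarrow> smooth_all (f i)) \<Longrightarrow> smooth_all (\<lambda>x. \<Sum>i\<in>I. f i x)"
  by (induction I rule: finite_induct) (simp_all add: smooth_all_const smooth_all_add)

lemma smooth_all_prod: "finite I \<Longrightarrow> (\<And>i. i \<in> I \<Longrightarrow> smooth_all (f i)) \<Longrightarrow> smooth_all (\<lambda>x. \<Prod>i\<in>I. f i x)"
  by (induction I rule: finite_induct) (simp_all add: smooth_all_const smooth_all_mult)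

lemma smooth_all_linear: "smooth_all (\<lambda>x. complex_of_real (x \<bullet> w))"
proof -
  let ?B = "\<lambda>f. f = (\<lambda>x::'a. complex_of_real (x \<bullet> w))"
  have d: "((\<lambda>x. complex_of_real (x \<bullet> w)) has_derivative (\<lambda>v. complex_of_real (v \<bullet> w))) (at x)" for x
    by (auto intro!: derivative_eq_intros)
  show ?thesis
    by (rule deriv_alg_smooth_all[of ?B])
      (use d dpart_eqI[OF d] in \<open>auto simp: differentiable_def intro: deriv_alg.intros(1,2)\<close>)
qed

lemma has_derivative_cis_linear:
  "((\<lambda>x. cis (x \<bullet> w)) has_derivative (\<lambda>v. \<i> * complex_of_real (v \<bullet> w) * cis (x \<bullet> w))) (at x)"
proof -
  have "((\<lambda>x. \<i> * complex_of_real (x \<bullet> w)) has_derivative (\<lambda>v. \<i> * complex_of_real (v \<bullet> w))) (at x)"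
    by (auto intro!: derivative_eq_intros)
  from has_derivative_compose[OF this DERIV_exp[unfolded has_field_derivative_def]]
  show ?thesis by (simp add: cis_conv_exp mult.commute)
qed

lemma smooth_all_cis: "smooth_all (\<lambda>x. cis (x \<bullet> w))"
proof -
  let ?B = "\<lambda>f. f = (\<lambda>x::'a. cis (x \<bullet> w))"
  have "deriv_alg ?B (dpart v (\<lambda>x. cis (x \<bullet> w)))" for v
  proof -
    have "dpart v (\<lambda>x. cis (x \<bullet> w)) = (\<lambda>x. \<i> * complex_of_real (v \<bullet> w) * cis (x \<bullet> w))"
      using dpart_eqI[OF has_derivative_cis_linear] by blast
    moreover have "deriv_alg ?B (\<lambda>x. \<i> * complex_of_real (v \<bullet> w) * cis (x \<bullet> w))"
      by (rule deriv_alg_mult[OF deriv_alg_const deriv_alg_base]) simp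
    ultimately show ?thesis by simp
  qed
  moreover have "(\<lambda>x. cis (x \<bullet> w)) differentiable (at x)" for x
    using has_derivative_cis_linear differentiable_def by blast
  ultimately show ?thesis
    by (intro deriv_alg_smooth_all[of ?B] deriv_alg_base) auto
qed

section \<open>Arbitrary directions, affine substitution and locality of derivatives\<close>

lemma frechet_linear_expand:
  fixes f :: "'a::euclidean_space \<Rightarrow> complex"
  assumes "f differentiable (at x)"
  shows "dpart v f x = (\<Sum>e\<in>Basis. complex_of_real (v \<bullet> e) * dpart e f x)"
proof -
  have lin: "linear (frechet_derivative f (at x))"
    using assms linear_frechet_derivative by blast
  have "frechet_derivative f (at x) v = frechet_derivative f (at x) (\<Sum>e\<in>Basis. (v \<bullet> e) *\<^sub>R e)"
    by (simp add: euclidean_representation)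
  also have "\<dots> = (\<Sum>e\<in>Basis. (v \<bullet> e) *\<^sub>R frechet_derivative f (at x) e)"
    using lin by (simp add: linear_sum linear_cmul)
  finally show ?thesis by (simp add: scaleR_conv_of_real)
qed

text \<open>A derivative in an arbitrary direction is a combination of the derivatives along
  \<open>Basis\<close>, so the algebra generated by the iterated partial derivatives along
  \<open>Basis\<close> is closed under differentiation in every direction.\<close>

lemma smooth_smooth_all: assumes "smooth f" shows "smooth_all f"
proof -
  let ?B = "\<lambda>g. \<exists>bs. set bs \<subseteq> Basis \<and> g = iter_partial bs f"
  have diff: "\<forall>x. iter_partial bs f differentiable (at x)" if "set bs \<subseteq> Basis" for bs
    using assms that unfolding smooth_def by (simp add: differentiable_on_def)
  have "deriv_alg ?B (dpart v (iter_partial bs f))" if bs: "set bs \<subseteq> Basis" for bs v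
  proof -
    have "dpart v (iter_partial bs f) = (\<lambda>x. \<Sum>e\<in>Basis. complex_of_real (v \<bullet> e) * iter_partial (e # bs) f x)"
      using frechet_linear_expand diff[OF bs] by fastforce
    moreover have "deriv_alg ?B (\<lambda>x. \<Sum>e\<in>Basis. complex_of_real (v \<bullet> e) * iter_partial (e # bs) f x)"
      by (intro deriv_alg_sum deriv_alg_mult deriv_alg_const deriv_alg_base) (use bs in \<open>auto intro!: exI[of _ "_ # bs"]\<close>)
    ultimately show ?thesis by simp
  qed
  then show ?thesis
    using diff by (intro deriv_alg_smooth_all[of ?B f] deriv_alg_base[of ?B]) (auto intro: exI[of _ "[]"])
qed

lemma iter_partial_affine:
  fixes L :: "'a::euclidean_space \<Rightarrow> 'b::euclidean_space"
  assumes L: "linear L" and f: "smooth_all f"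
  shows "iter_partial vs (\<lambda>x. f (a + L x)) = (\<lambda>x. iter_partial (map L vs) f (a + L x))"
proof (induction vs)
  case (Cons v vs)
  have "((\<lambda>x. iter_partial (map L vs) f (a + L x)) has_derivative
        (\<lambda>v. dpart (L v) (iter_partial (map L vs) f) (a + L x))) (at x)" for x
  proof -
    have "((\<lambda>x. a + L x) has_derivative L) (at x)"
      using L by (auto intro!: derivative_eq_intros linear_imp_has_derivative)
    from diff_chain_at[OF this smooth_all_has_derivative[OF smooth_all_iter_partial[OF f, of "map L vs"]]]
    show ?thesis by (simp add: o_def)
  qed
  then show ?case by (auto simp: Cons dest!: dpart_eqI)
qed simp

lemma smooth_all_affine:
  fixes L :: "'a::euclidean_space \<Rightarrow> 'b::euclidean_space"
  assumes L: "linear L" and f: "smooth_all f"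
  shows "smooth_all (\<lambda>x. f (a + L x))"
  unfolding smooth_all_def
proof (intro allI)
  fix vs x
  have "((\<lambda>x. a + L x) has_derivative L) (at x)"
    using L by (auto intro!: derivative_eq_intros linear_imp_has_derivative)
  from diff_chain_at[OF this smooth_all_has_derivative[OF smooth_all_iter_partial[OF f, of "map L vs"]]]
  show "iter_partial vs (\<lambda>x. f (a + L x)) differentiable (at x)"
    unfolding iter_partial_affine[OF L f] differentiable_def by (auto simp: o_def)
qed

lemma iter_partial_cong_open:
  assumes "open U" and "\<And>x. x \<in> U \<Longrightarrow> f x = g x" and "x \<in> U"
  shows "iter_partial vs f x = iter_partial vs g x"
  using assms(3)
proof (induction vs arbitrary: x)
  case Nil then show ?case using assms by simp
next
  case (Cons v vs)
  have "(iter_partial vs f has_derivative f') (at x) \<longleftrightarrow> (iter_partial vs g has_derivative f') (at x)" for f'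
    using Cons.IH Cons.prems assms(1) by (metis has_derivative_transform_within_open)
  then show ?case by (simp add: frechet_derivative_def)
qed

text \<open>Serves symbols given by rounding: the formula is discontinuous in form, yet near every
  point it coincides with a smooth function.\<close>

lemma smooth_all_local:
  assumes "\<And>x. \<exists>U g. open U \<and> x \<in> U \<and> smooth_all g \<and> (\<forall>y\<in>U. f y = g y)"
  shows "smooth_all f"
  unfolding smooth_all_def
proof (intro allI)
  fix vs x
  obtain U g where U: "open U" "x \<in> U" "smooth_all g" "\<forall>y\<in>U. f y = g y"
    using assms by blast
  have "(iter_partial vs g has_derivative (\<lambda>v. dpart v (iter_partial vs g) x)) (at x)"
    by (rule smooth_all_has_derivative[OF smooth_all_iter_partial[OF U(3)]])
  then have "(iter_partial vs f has_derivative (\<lambda>v. dpart v (iter_partial vs g) x)) (at x)"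
    using iter_partial_cong_open[OF U(1), of f g] U
    by (metis (mono_tags, lifting) has_derivative_transform_within_open)
  then show "iter_partial vs f differentiable (at x)" by (auto simp: differentiable_def)
qed

section \<open>Smooth functions with compact support\<close>

definition cc_smooth :: "('a::euclidean_space \<Rightarrow> complex) \<Rightarrow> bool" where
  "cc_smooth h \<longleftrightarrow> smooth_all h \<and> (\<exists>r. \<forall>x. norm x > r \<longrightarrow> h x = 0)"

lemma iter_partial_zero: "iter_partial vs (\<lambda>x. 0) = (\<lambda>x. 0)"
  by (induction vs) auto

lemma iter_partial_vanishes:
  assumes "closed K" and "\<And>x. x \<notin> K \<Longrightarrow> h x = 0" and "x \<notin> K"
  shows "iter_partial vs h x = 0"
  using iter_partial_cong_open[of "- K" h "\<lambda>x. 0" x vs] assms by (auto simp: iter_partial_zero)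

lemma cc_smooth_iter_partial: assumes "cc_smooth h" shows "cc_smooth (iter_partial vs h)"
proof -
  obtain r where r: "\<And>x. norm x > r \<Longrightarrow> h x = 0" using assms unfolding cc_smooth_def by blast
  have "iter_partial vs h x = 0" if "norm x > r" for x
    by (rule iter_partial_vanishes[of "cball 0 r"]) (use r that in auto)
  then show ?thesis using assms smooth_all_iter_partial unfolding cc_smooth_def by blast
qed

lemma cc_smooth_bounded: assumes "cc_smooth h" shows "\<exists>C. \<forall>x. norm (h x) \<le> C"
proof -
  obtain r where r: "\<And>x. norm x > r \<Longrightarrow> h x = 0" using assms unfolding cc_smooth_def by blast
  have "compact (h ` cball 0 r)"
    using assms unfolding cc_smooth_def by (intro compact_continuous_image smooth_all_continuous) auto
  then have "bounded (h ` cball 0 r)" by (rule compact_imp_bounded)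
  then obtain C where "\<forall>y\<in>h ` cball 0 r. norm y \<le> C"
    unfolding bounded_iff by blast
  then have C: "norm (h x) \<le> C" if "norm x \<le> r" for x using that by simp
  have "norm (h x) \<le> max C 0" for x
    using C[of x] r[of x] by (cases "norm x \<le> r") auto
  then show ?thesis by blast
qed

lemma cc_smooth_mult: "cc_smooth h \<Longrightarrow> smooth_all g \<Longrightarrow> cc_smooth (\<lambda>x. h x * g x)"
  unfolding cc_smooth_def by (metis mult_zero_left smooth_all_mult)

lemma cc_smooth_mult': "cc_smooth h \<Longrightarrow> smooth_all g \<Longrightarrow> cc_smooth (\<lambda>x. g x * h x)"
  using cc_smooth_mult[of h g] by (simp add: mult.commute)

lemma cc_smooth_add: assumes "cc_smooth f" "cc_smooth g" shows "cc_smooth (\<lambda>x. f x + g x)"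
proof -
  obtain r s where "\<And>x. norm x > r \<Longrightarrow> f x = 0" "\<And>x. norm x > s \<Longrightarrow> g x = 0"
    using assms unfolding cc_smooth_def by blast
  then have "\<forall>x. norm x > max r s \<longrightarrow> f x + g x = 0" by auto
  then show ?thesis using assms smooth_all_add unfolding cc_smooth_def by blast
qed

lemma cc_smooth_zero: "cc_smooth (\<lambda>x. 0)"
  unfolding cc_smooth_def by (simp add: smooth_all_const)

lemma cc_smooth_sum: "finite I \<Longrightarrow> (\<And>i. i \<in> I \<Longrightarrow> cc_smooth (f i)) \<Longrightarrow> cc_smooth (\<lambda>x. \<Sum>i\<in>I. f i x)"
  by (induction I rule: finite_induct) (auto intro: cc_smooth_add cc_smooth_zero)

lemma cc_smooth_scale:
  assumes "cc_smooth h" "c \<noteq> 0"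
  shows "cc_smooth (\<lambda>x. h (c *\<^sub>R (x - a)))"
proof -
  obtain r where r: "\<And>x. norm x > r \<Longrightarrow> h x = 0" using assms unfolding cc_smooth_def by blast
  have "smooth_all (\<lambda>x. h (- c *\<^sub>R a + c *\<^sub>R x))"
    by (rule smooth_all_affine) (use assms in \<open>auto simp: cc_smooth_def\<close>)
  then have "smooth_all (\<lambda>x. h (c *\<^sub>R (x - a)))" by (simp add: scaleR_diff_right)
  moreover have "h (c *\<^sub>R (x - a)) = 0" if "norm x > norm a + r / \<bar>c\<bar>" for x
  proof -
    have "r / \<bar>c\<bar> < norm (x - a)" using that norm_triangle_ineq2[of x a] by linarith
    then show ?thesis using assms by (intro r) (simp add: pos_divide_less_eq mult.commute)
  qed
  ultimately show ?thesis unfolding cc_smooth_def by blast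
qed

section \<open>Oscillatory integrals of rapidly decreasing functions\<close>

lemma nn_integral_lborel_affine:
  fixes f :: "'a::euclidean_space \<Rightarrow> ennreal"
  assumes [measurable]: "f \<in> borel_measurable borel" and c: "c \<noteq> 0"
  shows "(\<integral>\<^sup>+x. f x \<partial>lborel) = ennreal (\<bar>c\<bar> ^ DIM('a)) * (\<integral>\<^sup>+x. f (t + c *\<^sub>R x) \<partial>lborel)"
  by (subst lborel_affine[OF c, of t])
     (simp add: nn_integral_density nn_integral_distr nn_integral_cmult)

lemma integrable_lborel_affine:
  fixes f :: "'a::euclidean_space \<Rightarrow> 'b::{banach,second_countable_topology}"
  assumes f: "integrable lborel f" and c: "c \<noteq> 0"
  shows "integrable lborel (\<lambda>x. f (t + c *\<^sub>R x))"
proof -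
  have [measurable]: "f \<in> borel_measurable borel" using f by auto
  have "(\<integral>\<^sup>+x. ennreal (norm (f x)) \<partial>lborel) < \<infinity>" using f unfolding integrable_iff_bounded by simp
  then show ?thesis
    using c unfolding integrable_iff_bounded
    by (subst (asm) nn_integral_lborel_affine[where c=c and t=t]) (auto simp: ennreal_mult_less_top)
qed

lemma integral_lborel_affine:
  fixes f :: "'a::euclidean_space \<Rightarrow> 'b::{banach,second_countable_topology}"
  assumes c: "c \<noteq> 0" and f: "integrable lborel f"
  shows "integral\<^sup>L lborel f = (\<bar>c\<bar> ^ DIM('a)) *\<^sub>R (\<integral>x. f (t + c *\<^sub>R x) \<partial>lborel)"
proof -
  have [measurable]: "f \<in> borel_measurable borel" using f by auto
  show ?thesis
    by (subst lborel_affine[OF c, of t])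
       (simp add: integral_density integral_distr)
qed

lemma lborel_prod_integral:
  fixes f :: "'a::euclidean_space \<Rightarrow> real \<Rightarrow> 'b::{real_normed_field,banach,second_countable_topology}"
  assumes int: "\<And>b. b \<in> Basis \<Longrightarrow> integrable lborel (f b)"
  shows "integrable lborel (\<lambda>x. \<Prod>b\<in>Basis. f b (x \<bullet> b))"
    and "(\<integral>x. (\<Prod>b\<in>Basis. f b (x \<bullet> b)) \<partial>lborel) = (\<Prod>b\<in>Basis. integral\<^sup>L lborel (f b))"
proof -
  interpret product_sigma_finite "\<lambda>b::'a. lborel :: real measure" ..
  have [measurable]: "b \<in> Basis \<Longrightarrow> f b \<in> borel_measurable borel" for b using int by auto
  have T[measurable]: "(\<lambda>g. \<Sum>b\<in>Basis. g b *\<^sub>R b) \<in> (\<Pi>\<^sub>M b\<in>(Basis::'a set). lborel) \<rightarrow>\<^sub>M borel"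
    by measurable
  have M: "(\<lambda>x::'a. \<Prod>b\<in>Basis. f b (x \<bullet> b)) \<in> borel_measurable borel"
    by measurable
  have L: "(lborel :: 'a measure) = distr (\<Pi>\<^sub>M b\<in>Basis. lborel) borel (\<lambda>g. \<Sum>b\<in>Basis. g b *\<^sub>R b)"
    by (rule lborel_eq)
  have 1: "integrable (\<Pi>\<^sub>M b\<in>(Basis::'a set). lborel) (\<lambda>x. \<Prod>b\<in>Basis. f b (x b))"
    by (rule product_integrable_prod) (auto intro: int)
  have 2: "(\<integral>x. (\<Prod>b\<in>Basis. f b (x b)) \<partial>(\<Pi>\<^sub>M b\<in>(Basis::'a set). lborel)) = (\<Prod>b\<in>Basis. integral\<^sup>L lborel (f b))"
    by (rule product_integral_prod) (auto intro: int)
  show "integrable lborel (\<lambda>x. \<Prod>b\<in>Basis. f b (x \<bullet> b))"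
    unfolding L using 1 by (subst integrable_distr_eq[OF T M]) simp
  show "(\<integral>x. (\<Prod>b\<in>Basis. f b (x \<bullet> b)) \<partial>lborel) = (\<Prod>b\<in>Basis. integral\<^sup>L lborel (f b))"
    unfolding L 2[symmetric] by (subst integral_distr[OF T M]) simp
qed

lemma integrable_one_div_one_plus_square: "integrable lborel (\<lambda>x::real. 1 / (1 + x\<^sup>2))"
  using integrable_inverse_1_plus_square
  by (simp add: set_integrable_def einterval_def inverse_eq_divide)

text \<open>For every coordinate, \<open>1 + (x \<bullet> b)\<^sup>2\<close> is at most
  \<open>(1 + norm x)\<^sup>2\<close>, so the weight lies below a tensor product of integrable
  functions of one variable. This is the origin of the decay rate \<open>2 * DIM('a)\<close> that
  recurs wherever a weight has to be integrated over the whole space.\<close>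

lemma integrable_weight:
  assumes k: "k \<ge> 2 * DIM('a)"
  shows "integrable lborel (\<lambda>x::'a::euclidean_space. 1 / (1 + norm x) ^ k)"
proof (rule Bochner_Integration.integrable_bound)
  show "integrable lborel (\<lambda>x::'a. \<Prod>b\<in>Basis. 1 / (1 + (x \<bullet> b)\<^sup>2))"
    by (rule lborel_prod_integral) (rule integrable_one_div_one_plus_square)
  show "(\<lambda>x::'a. 1 / (1 + norm x) ^ k) \<in> borel_measurable lborel" by measurable
  have "norm (1 / (1 + norm x) ^ k) \<le> norm (\<Prod>b\<in>Basis. 1 / (1 + (x \<bullet> b)\<^sup>2))" for x :: 'a
  proof -
    have "(\<Prod>b\<in>(Basis::'a set). 1 + (x \<bullet> b)\<^sup>2) \<le> (\<Prod>b\<in>(Basis::'a set). (1 + norm x)\<^sup>2)"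
    proof (rule prod_mono, safe)
      fix b :: 'a assume "b \<in> Basis"
      then have "(x \<bullet> b)\<^sup>2 \<le> (norm x)\<^sup>2"
        using Basis_le_norm by (metis abs_le_square_iff abs_norm_cancel)
      then show "1 + (x \<bullet> b)\<^sup>2 \<le> (1 + norm x)\<^sup>2" by (simp add: power2_sum add_increasing2)
    qed simp
    also have "\<dots> = (1 + norm x) ^ (2 * DIM('a))" by (simp add: power_mult)
    also have "\<dots> \<le> (1 + norm x) ^ k" using k by (intro power_increasing) auto
    finally have *: "(\<Prod>b\<in>(Basis::'a set). 1 + (x \<bullet> b)\<^sup>2) \<le> (1 + norm x) ^ k" .
    have pos: "(\<Prod>b\<in>(Basis::'a set). 1 + (x \<bullet> b)\<^sup>2) > 0"
      by (intro prod_pos) (simp add: add_pos_nonneg)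
    have "(\<Prod>b\<in>(Basis::'a set). 1 / (1 + (x \<bullet> b)\<^sup>2)) = 1 / (\<Prod>b\<in>(Basis::'a set). 1 + (x \<bullet> b)\<^sup>2)"
      by (simp add: prod_dividef)
    then show ?thesis using * pos by (simp add: frac_le)
  qed
  then show "AE x in lborel. norm (1 / (1 + norm x) ^ k) \<le> norm (\<Prod>b\<in>(Basis::'a set). 1 / (1 + (x \<bullet> b)\<^sup>2))"
    by simp
qed

text \<open>Integrable moments of all orders are what differentiation under the integral sign
  consumes, and multiplication by a coordinate does not leave the class. Schwartz functions and
  smooth functions of compact support both belong to it.\<close>

definition rapid :: "('a::euclidean_space \<Rightarrow> complex) \<Rightarrow> bool" where
  "rapid h \<longleftrightarrow> h \<in> borel_measurable borel \<and> (\<forall>k. integrable lborel (\<lambda>x. (1 + norm x) ^ k * norm (h x)))"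

lemma rapid_measurable: "rapid h \<Longrightarrow> h \<in> borel_measurable borel"
  unfolding rapid_def by blast

lemma rapidI:
  fixes h :: "'a::euclidean_space \<Rightarrow> complex"
  assumes [measurable]: "h \<in> borel_measurable borel" and "\<And>k. \<exists>C. \<forall>x. (1 + norm x) ^ k * norm (h x) \<le> C"
  shows "rapid h"
  unfolding rapid_def
proof (intro conjI allI assms(1))
  fix k
  let ?n = "2 * DIM('a)"
  obtain C where C: "\<And>x. (1 + norm x) ^ (k + ?n) * norm (h x) \<le> C" using assms(2) by blast
  show "integrable lborel (\<lambda>x. (1 + norm x) ^ k * norm (h x))"
  proof (rule Bochner_Integration.integrable_bound)
    show "integrable lborel (\<lambda>x::'a. C * (1 / (1 + norm x) ^ ?n))"
      by (rule integrable_mult_right[OF integrable_weight]) simp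
    have "norm ((1 + norm x) ^ k * norm (h x)) \<le> norm (C * (1 / (1 + norm x) ^ ?n))" for x
    proof -
      have "0 \<le> (1 + norm x) ^ (k + ?n) * norm (h x)" by simp
      then have "0 \<le> C" using C[of x] by linarith
      moreover have "(1 + norm x) ^ k * norm (h x) \<le> C / (1 + norm x) ^ ?n"
        using C[of x] by (subst pos_le_divide_eq) (auto simp: power_add mult_ac add_pos_nonneg)
      ultimately show ?thesis by simp
    qed
    then show "AE x in lborel. norm ((1 + norm x) ^ k * norm (h x)) \<le> norm (C * (1 / (1 + norm x) ^ ?n))"
      by simp
  qed measurable
qed

lemma rapid_integrable: assumes "rapid h" shows "integrable lborel h"
proof -
  have [measurable]: "h \<in> borel_measurable borel" using assms by (rule rapid_measurable)
  have "integrable lborel (\<lambda>x. (1 + norm x) ^ 0 * norm (h x))" using assms unfolding rapid_def by blast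
  then show ?thesis by (subst integrable_norm_iff[symmetric]) simp_all
qed

lemma rapid_mult_bound:
  assumes h: "rapid h" and [measurable]: "g \<in> borel_measurable borel"
    and b: "\<And>x. norm (g x) \<le> C * (1 + norm x) ^ m"
  shows "rapid (\<lambda>x. g x * h x)"
  unfolding rapid_def
proof (intro conjI allI)
  have [measurable]: "h \<in> borel_measurable borel" using h by (rule rapid_measurable)
  show "(\<lambda>x. g x * h x) \<in> borel_measurable borel" by measurable
  fix k
  show "integrable lborel (\<lambda>x. (1 + norm x) ^ k * norm (g x * h x))"
  proof (rule Bochner_Integration.integrable_bound)
    show "integrable lborel (\<lambda>x. C * ((1 + norm x) ^ (k + m) * norm (h x)))"
      by (rule integrable_mult_right) (use h in \<open>simp add: rapid_def\<close>)
    have "norm ((1 + norm x) ^ k * norm (g x * h x)) \<le> norm (C * ((1 + norm x) ^ (k + m) * norm (h x)))" for x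
    proof -
      have "(1 + norm x) ^ k * norm (g x * h x) \<le> (1 + norm x) ^ k * ((C * (1 + norm x) ^ m) * norm (h x))"
        unfolding norm_mult by (intro mult_left_mono mult_right_mono b) auto
      also have "\<dots> = C * ((1 + norm x) ^ (k + m) * norm (h x))" by (simp add: power_add)
      finally show ?thesis by simp
    qed
    then show "AE x in lborel. norm ((1 + norm x) ^ k * norm (g x * h x)) \<le> norm (C * ((1 + norm x) ^ (k + m) * norm (h x)))"
      by simp
  qed measurable
qed

lemma rapid_linear: assumes "rapid h" shows "rapid (\<lambda>x. c * complex_of_real (x \<bullet> w) * h x)"
proof (rule rapid_mult_bound[OF assms, where C = "norm c * norm w" and m = 1])
  fix x
  have "norm (c * complex_of_real (x \<bullet> w)) \<le> norm c * (norm x * norm w)"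
    by (simp add: norm_mult Cauchy_Schwarz_ineq2 mult_left_mono)
  also have "\<dots> \<le> norm c * norm w * (1 + norm x) ^ 1"
    by (simp add: algebra_simps mult_left_mono)
  finally show "norm (c * complex_of_real (x \<bullet> w)) \<le> norm c * norm w * (1 + norm x) ^ 1" .
qed measurable

lemma cc_smooth_rapid: assumes "cc_smooth h" shows "rapid h"
proof (rule rapidI)
  show "h \<in> borel_measurable borel" using assms smooth_all_measurable unfolding cc_smooth_def by blast
  fix k
  obtain C where C: "\<And>x. norm (h x) \<le> C" using cc_smooth_bounded[OF assms] by blast
  obtain r where r: "\<And>x. norm x > r \<Longrightarrow> h x = 0" using assms unfolding cc_smooth_def by blast
  have "(1 + norm x) ^ k * norm (h x) \<le> (1 + \<bar>r\<bar>) ^ k * C" for x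
  proof (cases "norm x > r")
    case True
    have "0 \<le> C" using C[of x] norm_ge_zero[of "h x"] by linarith
    then show ?thesis using r[OF True] by simp
  next
    case False
    then show ?thesis by (intro mult_mono power_mono C) auto
  qed
  then show "\<exists>C. \<forall>x. (1 + norm x) ^ k * norm (h x) \<le> C" by blast
qed

text \<open>The inverse Fourier integral without its normalising factor. Both transforms reduce to
  it: \<open>fourier f\<close> is its reflection and \<open>inv_fourier f\<close> a multiple of
  it.\<close>

definition osc :: "('a::euclidean_space \<Rightarrow> complex) \<Rightarrow> 'a \<Rightarrow> complex" where
  "osc h x = (LINT \<xi>|lborel. cis (x \<bullet> \<xi>) * h \<xi>)"

lemma cis_mult_measurable [measurable]: "(\<lambda>x. cis (f x)) \<in> borel_measurable M" if "f \<in> borel_measurable M"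
  using that by (intro borel_measurable_continuous_on[where f=cis]) (auto intro: continuous_intros)

lemma integrable_bounded_mult:
  fixes h :: "'a::euclidean_space \<Rightarrow> complex"
  assumes h: "integrable lborel h" and [measurable]: "g \<in> borel_measurable borel" and b: "\<And>x. norm (g x) \<le> C"
  shows "integrable lborel (\<lambda>x. g x * h x)"
proof (rule Bochner_Integration.integrable_bound)
  have [measurable]: "h \<in> borel_measurable borel" using h by auto
  show "integrable lborel (\<lambda>x. complex_of_real C * h x)" using h by simp
  show "(\<lambda>x. g x * h x) \<in> borel_measurable lborel" by measurable
  have "norm (g x * h x) \<le> norm (complex_of_real C * h x)" for x
    using b[of x] order_trans[OF norm_ge_zero b[of x]] by (simp add: norm_mult mult_right_mono)
  then show "AE x in lborel. norm (g x * h x) \<le> norm (complex_of_real C * h x)" by simp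
qed

lemma osc_integrable:
  "integrable lborel h \<Longrightarrow> integrable lborel (\<lambda>\<xi>. cis (x \<bullet> \<xi>) * h \<xi>)"
  by (rule integrable_bounded_mult[where C=1]) auto

lemma osc_bound: "norm (osc h x) \<le> (LINT \<xi>|lborel. norm (h \<xi>))"
  unfolding osc_def
  by (rule order_trans[OF integral_norm_bound]) (simp add: norm_mult)

lemma cis_taylor: "norm (cis t - 1 - \<i> * complex_of_real t) \<le> t\<^sup>2"
proof -
  have "2 * norm (cis t - 1 - \<i> * complex_of_real t) \<le> t\<^sup>2"
    using iexp_approx1[of t 1] by (simp add: cis_conv_exp power2_eq_square algebra_simps)
  then show ?thesis using norm_ge_zero[of "cis t - 1 - \<i> * complex_of_real t"] by linarith
qed

text \<open>The remainder \<open>cis t - 1 - \<i> * t\<close> is at most \<open>t\<^sup>2\<close>.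
  Integrated against the second moment of \<open>h\<close>, this bounds the Frechet remainder by a
  multiple of \<open>(norm v)\<^sup>2\<close>, so no limit has to be taken under the
  integral.\<close>

lemma osc_has_derivative:
  assumes h: "rapid h"
  shows "(osc h has_derivative (\<lambda>v. osc (\<lambda>\<xi>. \<i> * complex_of_real (\<xi> \<bullet> v) * h \<xi>) x)) (at x)"
proof -
  let ?D = "\<lambda>v. osc (\<lambda>\<xi>. \<i> * complex_of_real (\<xi> \<bullet> v) * h \<xi>) x"
  have ri: "integrable lborel (\<lambda>\<xi>. cis (x \<bullet> \<xi>) * (\<i> * complex_of_real (\<xi> \<bullet> v) * h \<xi>))" for x v
    using rapid_integrable[OF rapid_linear[OF h, of \<i>]] osc_integrable by blast
  have r0: "integrable lborel (\<lambda>\<xi>. cis (x \<bullet> \<xi>) * h \<xi>)" for x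
    using rapid_integrable[OF h] osc_integrable by blast
  define A where "A = (LINT \<xi>|lborel. (1 + norm \<xi>) ^ 2 * norm (h \<xi>))"
  define B where "B = (LINT \<xi>|lborel. (1 + norm \<xi>) ^ 1 * norm (h \<xi>))"
  have iA: "integrable lborel (\<lambda>\<xi>. (1 + norm \<xi>) ^ k * norm (h \<xi>))" for k
    using h unfolding rapid_def by blast
  have lin: "bounded_linear ?D"
  proof (rule bounded_linear_intro[where K=B])
    show "?D (u + v) = ?D u + ?D v" for u v
      unfolding osc_def using ri
      by (subst Bochner_Integration.integral_add[symmetric]) (auto simp: inner_add_right algebra_simps)
    show "?D (r *\<^sub>R v) = r *\<^sub>R ?D v" for r v
      unfolding osc_def
      by (subst integral_scaleR_right[symmetric]) (auto simp: scaleR_conv_of_real mult_ac)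
    show "norm (?D v) \<le> norm v * B" for v
    proof -
      have "norm (?D v) \<le> (LINT \<xi>|lborel. norm (\<i> * complex_of_real (\<xi> \<bullet> v) * h \<xi>))" by (rule osc_bound)
      also have "\<dots> \<le> (LINT \<xi>|lborel. norm v * ((1 + norm \<xi>) ^ 1 * norm (h \<xi>)))"
      proof (rule integral_mono)
        show "integrable lborel (\<lambda>\<xi>. norm (\<i> * complex_of_real (\<xi> \<bullet> v) * h \<xi>))"
          using rapid_integrable[OF rapid_linear[OF h, of \<i>]] by (rule integrable_norm)
        show "integrable lborel (\<lambda>\<xi>. norm v * ((1 + norm \<xi>) ^ 1 * norm (h \<xi>)))"
          using iA by (rule integrable_mult_right)
        fix \<xi>
        have "\<bar>\<xi> \<bullet> v\<bar> \<le> norm v * (1 + norm \<xi>)"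
          using Cauchy_Schwarz_ineq2[of \<xi> v] by (simp add: algebra_simps add_increasing)
        then show "norm (\<i> * complex_of_real (\<xi> \<bullet> v) * h \<xi>) \<le> norm v * ((1 + norm \<xi>) ^ 1 * norm (h \<xi>))"
          by (simp add: norm_mult mult.assoc[symmetric] mult_right_mono del: mult.assoc)
      qed
      also have "\<dots> = norm v * B" unfolding B_def by simp
      finally show ?thesis .
    qed
  qed
  have est: "norm (osc h (x + v) - osc h x - ?D v) \<le> (norm v)\<^sup>2 * A" for v
  proof -
    have "osc h (x + v) - osc h x - ?D v = (LINT \<xi>|lborel. cis ((x + v) \<bullet> \<xi>) * h \<xi> - cis (x \<bullet> \<xi>) * h \<xi>
        - cis (x \<bullet> \<xi>) * (\<i> * complex_of_real (\<xi> \<bullet> v) * h \<xi>))"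
      unfolding osc_def
      by (simp only: Bochner_Integration.integral_diff Bochner_Integration.integrable_diff r0 ri)
    also have "\<dots> = (LINT \<xi>|lborel. cis (x \<bullet> \<xi>) * (cis (v \<bullet> \<xi>) - 1 - \<i> * complex_of_real (v \<bullet> \<xi>)) * h \<xi>)"
    proof (rule Bochner_Integration.integral_cong[OF refl])
      fix \<xi>
      have "cis ((x + v) \<bullet> \<xi>) = cis (x \<bullet> \<xi>) * cis (v \<bullet> \<xi>)" by (simp add: cis_mult inner_add_left)
      then show "cis ((x + v) \<bullet> \<xi>) * h \<xi> - cis (x \<bullet> \<xi>) * h \<xi> - cis (x \<bullet> \<xi>) * (\<i> * complex_of_real (\<xi> \<bullet> v) * h \<xi>)
        = cis (x \<bullet> \<xi>) * (cis (v \<bullet> \<xi>) - 1 - \<i> * complex_of_real (v \<bullet> \<xi>)) * h \<xi>"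
        by (simp add: algebra_simps inner_commute)
    qed
    also have "norm \<dots> \<le> (LINT \<xi>|lborel. norm (cis (x \<bullet> \<xi>) * (cis (v \<bullet> \<xi>) - 1 - \<i> * complex_of_real (v \<bullet> \<xi>)) * h \<xi>))"
      by (rule integral_norm_bound)
    also have "\<dots> \<le> (LINT \<xi>|lborel. (norm v)\<^sup>2 * ((1 + norm \<xi>) ^ 2 * norm (h \<xi>)))"
    proof (rule integral_mono')
      show "integrable lborel (\<lambda>\<xi>. (norm v)\<^sup>2 * ((1 + norm \<xi>) ^ 2 * norm (h \<xi>)))"
        using iA by (rule integrable_mult_right)
      fix \<xi>
      have "(v \<bullet> \<xi>)\<^sup>2 \<le> (norm v * norm \<xi>)\<^sup>2"
        using Cauchy_Schwarz_ineq2[of v \<xi>] by (metis abs_le_square_iff abs_mult abs_norm_cancel)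
      also have "\<dots> \<le> (norm v)\<^sup>2 * (1 + norm \<xi>)\<^sup>2"
        unfolding power_mult_distrib by (intro mult_left_mono power_mono) auto
      finally have "norm (cis (v \<bullet> \<xi>) - 1 - \<i> * complex_of_real (v \<bullet> \<xi>)) \<le> (norm v)\<^sup>2 * (1 + norm \<xi>)\<^sup>2"
        using cis_taylor order_trans by blast
      then show "norm (cis (x \<bullet> \<xi>) * (cis (v \<bullet> \<xi>) - 1 - \<i> * complex_of_real (v \<bullet> \<xi>)) * h \<xi>)
           \<le> (norm v)\<^sup>2 * ((1 + norm \<xi>) ^ 2 * norm (h \<xi>))"
        by (simp add: norm_mult mult.assoc[symmetric] mult_right_mono del: mult.assoc)
    qed simp
    also have "\<dots> = (norm v)\<^sup>2 * A" unfolding A_def by simp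
    finally show ?thesis .
  qed
  show ?thesis
    unfolding has_derivative_at
  proof (intro conjI lin)
    show "(\<lambda>v. norm (osc h (x + v) - osc h x - ?D v) / norm v) \<midarrow>0\<rightarrow> 0"
    proof (rule Lim_null_comparison)
      have "norm (norm (osc h (x + v) - osc h x - ?D v) / norm v) \<le> norm v * A" for v
        using est[of v] by (cases "v = 0") (auto simp: power2_eq_square divide_simps mult_ac)
      then show "\<forall>\<^sub>F v in at 0. norm (norm (osc h (x + v) - osc h x - ?D v) / norm v) \<le> norm v * A"
        by simp
      show "((\<lambda>v. norm v * A) \<longlongrightarrow> 0) (at 0)"
        by (auto intro!: tendsto_eq_intros)
    qed
  qed
qed

lemma dpart_osc: "rapid h \<Longrightarrow> dpart v (osc h) = osc (\<lambda>\<xi>. \<i> * complex_of_real (\<xi> \<bullet> v) * h \<xi>)"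
  using dpart_eqI[OF osc_has_derivative] by blast

lemma smooth_all_osc: assumes "rapid h" shows "smooth_all (osc h)"
proof (rule smooth_all_coinduct[where P = "\<lambda>g. \<exists>h. rapid h \<and> g = osc h"])
  show "\<exists>h'. rapid h' \<and> osc h = osc h'" using assms by blast
  fix g :: "'a \<Rightarrow> complex" assume "\<exists>h. rapid h \<and> g = osc h"
  then obtain h where h: "rapid h" "g = osc h" by blast
  show "(\<forall>x. g differentiable at x) \<and> (\<forall>v. \<exists>h. rapid h \<and> dpart v g = osc h)"
    using osc_has_derivative[OF h(1)] dpart_osc[OF h(1)] rapid_linear[OF h(1), of \<i>] h(2)
    unfolding differentiable_def by blast
qed

text \<open>Every derivative of the transform of a test function is again such a transform. Hence
  decay of \<open>osc h\<close> itself, for all \<open>h\<close> in this class, already yields all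
  Schwartz bounds.\<close>

lemma iter_partial_osc:
  assumes "cc_smooth h" shows "\<exists>h'. cc_smooth h' \<and> iter_partial vs (osc h) = osc h'"
proof (induction vs)
  case (Cons v vs)
  then obtain h' where h': "cc_smooth h'" "iter_partial vs (osc h) = osc h'" by blast
  have "smooth_all (\<lambda>\<xi>. \<i> * complex_of_real (\<xi> \<bullet> v))"
    by (intro smooth_all_mult smooth_all_const smooth_all_linear)
  then have "cc_smooth (\<lambda>\<xi>. \<i> * complex_of_real (\<xi> \<bullet> v) * h' \<xi>)"
    using cc_smooth_mult'[OF h'(1)] by blast
  then show ?case using h' dpart_osc[OF cc_smooth_rapid[OF h'(1)], of v] by auto
qed (use assms in auto)

section \<open>Integration by parts and decay of oscillatory integrals\<close>

lemma integrable_cball_indicator: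
  "integrable lborel (indicator (cball (a::'a::euclidean_space) r) :: 'a \<Rightarrow> real)"
  by (rule integrable_real_indicator) (use emeasure_lborel_cball_finite[of a r] in simp_all)

lemma cc_smooth_lipschitz:
  assumes h: "cc_smooth h"
  shows "\<exists>B. \<forall>x y. norm (h x - h y) \<le> B * norm (x - y)"
proof -
  have "\<exists>M. \<forall>x. norm (dpart e h x) \<le> M" for e
    using cc_smooth_bounded[OF cc_smooth_iter_partial[OF h, of "[e]"]] by simp
  then obtain M where M: "\<And>e x. norm (dpart e h x) \<le> M e" by metis
  have sm: "smooth_all h" using h unfolding cc_smooth_def by blast
  have on: "onorm (\<lambda>v. dpart v h x) \<le> (\<Sum>e\<in>Basis. M e)" for x
  proof (rule onorm_bound)
    show "0 \<le> (\<Sum>e\<in>Basis. M e)"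
      by (rule sum_nonneg) (rule order_trans[OF norm_ge_zero M])
    fix v
    have "norm (dpart v h x) \<le> (\<Sum>e\<in>Basis. norm (complex_of_real (v \<bullet> e) * dpart e h x))"
      by (subst frechet_linear_expand[OF smooth_all_differentiable[OF sm]]) (rule norm_sum)
    also have "\<dots> \<le> (\<Sum>e\<in>Basis. norm v * M e)"
      by (rule sum_mono) (auto simp: norm_mult intro!: mult_mono M Basis_le_norm)
    finally show "norm (dpart v h x) \<le> (\<Sum>e\<in>Basis. M e) * norm v"
      by (simp add: sum_distrib_left mult.commute)
  qed
  have "norm (h x - h y) \<le> (\<Sum>e\<in>Basis. M e) * norm (x - y)" for x y
    by (rule differentiable_bound[of UNIV h "\<lambda>x v. dpart v h x"])
      (use smooth_all_has_derivative[OF sm] on in auto)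
  then show ?thesis by blast
qed

text \<open>The difference quotients have integral zero by translation invariance.\<close>

lemma integral_dpart_zero:
  fixes h :: "'a::euclidean_space \<Rightarrow> complex"
  assumes h: "cc_smooth h"
  shows "(LINT x|lborel. dpart v h x) = 0"
proof -
  have sm: "smooth_all h" using h unfolding cc_smooth_def by blast
  have [measurable]: "h \<in> borel_measurable borel" by (rule smooth_all_measurable[OF sm])
  obtain B where B: "\<And>x y. norm (h x - h y) \<le> B * norm (x - y)" using cc_smooth_lipschitz[OF h] by blast
  obtain r where r: "\<And>x. norm x > r \<Longrightarrow> h x = 0" using h unfolding cc_smooth_def by blast
  define t where "t j = inverse (real (Suc j))" for j
  have t: "0 < t j" "t j \<le> 1" for j by (auto simp: t_def divide_simps)
  have tabs: "\<bar>t j\<bar> = t j" for j using t(1)[of j] by simp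
  have tinv: "inverse (t j) * t j = 1" for j using t(1)[of j] by simp
  have t0: "t \<longlonglongrightarrow> 0" unfolding t_def by (rule LIMSEQ_inverse_real_of_nat)
  define q where "q j x = (h (t j *\<^sub>R v + 1 *\<^sub>R x) - h x) /\<^sub>R t j" for j x
  have ih: "integrable lborel h" by (rule rapid_integrable[OF cc_smooth_rapid[OF h]])
  have zero: "integral\<^sup>L lborel (q j) = 0" for j
    unfolding q_def using integral_lborel_affine[OF _ ih, of 1 "t j *\<^sub>R v"]
      integrable_lborel_affine[OF ih, of 1 "t j *\<^sub>R v"] ih by simp
  have "(\<lambda>j. integral\<^sup>L lborel (q j)) \<longlonglongrightarrow> (LINT x|lborel. dpart v h x)"
  proof (rule integral_dominated_convergence)
    show "(\<lambda>x. dpart v h x) \<in> borel_measurable lborel"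
      using smooth_all_measurable[OF smooth_all_dpart[OF sm]] by simp
    show "q j \<in> borel_measurable lborel" for j unfolding q_def by measurable
    show "integrable lborel (\<lambda>x::'a. (B * norm v) * indicator (cball 0 (\<bar>r\<bar> + norm v)) x)"
      by (intro integrable_mult_right integrable_cball_indicator)
    have lim: "(\<lambda>j. q j x) \<longlonglongrightarrow> dpart v h x" for x
    proof -
      have "((\<lambda>s. h (x + s *\<^sub>R v)) has_derivative (\<lambda>s. dpart (s *\<^sub>R v) h x)) (at 0)"
        by (rule has_derivative_compose[of "\<lambda>s. x + s *\<^sub>R v" "\<lambda>s. s *\<^sub>R v"])
          (auto intro!: derivative_eq_intros smooth_all_has_derivative[OF sm])
      moreover have "dpart (s *\<^sub>R v) h x = s *\<^sub>R dpart v h x" for s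
        using linear_frechet_derivative[OF smooth_all_differentiable[OF sm]] linear_cmul by blast
      ultimately have L: "((\<lambda>s. (h (x + s *\<^sub>R v) - h x - s *\<^sub>R dpart v h x) /\<^sub>R norm s) \<longlongrightarrow> 0) (at 0)"
        unfolding has_derivative_within by (simp add: inverse_eq_divide diff_diff_eq)
      have "filterlim t (at 0) sequentially"
        using t0 t(1) by (intro filterlim_atI) (auto simp: less_imp_neq[symmetric])
      from filterlim_compose[OF L this]
      have "(\<lambda>j. q j x - dpart v h x) \<longlonglongrightarrow> 0"
        by (simp add: q_def scaleR_diff_right add.commute tabs tinv)
      then show ?thesis by (simp add: LIM_zero_iff)
    qed
    then show "AE x in lborel. (\<lambda>j. q j x) \<longlonglongrightarrow> dpart v h x" by simp
    \<comment> \<open>The Lipschitz constant dominates the quotients, and \<open>t j \<le> 1\<close>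
      keeps all their supports in one ball.\<close>
    have "norm (q j x) \<le> (B * norm v) * indicator (cball 0 (\<bar>r\<bar> + norm v)) x" for j x
    proof (cases "x \<in> cball 0 (\<bar>r\<bar> + norm v)")
      case True
      have "norm (h (t j *\<^sub>R v + x) - h x) \<le> B * (t j * norm v)"
        using B[of "t j *\<^sub>R v + x" x] t(1)[of j] by simp
      then show ?thesis using True t(1)[of j] by (simp add: q_def divide_simps mult_ac)
    next
      case False
      have "norm (t j *\<^sub>R v) \<le> norm v" using t[of j] by (simp add: mult_left_le_one_le)
      moreover have "norm x - norm (t j *\<^sub>R v) \<le> norm (t j *\<^sub>R v + x)"
        using norm_triangle_ineq4[of "t j *\<^sub>R v + x" "t j *\<^sub>R v"] by simp
      moreover have "norm x > \<bar>r\<bar> + norm v" using False by simp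
      ultimately have "norm (t j *\<^sub>R v + x) > r" "norm x > r"
        using norm_ge_zero[of v] by linarith+
      then have "h (t j *\<^sub>R v + x) = 0" "h x = 0" using r by blast+
      then show ?thesis using False by (simp add: q_def)
    qed
    then show "AE x in lborel. norm (q j x) \<le> (B * norm v) * indicator (cball 0 (\<bar>r\<bar> + norm v)) x" for j by simp
  qed
  then show ?thesis unfolding zero using LIMSEQ_unique tendsto_const by blast
qed

text \<open>The derivative of \<open>cis (x \<bullet> \<xi>) * h \<xi>\<close> in direction
  \<open>v\<close> integrates to zero; expanding it by the product rule trades a factor
  \<open>x \<bullet> v\<close> for a derivative of \<open>h\<close>.\<close>

lemma osc_by_parts:
  assumes h: "cc_smooth h"
  shows "complex_of_real (x \<bullet> v) * osc h x = \<i> * osc (dpart v h) x"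
proof -
  have sm: "smooth_all h" using h unfolding cc_smooth_def by blast
  have hp: "cc_smooth (dpart v h)" using cc_smooth_iter_partial[OF h, of "[v]"] by simp
  have int: "integrable lborel (\<lambda>\<xi>. cis (x \<bullet> \<xi>) * h \<xi>)" "integrable lborel (\<lambda>\<xi>. cis (x \<bullet> \<xi>) * dpart v h \<xi>)"
    by (intro osc_integrable rapid_integrable cc_smooth_rapid h hp)+
  have "dpart v (\<lambda>\<xi>. cis (x \<bullet> \<xi>) * h \<xi>) \<xi> =
      cis (x \<bullet> \<xi>) * dpart v h \<xi> + \<i> * complex_of_real (x \<bullet> v) * (cis (x \<bullet> \<xi>) * h \<xi>)" for \<xi>
  proof -
    have "((\<lambda>\<xi>. cis (\<xi> \<bullet> x) * h \<xi>) has_derivative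
       (\<lambda>v. cis (\<xi> \<bullet> x) * dpart v h \<xi> + (\<i> * complex_of_real (v \<bullet> x) * cis (\<xi> \<bullet> x)) * h \<xi>)) (at \<xi>)"
      by (rule has_derivative_mult[OF has_derivative_cis_linear smooth_all_has_derivative[OF sm]])
    from dpart_eqI[OF this, of v] show ?thesis by (simp add: inner_commute mult_ac)
  qed
  moreover have "cc_smooth (\<lambda>\<xi>. cis (x \<bullet> \<xi>) * h \<xi>)"
    using cc_smooth_mult'[OF h smooth_all_cis[of x]] by (simp add: inner_commute)
  ultimately have "(LINT \<xi>|lborel. cis (x \<bullet> \<xi>) * dpart v h \<xi> + \<i> * complex_of_real (x \<bullet> v) * (cis (x \<bullet> \<xi>) * h \<xi>)) = 0"
    using integral_dpart_zero[of "\<lambda>\<xi>. cis (x \<bullet> \<xi>) * h \<xi>" v] by simp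
  then have "osc (dpart v h) x + \<i> * complex_of_real (x \<bullet> v) * osc h x = 0"
    unfolding osc_def using int by (simp add: mult.assoc)
  then have "\<i> * (osc (dpart v h) x + \<i> * complex_of_real (x \<bullet> v) * osc h x) = 0" by simp
  then show ?thesis by (simp add: algebra_simps)
qed

lemma osc_power:
  assumes h: "cc_smooth h"
  shows "complex_of_real (x \<bullet> v) ^ K * osc h x = \<i> ^ K * osc (iter_partial (replicate K v) h) x"
proof (induction K)
  case (Suc K)
  show ?case
    using Suc osc_by_parts[OF cc_smooth_iter_partial[OF h, of "replicate K v"], of x v]
    by (simp add: mult.assoc mult.left_commute)
qed simp

lemma osc_bound_supp:
  fixes g :: "'a::euclidean_space \<Rightarrow> complex"
  assumes b: "\<And>x. norm (g x) \<le> A" and s: "\<And>x. norm x > r \<Longrightarrow> g x = 0"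
  shows "norm (osc g x) \<le> A * measure lborel (cball (0::'a) r)"
proof -
  have "norm (osc g x) \<le> (LINT \<xi>|lborel. norm (g \<xi>))" by (rule osc_bound)
  also have "\<dots> \<le> (LINT \<xi>|lborel. A * indicator (cball (0::'a) r) \<xi>)"
  proof (rule integral_mono')
    show "integrable lborel (\<lambda>\<xi>. A * indicator (cball (0::'a) r) \<xi>)"
      by (intro integrable_mult_right integrable_cball_indicator)
    show "norm (g \<xi>) \<le> A * indicator (cball (0::'a) r) \<xi>" for \<xi>
      using b[of \<xi>] s[of \<xi>] by (auto simp: indicator_def)
    show "0 \<le> A * indicator (cball (0::'a) r) \<xi>" for \<xi>
      using order_trans[OF norm_ge_zero b] by simp
  qed
  finally show ?thesis by simp
qed

text \<open>The largest coordinate controls the norm. Only pure powers of single coordinates appear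
  on the right, so decay of \<open>osc h\<close> will involve only the pure derivatives
  \<open>iter_partial (replicate K b) h\<close>, whose behaviour under dilation is easy to
  track.\<close>

lemma one_plus_norm_power_le:
  fixes x :: "'a::euclidean_space"
  shows "(1 + norm x) ^ K \<le> 2 ^ K * (1 + real DIM('a) ^ K * (\<Sum>b\<in>Basis. \<bar>x \<bullet> b\<bar> ^ K))"
proof -
  let ?S = "(\<lambda>b. \<bar>x \<bullet> b\<bar>) ` (Basis :: 'a set)"
  have "Max ?S \<in> ?S" by (rule Max_in) auto
  then obtain b0 where b0: "b0 \<in> Basis" "\<bar>x \<bullet> b0\<bar> = Max ?S" by force
  have b1: "\<bar>x \<bullet> b\<bar> \<le> \<bar>x \<bullet> b0\<bar>" if "b \<in> Basis" for b
    unfolding b0(2) using that by (intro Max_ge) auto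
  have "norm x \<le> (\<Sum>b\<in>Basis. \<bar>x \<bullet> b\<bar>)" by (rule norm_le_l1)
  also have "\<dots> \<le> real DIM('a) * \<bar>x \<bullet> b0\<bar>"
    using sum_bounded_above[of Basis "\<lambda>b. \<bar>x \<bullet> b\<bar>" "\<bar>x \<bullet> b0\<bar>"] b1 by simp
  finally have "norm x ^ K \<le> (real DIM('a) * \<bar>x \<bullet> b0\<bar>) ^ K" by (intro power_mono) auto
  also have "\<dots> \<le> real DIM('a) ^ K * (\<Sum>b\<in>Basis. \<bar>x \<bullet> b\<bar> ^ K)"
    unfolding power_mult_distrib
    by (intro mult_left_mono member_le_sum[where f="\<lambda>b. \<bar>x \<bullet> b\<bar> ^ K"] b0(1)) auto
  finally have 1: "norm x ^ K \<le> real DIM('a) ^ K * (\<Sum>b\<in>Basis. \<bar>x \<bullet> b\<bar> ^ K)" .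
  have "(1 + norm x) ^ K \<le> (2 * max 1 (norm x)) ^ K" by (intro power_mono) auto
  also have "\<dots> \<le> 2 ^ K * (1 + norm x ^ K)"
    unfolding power_mult_distrib by (intro mult_left_mono) (auto simp: max_def)
  also have "\<dots> \<le> 2 ^ K * (1 + real DIM('a) ^ K * (\<Sum>b\<in>Basis. \<bar>x \<bullet> b\<bar> ^ K))"
    using 1 by simp
  finally show ?thesis .
qed

text \<open>The constant depends on \<open>h\<close> only through the bound \<open>A\<close> and the
  radius \<open>r\<close>. This uniformity makes the estimate applicable to all Littlewood-Paley
  pieces at once, after rescaling them to unit size.\<close>

lemma osc_decay:
  fixes h :: "'a::euclidean_space \<Rightarrow> complex"
  assumes h: "cc_smooth h" and s: "\<And>x. norm x > r \<Longrightarrow> h x = 0"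
    and A: "\<And>x. norm (h x) \<le> A" "\<And>b x. b \<in> Basis \<Longrightarrow> norm (iter_partial (replicate K b) h x) \<le> A"
  shows "(1 + norm x) ^ K * norm (osc h x) \<le> 2 ^ K * (1 + real DIM('a) ^ K * real DIM('a)) * (A * measure lborel (cball (0::'a) r))"
proof -
  let ?V = "A * measure lborel (cball (0::'a) r)"
  have V: "norm (osc h x) \<le> ?V" by (rule osc_bound_supp[OF A(1) s])
  have b: "\<bar>x \<bullet> b\<bar> ^ K * norm (osc h x) \<le> ?V" if b: "b \<in> Basis" for b
  proof -
    have "\<bar>x \<bullet> b\<bar> ^ K * norm (osc h x) = norm (complex_of_real (x \<bullet> b) ^ K * osc h x)"
      by (simp add: norm_mult norm_power)
    also have "\<dots> = norm (osc (iter_partial (replicate K b) h) x)"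
      unfolding osc_power[OF h] by (simp add: norm_mult norm_power)
    also have "\<dots> \<le> ?V"
    proof (rule osc_bound_supp)
      show "iter_partial (replicate K b) h x = 0" if "norm x > r" for x
        by (rule iter_partial_vanishes[of "cball 0 r"]) (use s that in auto)
    qed (use A(2) b in auto)
    finally show ?thesis .
  qed
  have "(1 + norm x) ^ K * norm (osc h x) \<le> 2 ^ K * (1 + real DIM('a) ^ K * (\<Sum>b\<in>Basis. \<bar>x \<bullet> b\<bar> ^ K)) * norm (osc h x)"
    by (intro mult_right_mono one_plus_norm_power_le) auto
  also have "\<dots> = 2 ^ K * (norm (osc h x) + real DIM('a) ^ K * (\<Sum>b\<in>Basis. \<bar>x \<bullet> b\<bar> ^ K * norm (osc h x)))"
    by (simp add: algebra_simps sum_distrib_left sum_distrib_right)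
  also have "\<dots> \<le> 2 ^ K * (?V + real DIM('a) ^ K * (\<Sum>b\<in>(Basis::'a set). ?V))"
    by (intro mult_left_mono add_mono V sum_mono b) auto
  finally show ?thesis by (simp add: algebra_simps)
qed

lemma osc_decay_ex:
  assumes h: "cc_smooth h" shows "\<exists>C. \<forall>x. (1 + norm x) ^ K * norm (osc h x) \<le> C"
proof -
  obtain r where r: "\<And>x. norm x > r \<Longrightarrow> h x = 0" using h unfolding cc_smooth_def by blast
  have "\<forall>b. \<exists>M. \<forall>x. norm (iter_partial (replicate K b) h x) \<le> M"
    using cc_smooth_bounded[OF cc_smooth_iter_partial[OF h]] by blast
  then obtain M where M: "\<And>b x. norm (iter_partial (replicate K b) h x) \<le> M b" by metis
  obtain M0 where M0: "\<And>x. norm (h x) \<le> M0" using cc_smooth_bounded[OF h] by blast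
  have Mpos: "0 \<le> M b" for b using order_trans[OF norm_ge_zero M] .
  have "0 \<le> M0" using order_trans[OF norm_ge_zero M0] .
  have "norm (h x) \<le> M0 + sum M Basis" for x
    using M0[of x] sum_nonneg[of Basis M] Mpos by (simp add: add_increasing2)
  moreover have "norm (iter_partial (replicate K b) h x) \<le> M0 + sum M Basis" if "b \<in> Basis" for b x
    using M[of b x] member_le_sum[of b Basis M] Mpos that \<open>0 \<le> M0\<close> by fastforce
  ultimately show ?thesis using osc_decay[OF h r] by blast
qed

section \<open>Schwartz functions and compactly supported test functions\<close>

lemma schwartz_smooth_all: "f \<in> schwartz \<Longrightarrow> smooth_all f"
  unfolding schwartz_def by (simp add: smooth_smooth_all)

lemma multi_partial_0: "multi_partial (\<lambda>_. 0) f = f"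
proof -
  have "concat (map (\<lambda>b. replicate 0 b) bs) = []" for bs :: "'a list" by simp
  then show ?thesis unfolding multi_partial_def by (metis iter_partial.simps(1))
qed

lemma schwartz_bound: "f \<in> schwartz \<Longrightarrow> \<exists>C. \<forall>x. (1 + norm x) ^ k * norm (f x) \<le> C"
proof -
  assume "f \<in> schwartz"
  then have "\<exists>C. \<forall>x. (1 + norm x) ^ k * norm (multi_partial (\<lambda>_. 0) f x) \<le> C"
    unfolding schwartz_def by blast
  then show ?thesis unfolding multi_partial_0 .
qed

lemma schwartz_rapid: "f \<in> schwartz \<Longrightarrow> rapid f"
  by (intro rapidI schwartz_bound smooth_all_measurable schwartz_smooth_all)

lemma osc_cc_smooth_schwartz: assumes "cc_smooth h" shows "osc h \<in> schwartz"
  unfolding schwartz_def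
proof (intro CollectI conjI allI smooth_all_smooth smooth_all_osc cc_smooth_rapid assms)
  fix k \<alpha>
  show "\<exists>C. \<forall>x. (1 + norm x) ^ k * cmod (multi_partial \<alpha> (osc h) x) \<le> C"
    using iter_partial_osc[OF assms] osc_decay_ex unfolding multi_partial_def by metis
qed

lemma cc_smooth_schwartz: assumes "cc_smooth h" shows "h \<in> schwartz"
  unfolding schwartz_def
proof (intro CollectI conjI allI smooth_all_smooth)
  show "smooth_all h" using assms unfolding cc_smooth_def by blast
  fix k \<alpha>
  define g where "g = multi_partial \<alpha> h"
  have g: "cc_smooth g" unfolding g_def multi_partial_def by (rule cc_smooth_iter_partial[OF assms])
  obtain C where C: "\<And>x. norm (g x) \<le> C" using cc_smooth_bounded[OF g] by blast
  obtain r where r: "\<And>x. norm x > r \<Longrightarrow> g x = 0" using g unfolding cc_smooth_def by blast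
  have "(1 + norm x) ^ k * norm (g x) \<le> (1 + \<bar>r\<bar>) ^ k * C" for x
  proof (cases "norm x > r")
    case True
    have "0 \<le> C" using C[of x] norm_ge_zero[of "g x"] by linarith
    then show ?thesis using r[OF True] by simp
  next
    case False
    then show ?thesis by (intro mult_mono power_mono C) auto
  qed
  then show "\<exists>C. \<forall>x. (1 + norm x) ^ k * cmod (multi_partial \<alpha> h x) \<le> C"
    unfolding g_def by blast
qed

section \<open>Fourier inversion\<close>

text \<open>The form in which Fubini is applied below: \<open>k\<close> is an oscillating
  exponential, so integrability of \<open>f\<close> and \<open>g\<close> alone makes the double
  integral absolutely convergent.\<close>

lemma fubini_kernel:
  fixes f :: "'a::euclidean_space \<Rightarrow> complex" and g :: "'b::euclidean_space \<Rightarrow> complex"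
    and k :: "'a \<times> 'b \<Rightarrow> complex"
  assumes f: "integrable lborel f" and g: "integrable lborel g"
    and [measurable]: "k \<in> borel_measurable borel" and k: "\<And>p. norm (k p) \<le> 1"
  shows "(LINT x|lborel. f x * (LINT y|lborel. k (x, y) * g y)) = (LINT y|lborel. g y * (LINT x|lborel. k (x, y) * f x))"
proof -
  have [measurable]: "f \<in> borel_measurable borel" "g \<in> borel_measurable borel" using f g by auto
  have [measurable]: "k \<in> borel_measurable (borel \<Otimes>\<^sub>M borel)" unfolding borel_prod by measurable
  let ?F = "\<lambda>x y. f x * (k (x, y) * g y)"
  have kx: "(\<lambda>y. k (x, y)) \<in> borel_measurable borel" for x
    by measurable
  have iy: "integrable lborel (\<lambda>y. k (x, y) * g y)" for x
    by (rule integrable_bounded_mult[OF g kx k])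
  have b: "(LINT y|lborel. norm (?F x y)) \<le> norm (f x) * (LINT y|lborel. norm (g y))" for x
  proof -
    have "(LINT y|lborel. norm (?F x y)) \<le> (LINT y|lborel. norm (f x) * norm (g y))"
      using g k by (intro integral_mono') (auto simp: norm_mult intro!: mult_left_mono mult_left_le_one_le)
    then show ?thesis by simp
  qed
  have "integrable (lborel \<Otimes>\<^sub>M lborel) (case_prod ?F)"
  proof (rule lborel_pair.Fubini_integrable)
    show "case_prod ?F \<in> borel_measurable (lborel \<Otimes>\<^sub>M lborel)" by measurable
    show "AE x in lborel. integrable lborel (\<lambda>y. case_prod ?F (x, y))" using iy by simp
    show "integrable lborel (\<lambda>x. LINT y|lborel. norm (case_prod ?F (x, y)))"
    proof (rule Bochner_Integration.integrable_bound)
      show "integrable lborel (\<lambda>x. norm (f x) * (LINT y|lborel. norm (g y)))" using f by simp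
      show "(\<lambda>x. LINT y|lborel. norm (case_prod ?F (x, y))) \<in> borel_measurable lborel" by measurable
      have "norm (LINT y|lborel. norm (?F x y)) \<le> norm (norm (f x) * (LINT y|lborel. norm (g y)))" for x
        using b[of x] by (simp add: integral_nonneg_AE)
      then show "AE x in lborel. norm (LINT y|lborel. norm (case_prod ?F (x, y))) \<le> norm (norm (f x) * (LINT y|lborel. norm (g y)))"
        by simp
    qed
  qed
  from lborel_pair.Fubini_integral[OF this]
  have "(LINT y|lborel. (LINT x|lborel. ?F x y)) = (LINT x|lborel. (LINT y|lborel. ?F x y))" .
  moreover have "(LINT x|lborel. ?F x y) = g y * (LINT x|lborel. k (x, y) * f x)" for y
    by (subst integral_mult_right_zero[symmetric]) (simp add: mult_ac)
  moreover have "(LINT y|lborel. ?F x y) = f x * (LINT y|lborel. k (x, y) * g y)" for x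
    by simp
  ultimately show ?thesis by simp
qed

text \<open>This is the characteristic function of the standard normal distribution, cleared of the
  normalising factor of its density.\<close>

lemma gauss_1d:
  "integrable lborel (\<lambda>t::real. complex_of_real (exp (- t\<^sup>2 / 2)))"
  "(LINT t|lborel. cis (y * t) * complex_of_real (exp (- t\<^sup>2 / 2))) = complex_of_real (sqrt (2 * pi) * exp (- y\<^sup>2 / 2))"
proof -
  have i: "integrable lborel std_normal_density" by simp
  have "integrable lborel (\<lambda>t. sqrt (2 * pi) * std_normal_density t)"
    using i by (rule integrable_mult_right)
  then have "integrable lborel (\<lambda>t::real. exp (- t\<^sup>2 / 2))" by (simp add: std_normal_density_def)
  then show "integrable lborel (\<lambda>t::real. complex_of_real (exp (- t\<^sup>2 / 2)))"
    by (rule integrable_of_real)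
  have "char std_normal_distribution y = (LINT t|lborel. std_normal_density t *\<^sub>R iexp (y * t))"
    unfolding char_def by (subst integral_density) (auto simp: normal_density_nonneg)
  then have "complex_of_real (exp (- (y^2) / 2)) = (LINT t|lborel. std_normal_density t *\<^sub>R iexp (y * t))"
    by (simp add: char_std_normal_distribution)
  then have "complex_of_real (sqrt (2 * pi) * exp (- y\<^sup>2 / 2)) = complex_of_real (sqrt (2 * pi)) * (LINT t|lborel. std_normal_density t *\<^sub>R iexp (y * t))"
    by simp
  also have "\<dots> = (LINT t|lborel. complex_of_real (sqrt (2 * pi)) * (std_normal_density t *\<^sub>R iexp (y * t)))"
    by (rule integral_mult_right_zero[symmetric])
  also have "\<dots> = (LINT t|lborel. cis (y * t) * complex_of_real (exp (- t\<^sup>2 / 2)))"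
    by (rule Bochner_Integration.integral_cong) (auto simp: std_normal_density_def scaleR_conv_of_real cis_conv_exp mult_ac)
  finally show "(LINT t|lborel. cis (y * t) * complex_of_real (exp (- t\<^sup>2 / 2))) = complex_of_real (sqrt (2 * pi) * exp (- y\<^sup>2 / 2))"
    by simp
qed

definition gauss :: "'a::euclidean_space \<Rightarrow> complex" where
  "gauss x = complex_of_real (exp (- (norm x)\<^sup>2 / 2))"

lemma norm_sq_Basis: "(norm x)\<^sup>2 = (\<Sum>b\<in>Basis. (x \<bullet> b)\<^sup>2)"
  unfolding power2_norm_eq_inner by (subst euclidean_inner) (simp add: power2_eq_square)

lemma gauss_prod: "gauss x = (\<Prod>b\<in>Basis. complex_of_real (exp (- (x \<bullet> b)\<^sup>2 / 2)))"
proof -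
  have "exp (- (norm x)\<^sup>2 / 2) = (\<Prod>b\<in>Basis. exp (- (x \<bullet> b)\<^sup>2 / 2))"
    unfolding norm_sq_Basis by (simp add: exp_sum[symmetric] sum_negf sum_divide_distrib)
  then show ?thesis unfolding gauss_def by simp
qed

lemma gauss_integrable: "integrable lborel gauss"
  unfolding gauss_prod[abs_def] by (rule lborel_prod_integral) (rule gauss_1d)

lemma gauss_measurable [measurable]: "gauss \<in> borel_measurable borel"
  unfolding gauss_def[abs_def] by measurable

lemma norm_gauss_le: "norm (gauss x) \<le> 1"
  by (simp add: gauss_def)

lemma cis_sum: "finite I \<Longrightarrow> cis (\<Sum>i\<in>I. f i) = (\<Prod>i\<in>I. cis (f i))"
  by (induction I rule: finite_induct) (auto simp: cis_mult[symmetric])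

lemma osc_gauss:
  fixes x :: "'a::euclidean_space"
  shows "osc gauss x = complex_of_real (sqrt (2 * pi) ^ DIM('a)) * gauss x"
proof -
  have "osc gauss x = (LINT \<xi>|lborel. (\<Prod>b\<in>Basis. cis ((x \<bullet> b) * (\<xi> \<bullet> b)) * complex_of_real (exp (- (\<xi> \<bullet> b)\<^sup>2 / 2))))"
    unfolding osc_def
  proof (rule Bochner_Integration.integral_cong[OF refl])
    fix \<xi> :: 'a
    have "cis (x \<bullet> \<xi>) = (\<Prod>b\<in>Basis. cis ((x \<bullet> b) * (\<xi> \<bullet> b)))"
      by (subst euclidean_inner) (simp add: cis_sum)
    then show "cis (x \<bullet> \<xi>) * gauss \<xi> = (\<Prod>b\<in>Basis. cis ((x \<bullet> b) * (\<xi> \<bullet> b)) * complex_of_real (exp (- (\<xi> \<bullet> b)\<^sup>2 / 2)))"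
      by (simp add: gauss_prod prod.distrib)
  qed
  also have "\<dots> = (\<Prod>b\<in>(Basis::'a set). LINT t|lborel. cis ((x \<bullet> b) * t) * complex_of_real (exp (- t\<^sup>2 / 2)))"
    by (rule lborel_prod_integral) (rule integrable_bounded_mult[OF gauss_1d(1), where C=1], auto)
  also have "\<dots> = (\<Prod>b\<in>(Basis::'a set). complex_of_real (sqrt (2 * pi)) * complex_of_real (exp (- (x \<bullet> b)\<^sup>2 / 2)))"
    by (simp only: gauss_1d(2) of_real_mult)
  also have "\<dots> = complex_of_real (sqrt (2 * pi) ^ DIM('a)) * gauss x"
    by (simp add: prod.distrib gauss_prod)
  finally show ?thesis .
qed

lemma integral_gauss:
  "(LINT x|lborel. gauss (x :: 'a::euclidean_space)) = complex_of_real (sqrt (2 * pi) ^ DIM('a))"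
  using osc_gauss[of "0 :: 'a"] by (simp add: osc_def gauss_def)

text \<open>Damping the outer integral by \<open>gauss (t j *\<^sub>R \<xi>)\<close> makes the
  interchange of integrals legitimate, and the explicit transform of the Gaussian turns the damped
  integral into an average of \<open>g\<close> near \<open>x\<close>. As \<open>t j\<close> tends to
  zero, one side converges by integrability of \<open>osc g\<close>, the other by continuity and
  boundedness of \<open>g\<close>. One factor \<open>sqrt (2 * pi)\<close> per dimension comes from
  the transform of the Gaussian, a second one from its total mass.\<close>

lemma fourier_inversion:
  fixes g :: "'a::euclidean_space \<Rightarrow> complex"
  assumes g: "integrable lborel g" and cont: "continuous_on UNIV g" and bdd: "\<And>x. norm (g x) \<le> M"
    and gh: "integrable lborel (osc g)"
  shows "osc (\<lambda>\<xi>. osc g (- \<xi>)) x = complex_of_real ((2 * pi) ^ DIM('a)) * g x"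
proof -
  let ?n = "DIM('a)"
  have [measurable]: "g \<in> borel_measurable borel" "osc g \<in> borel_measurable borel" using g gh by auto
  have gh': "integrable lborel (\<lambda>\<xi>. osc g (- \<xi>))"
    using integrable_lborel_affine[OF gh, of "-1" 0] by simp
  define t where "t j = inverse (real (Suc j))" for j
  have t: "0 < t j" for j by (auto simp: t_def)
  have t0: "t \<longlonglongrightarrow> 0" unfolding t_def by (rule LIMSEQ_inverse_real_of_nat)
  define L where "L j = (LINT \<xi>|lborel. cis (x \<bullet> \<xi>) * gauss (t j *\<^sub>R \<xi>) * osc g (- \<xi>))" for j
  have gauss_scaled: "integrable lborel (\<lambda>\<xi>. gauss (t j *\<^sub>R \<xi>) :: complex)" for j
    using integrable_lborel_affine[OF gauss_integrable, of "t j" 0] t[of j] by simp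
  have E: "osc (\<lambda>\<xi>. gauss (t j *\<^sub>R \<xi>)) z = complex_of_real ((1 / t j) ^ ?n * sqrt (2 * pi) ^ ?n) * gauss ((1 / t j) *\<^sub>R z)" for j and z :: 'a
  proof -
    have "osc (\<lambda>\<xi>. gauss (t j *\<^sub>R \<xi>)) z = (\<bar>1 / t j\<bar> ^ ?n) *\<^sub>R (LINT u|lborel. cis (z \<bullet> (0 + (1 / t j) *\<^sub>R u)) * gauss (t j *\<^sub>R (0 + (1 / t j) *\<^sub>R u)))"
      unfolding osc_def by (rule integral_lborel_affine) (use t[of j] osc_integrable[OF gauss_scaled] in auto)
    also have "\<dots> = complex_of_real ((1 / t j) ^ ?n) * osc gauss ((1 / t j) *\<^sub>R z)"
      using t[of j] by (simp add: osc_def scaleR_conv_of_real)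
    finally show ?thesis by (simp add: osc_gauss)
  qed
  have L: "L j = complex_of_real (sqrt (2 * pi) ^ ?n) * (LINT u|lborel. g (x + t j *\<^sub>R u) * gauss u)" for j
  proof -
    let ?f = "\<lambda>\<xi>. cis (x \<bullet> \<xi>) * gauss (t j *\<^sub>R \<xi>)"
    have if': "integrable lborel ?f" by (rule osc_integrable[OF gauss_scaled])
    have "L j = (LINT \<xi>|lborel. ?f \<xi> * (LINT y|lborel. cis (- (fst (\<xi>, y) \<bullet> snd (\<xi>, y))) * g y))"
      unfolding L_def osc_def by simp
    also have "\<dots> = (LINT y|lborel. g y * (LINT \<xi>|lborel. cis (- (fst (\<xi>, y) \<bullet> snd (\<xi>, y))) * ?f \<xi>))"
      by (rule fubini_kernel[OF if' g, of "\<lambda>p. cis (- (fst p \<bullet> snd p))"])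
        (auto intro!: borel_measurable_continuous_onI continuous_intros)
    also have "\<dots> = (LINT y|lborel. g y * osc (\<lambda>\<xi>. gauss (t j *\<^sub>R \<xi>)) (x - y))"
    proof (rule Bochner_Integration.integral_cong[OF refl])
      fix y
      have "cis (- (\<xi> \<bullet> y)) * (cis (x \<bullet> \<xi>) * gauss (t j *\<^sub>R \<xi>)) = cis ((x - y) \<bullet> \<xi>) * gauss (t j *\<^sub>R \<xi>)" for \<xi>
        unfolding mult.assoc[symmetric] cis_mult by (simp add: inner_diff_left inner_diff_right inner_commute)
      then show "g y * (LINT \<xi>|lborel. cis (- (fst (\<xi>, y) \<bullet> snd (\<xi>, y))) * ?f \<xi>) = g y * osc (\<lambda>\<xi>. gauss (t j *\<^sub>R \<xi>)) (x - y)"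
        by (simp only: osc_def fst_conv snd_conv)
    qed
    also have "\<dots> = (LINT y|lborel. complex_of_real ((1 / t j) ^ ?n * sqrt (2 * pi) ^ ?n) * (g y * gauss ((1 / t j) *\<^sub>R (x - y))))"
      unfolding E by (simp add: mult_ac)
    also have "\<dots> = complex_of_real ((1 / t j) ^ ?n * sqrt (2 * pi) ^ ?n) * (LINT y|lborel. g y * gauss ((1 / t j) *\<^sub>R (x - y)))"
      by simp
    also have "(LINT y|lborel. g y * gauss ((1 / t j) *\<^sub>R (x - y))) =
       (\<bar>t j\<bar> ^ ?n) *\<^sub>R (LINT u|lborel. g (x + t j *\<^sub>R u) * gauss ((1 / t j) *\<^sub>R (x - (x + t j *\<^sub>R u))))"
    proof (rule integral_lborel_affine)
      show "t j \<noteq> 0" using t[of j] by simp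
      have "integrable lborel (\<lambda>y. gauss ((1 / t j) *\<^sub>R (x - y)) * g y)"
        by (rule integrable_bounded_mult[OF g _ norm_gauss_le]) measurable
      then show "integrable lborel (\<lambda>y. g y * gauss ((1 / t j) *\<^sub>R (x - y)))" by (simp add: mult.commute)
    qed
    also have "\<dots> = complex_of_real (t j ^ ?n) * (LINT u|lborel. g (x + t j *\<^sub>R u) * gauss u)"
      using t[of j] by (simp add: gauss_def scaleR_conv_of_real)
    finally show ?thesis using t[of j] by (simp add: power_divide)
  qed
  have lim1: "L \<longlonglongrightarrow> osc (\<lambda>\<xi>. osc g (- \<xi>)) x"
    unfolding L_def osc_def[of "\<lambda>\<xi>. osc g (- \<xi>)"]
  proof (rule integral_dominated_convergence)
    show "integrable lborel (\<lambda>\<xi>. norm (osc g (- \<xi>)))" using gh' by (rule integrable_norm)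
    have "(\<lambda>j. cis (x \<bullet> \<xi>) * gauss (t j *\<^sub>R \<xi>) * osc g (- \<xi>)) \<longlonglongrightarrow> cis (x \<bullet> \<xi>) * gauss (0 *\<^sub>R \<xi>) * osc g (- \<xi>)" for \<xi>
      unfolding gauss_def by (intro tendsto_intros t0) simp_all
    then show "AE \<xi> in lborel. (\<lambda>j. cis (x \<bullet> \<xi>) * gauss (t j *\<^sub>R \<xi>) * osc g (- \<xi>)) \<longlonglongrightarrow> cis (x \<bullet> \<xi>) * osc g (- \<xi>)"
      by (simp add: gauss_def)
    show "AE \<xi> in lborel. norm (cis (x \<bullet> \<xi>) * gauss (t j *\<^sub>R \<xi>) * osc g (- \<xi>)) \<le> norm (osc g (- \<xi>))" for j
      by (intro AE_I2) (simp add: norm_mult mult_left_le_one_le norm_gauss_le)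
  qed measurable
  have lim2: "(\<lambda>j. LINT u|lborel. g (x + t j *\<^sub>R u) * gauss u) \<longlonglongrightarrow> (LINT u|lborel. g x * gauss (u :: 'a))"
  proof (rule integral_dominated_convergence)
    show "integrable lborel (\<lambda>u::'a. M * norm (gauss u))"
      by (intro integrable_mult_right integrable_norm gauss_integrable)
    have "(\<lambda>j. g (x + t j *\<^sub>R u)) \<longlonglongrightarrow> g (x + 0 *\<^sub>R u)" for u
    proof -
      have "(\<lambda>j. x + t j *\<^sub>R u) \<longlonglongrightarrow> x + 0 *\<^sub>R u" by (intro tendsto_intros t0)
      then show ?thesis by (rule continuous_on_tendsto_compose[OF cont]) simp_all
    qed
    then have "(\<lambda>j. g (x + t j *\<^sub>R u) * gauss u) \<longlonglongrightarrow> g x * gauss u" for u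
      using tendsto_mult_right by fastforce
    then show "AE u in lborel. (\<lambda>j. g (x + t j *\<^sub>R u) * gauss u) \<longlonglongrightarrow> g x * gauss u" by simp
    show "AE u in lborel. norm (g (x + t j *\<^sub>R u) * gauss u) \<le> M * norm (gauss u)" for j
      by (intro AE_I2) (simp add: norm_mult mult_right_mono bdd)
  qed measurable
  have "L \<longlonglongrightarrow> complex_of_real (sqrt (2 * pi) ^ ?n) * (LINT u|lborel. g x * gauss (u :: 'a))"
    unfolding L by (intro tendsto_intros lim2)
  from LIMSEQ_unique[OF lim1 this]
  have "osc (\<lambda>\<xi>. osc g (- \<xi>)) x = complex_of_real (sqrt (2 * pi) ^ ?n) * (g x * complex_of_real (sqrt (2 * pi) ^ ?n))"
    by (simp add: integral_gauss)
  also have "\<dots> = complex_of_real ((sqrt (2 * pi) * sqrt (2 * pi)) ^ ?n) * g x"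
    by (simp only: power_mult_distrib of_real_mult mult_ac)
  finally show ?thesis by (simp del: of_real_power)
qed

lemma integrable_osc_cc: "cc_smooth g \<Longrightarrow> integrable lborel (osc g)"
  by (intro rapid_integrable schwartz_rapid osc_cc_smooth_schwartz)

lemma cc_smooth_inversion:
  fixes g :: "'a::euclidean_space \<Rightarrow> complex"
  assumes g: "cc_smooth g"
  shows "osc (\<lambda>\<xi>. osc g (- \<xi>)) x = complex_of_real ((2 * pi) ^ DIM('a)) * g x"
    and "osc (osc g) (- x) = complex_of_real ((2 * pi) ^ DIM('a)) * g x"
proof -
  obtain M where M: "\<And>x. norm (g x) \<le> M" using cc_smooth_bounded[OF g] by blast
  have sm: "smooth_all g" using g unfolding cc_smooth_def by blast
  show 1: "osc (\<lambda>\<xi>. osc g (- \<xi>)) x = complex_of_real ((2 * pi) ^ DIM('a)) * g x"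
    by (rule fourier_inversion[OF rapid_integrable[OF cc_smooth_rapid[OF g]] smooth_all_continuous[OF sm] M integrable_osc_cc[OF g]])
  have "osc (\<lambda>\<xi>. osc g (- \<xi>)) x = osc (osc g) (- x)"
    using integral_lborel_affine[OF _ osc_integrable[OF integrable_osc_cc[OF g], of "- x"], of "-1" 0]
    unfolding osc_def[of "osc g"] osc_def[of "\<lambda>\<xi>. osc g (- \<xi>)"] by simp
  with 1 show "osc (osc g) (- x) = complex_of_real ((2 * pi) ^ DIM('a)) * g x" by simp
qed

section \<open>The two Fourier transforms in terms of oscillatory integrals\<close>

lemma fourier_osc: "fourier f \<xi> = osc f (- \<xi>)"
  by (simp add: fourier_def osc_def)

lemma inv_fourier_osc:
  fixes f :: "real^'n \<Rightarrow> complex"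
  shows "inv_fourier f x = complex_of_real (1 / (2 * pi) ^ CARD('n)) * osc f x"
  by (simp add: inv_fourier_def osc_def)

lemma inv_fourier_osc':
  fixes f :: "real^'n \<Rightarrow> complex"
  shows "inv_fourier f = osc (\<lambda>\<xi>. complex_of_real (1 / (2 * pi) ^ CARD('n)) * f \<xi>)"
  by (rule ext) (simp add: inv_fourier_osc osc_def mult.left_commute)

lemma inv_fourier_schwartz:
  fixes h :: "real^'n::finite \<Rightarrow> complex"
  assumes "cc_smooth h" shows "inv_fourier h \<in> schwartz"
  unfolding inv_fourier_osc'
  by (intro osc_cc_smooth_schwartz cc_smooth_mult' assms smooth_all_const)

lemma fourier_inv_fourier:
  fixes h :: "real^'n::finite \<Rightarrow> complex"
  assumes h: "cc_smooth h" shows "fourier (inv_fourier h) = h"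
proof
  fix \<xi>
  have "fourier (inv_fourier h) \<xi> = complex_of_real (1 / (2 * pi) ^ CARD('n)) * osc (osc h) (- \<xi>)"
    unfolding fourier_osc by (simp add: osc_def[of "inv_fourier h"] osc_def[of "osc h"] inv_fourier_osc mult.left_commute)
  then show "fourier (inv_fourier h) \<xi> = h \<xi>"
    by (simp add: cc_smooth_inversion(2)[OF h])
qed

section \<open>Fourier multipliers and uniqueness of representatives\<close>

lemma schwartz_bounded: "\<phi> \<in> schwartz \<Longrightarrow> \<exists>C. \<forall>x. norm (\<phi> x) \<le> C"
  using schwartz_bound[of \<phi> 0] by simp

lemma schwartz_measurable: "\<phi> \<in> schwartz \<Longrightarrow> \<phi> \<in> borel_measurable borel"
  by (intro smooth_all_measurable schwartz_smooth_all)

lemma integrable_mult_schwartz: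
  fixes f :: "'a::euclidean_space \<Rightarrow> complex"
  assumes f: "integrable lborel f" and \<phi>: "\<phi> \<in> schwartz"
  shows "integrable lborel (\<lambda>x. f x * \<phi> x)"
proof -
  obtain C where C: "\<And>x. norm (\<phi> x) \<le> C" using schwartz_bounded[OF \<phi>] by blast
  show ?thesis
    using integrable_bounded_mult[OF f schwartz_measurable[OF \<phi>] C] by (simp add: mult.commute)
qed

lemma schwartz_seminorm_upper: "\<phi> \<in> schwartz \<Longrightarrow> norm (\<phi> x) \<le> schwartz_seminorm 0 (\<lambda>_. 0) \<phi>"
proof -
  assume "\<phi> \<in> schwartz"
  then obtain C where C: "\<And>x. norm (\<phi> x) \<le> C" using schwartz_bounded by blast
  then have "bdd_above (range (\<lambda>x. norm (\<phi> x)))" by (auto simp: bdd_above_def)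
  then have "norm (\<phi> x) \<le> (SUP x. norm (\<phi> x))" by (rule cSUP_upper[OF UNIV_I])
  then show ?thesis by (simp add: schwartz_seminorm_def multi_partial_0)
qed

lemma tempered_dist_of:
  fixes f :: "real^'n::finite \<Rightarrow> complex"
  assumes f: "integrable lborel f"
  shows "tempered (dist_of f)"
  unfolding tempered_def
proof (intro conjI ballI allI impI)
  fix \<phi> \<eta> :: "real^'n \<Rightarrow> complex" assume "\<phi> \<in> schwartz" "\<eta> \<in> schwartz"
  then show "dist_of f (\<lambda>x. \<phi> x + \<eta> x) = dist_of f \<phi> + dist_of f \<eta>"
    unfolding dist_of_def using integrable_mult_schwartz[OF f] by (simp add: distrib_left)
next
  fix c and \<phi> :: "real^'n \<Rightarrow> complex"
  show "dist_of f (\<lambda>x. c * \<phi> x) = c * dist_of f \<phi>"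
    unfolding dist_of_def by (simp add: mult.left_commute)
next
  fix \<Phi> :: "nat \<Rightarrow> real^'n \<Rightarrow> complex"
  assume "(\<forall>i. \<Phi> i \<in> schwartz) \<and> (\<forall>k \<alpha>. (\<lambda>i. schwartz_seminorm k \<alpha> (\<Phi> i)) \<longlonglongrightarrow> 0)"
  then have S: "\<And>i. \<Phi> i \<in> schwartz" and l: "(\<lambda>i. schwartz_seminorm 0 (\<lambda>_. 0) (\<Phi> i)) \<longlonglongrightarrow> 0" by blast+
  show "(\<lambda>i. dist_of f (\<Phi> i)) \<longlonglongrightarrow> 0"
  proof (rule Lim_null_comparison)
    have "norm (dist_of f (\<Phi> i)) \<le> (LINT x|lborel. norm (f x)) * schwartz_seminorm 0 (\<lambda>_. 0) (\<Phi> i)" for i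
    proof -
      have "norm (dist_of f (\<Phi> i)) \<le> (LINT x|lborel. norm (f x * \<Phi> i x))"
        unfolding dist_of_def by (rule integral_norm_bound)
      also have "\<dots> \<le> (LINT x|lborel. norm (f x) * schwartz_seminorm 0 (\<lambda>_. 0) (\<Phi> i))"
        using f schwartz_seminorm_upper[OF S] order_trans[OF norm_ge_zero schwartz_seminorm_upper[OF S]]
        by (intro integral_mono') (auto simp: norm_mult intro!: mult_left_mono)
      finally show ?thesis by simp
    qed
    then show "\<forall>\<^sub>F i in sequentially. norm (dist_of f (\<Phi> i)) \<le> (LINT x|lborel. norm (f x)) * schwartz_seminorm 0 (\<lambda>_. 0) (\<Phi> i)"
      by simp
    show "(\<lambda>i. (LINT x|lborel. norm (f x)) * schwartz_seminorm 0 (\<lambda>_. 0) (\<Phi> i)) \<longlonglongrightarrow> 0"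
      using tendsto_mult_right_zero[OF l] by simp
  qed
qed

section \<open>Superpositions of plane waves along a linear map\<close>

lemma cis_pair_measurable:
  fixes A :: "'b::euclidean_space \<Rightarrow> 'a::euclidean_space"
  assumes "linear A"
  shows "(\<lambda>p. cis (fst p \<bullet> A (snd p))) \<in> borel_measurable borel" "(\<lambda>p. cis (snd p \<bullet> A (fst p))) \<in> borel_measurable borel"
  by (intro borel_measurable_continuous_onI continuous_intros linear_continuous_on_compose[OF _ assms])+

text \<open>The frequencies range over a space of their own and enter the exponential through
  \<open>A\<close>. With \<open>A\<close> the identity this is an inverse Fourier integral; with
  \<open>A\<close> the sum of the \<open>N\<close> components it is the output of an operator whose
  symbol does not depend on \<open>x\<close>. One set of lemmas covers both.\<close>

definition wave :: "('b::euclidean_space \<Rightarrow> 'a::euclidean_space) \<Rightarrow> ('b \<Rightarrow> complex) \<Rightarrow> 'a \<Rightarrow> complex" where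
  "wave A H x = (LINT \<xi>|lborel. cis (x \<bullet> A \<xi>) * H \<xi>)"

lemma wave_integrable:
  fixes A :: "'b::euclidean_space \<Rightarrow> 'a::euclidean_space"
  assumes "linear A" "integrable lborel H"
  shows "integrable lborel (\<lambda>\<xi>. cis (x \<bullet> A \<xi>) * H \<xi>)"
proof (rule integrable_bounded_mult[OF assms(2), where C=1])
  have "continuous_on UNIV A" using assms(1) by (rule linear_continuous_on_compose[OF continuous_on_id, simplified])
  then show "(\<lambda>\<xi>. cis (x \<bullet> A \<xi>)) \<in> borel_measurable borel"
    by (intro borel_measurable_continuous_onI continuous_intros) auto
qed simp

lemma wave_pairing:
  fixes A :: "'b::euclidean_space \<Rightarrow> 'a::euclidean_space"
  assumes A: "linear A" and H: "integrable lborel H" and \<phi>: "integrable lborel \<phi>"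
  shows "(LINT x|lborel. wave A H x * \<phi> x) = (LINT \<xi>|lborel. H \<xi> * osc \<phi> (A \<xi>))"
proof -
  have "(LINT x|lborel. \<phi> x * (LINT \<xi>|lborel. cis (fst (x, \<xi>) \<bullet> A (snd (x, \<xi>))) * H \<xi>))
      = (LINT \<xi>|lborel. H \<xi> * (LINT x|lborel. cis (fst (x, \<xi>) \<bullet> A (snd (x, \<xi>))) * \<phi> x))"
    by (rule fubini_kernel[OF \<phi> H cis_pair_measurable(1)[OF A]]) simp
  then show ?thesis unfolding wave_def osc_def by (simp add: mult.commute inner_commute)
qed

lemma wave_bound: "norm (wave A H x) \<le> (LINT \<xi>|lborel. norm (H \<xi>))"
  unfolding wave_def by (rule order_trans[OF integral_norm_bound]) (simp add: norm_mult)

lemma wave_continuous: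
  fixes A :: "'b::euclidean_space \<Rightarrow> 'a::euclidean_space"
  assumes A: "linear A" and H: "integrable lborel H"
  shows "continuous_on UNIV (wave A H)"
  unfolding continuous_on_sequentially
proof (intro ballI allI impI)
  fix X and a assume "(\<forall>n. X n \<in> UNIV) \<and> X \<longlonglongrightarrow> (a :: 'a)"
  then have X: "X \<longlonglongrightarrow> a" by blast
  show "(wave A H \<circ> X) \<longlonglongrightarrow> wave A H a"
    unfolding wave_def o_def
  proof (rule integral_dominated_convergence)
    show "(\<lambda>\<xi>. cis (a \<bullet> A \<xi>) * H \<xi>) \<in> borel_measurable lborel"
      "(\<lambda>\<xi>. cis (X n \<bullet> A \<xi>) * H \<xi>) \<in> borel_measurable lborel" for n
      using borel_measurable_integrable[OF wave_integrable[OF A H]] by blast+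
    show "integrable lborel (\<lambda>\<xi>. norm (H \<xi>))" using H by simp
    have "(\<lambda>n. cis (X n \<bullet> A \<xi>)) \<longlonglongrightarrow> cis (a \<bullet> A \<xi>)" for \<xi>
    proof -
      have "continuous_on UNIV cis" by (intro continuous_intros)
      then show ?thesis
        by (rule continuous_on_tendsto_compose) (auto intro!: tendsto_intros X)
    qed
    then show "AE \<xi> in lborel. (\<lambda>n. cis (X n \<bullet> A \<xi>) * H \<xi>) \<longlonglongrightarrow> cis (a \<bullet> A \<xi>) * H \<xi>"
      by (intro AE_I2 tendsto_mult tendsto_const) blast
  qed (simp add: norm_mult)
qed

text \<open>On a test function \<open>\<phi>\<close> the multiplier unfolds to a pairing with
  \<open>fourier (\<lambda>\<xi>. \<psi> \<xi> * inv_fourier \<phi> \<xi>)\<close>. Compact support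
  of \<open>\<psi>\<close> makes the inner function a test function, so inversion identifies
  \<open>osc\<close> of this transform as \<open>\<psi> y * osc \<phi> y\<close>, and the pairing
  formula lets the factor \<open>\<psi>\<close> migrate to the density \<open>H\<close>.\<close>

lemma fourier_multiplier_wave:
  fixes A :: "'b::euclidean_space \<Rightarrow> real^'n::finite"
  assumes A: "linear A" and H: "integrable lborel H" and \<psi>: "cc_smooth \<psi>"
  shows "represents (wave A (\<lambda>\<xi>. \<psi> (A \<xi>) * H \<xi>)) (fourier_multiplier \<psi> (dist_of (wave A H)))"
  unfolding represents_def
proof (intro conjI ballI)
  let ?H = "\<lambda>\<xi>. \<psi> (A \<xi>) * H \<xi>"
  obtain M where M: "\<And>x. norm (\<psi> x) \<le> M" using cc_smooth_bounded[OF \<psi>] by blast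
  have sm: "smooth_all \<psi>" using \<psi> unfolding cc_smooth_def by blast
  have "continuous_on UNIV (\<lambda>\<xi>. \<psi> (A \<xi>))"
    by (intro continuous_on_compose2[OF smooth_all_continuous[OF sm, of UNIV]] linear_continuous_on_compose[OF continuous_on_id A]) auto
  then have H': "integrable lborel ?H"
    by (intro integrable_bounded_mult[OF H _ M]) (rule borel_measurable_continuous_onI)
  have meas: "wave A ?H \<in> borel_measurable borel"
    by (rule borel_measurable_continuous_onI[OF wave_continuous[OF A H']])
  then show "wave A ?H \<in> borel_measurable lborel" by simp
  fix \<phi> :: "real^'n \<Rightarrow> complex" assume \<phi>: "\<phi> \<in> schwartz"
  have i\<phi>: "integrable lborel \<phi>" by (rule rapid_integrable[OF schwartz_rapid[OF \<phi>]])
  show "integrable lborel (\<lambda>x. wave A ?H x * \<phi> x)"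
    by (rule integrable_bounded_mult[OF i\<phi> meas wave_bound])
  let ?c = "complex_of_real (1 / (2 * pi) ^ CARD('n))"
  let ?g = "\<lambda>\<xi>. \<psi> \<xi> * inv_fourier \<phi> \<xi>"
  have g: "cc_smooth ?g"
  proof (rule cc_smooth_mult[OF \<psi>])
    have "smooth_all (\<lambda>\<xi>. ?c * osc \<phi> \<xi>)"
      by (intro smooth_all_mult smooth_all_const smooth_all_osc schwartz_rapid \<phi>)
    then show "smooth_all (inv_fourier \<phi>)" by (simp only: inv_fourier_osc[abs_def])
  qed
  have G: "integrable lborel (fourier ?g)"
    using integrable_lborel_affine[OF integrable_osc_cc[OF g], of "-1" 0] by (simp add: fourier_osc[abs_def])
  have oG: "osc (fourier ?g) y = \<psi> y * osc \<phi> y" for y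
    using cc_smooth_inversion(1)[OF g, of y] by (simp add: fourier_osc[abs_def] inv_fourier_osc)
  have "fourier_multiplier \<psi> (dist_of (wave A H)) \<phi> = (LINT x|lborel. wave A H x * fourier ?g x)"
    by (simp add: fourier_multiplier_def dist_inv_fourier_def dist_mult_def dist_fourier_def dist_of_def)
  also have "\<dots> = (LINT \<xi>|lborel. H \<xi> * osc (fourier ?g) (A \<xi>))" by (rule wave_pairing[OF A H G])
  also have "\<dots> = (LINT \<xi>|lborel. ?H \<xi> * osc \<phi> (A \<xi>))" by (simp add: oG mult_ac)
  also have "\<dots> = (LINT x|lborel. wave A ?H x * \<phi> x)" by (rule wave_pairing[OF A H' i\<phi>, symmetric])
  finally show "fourier_multiplier \<psi> (dist_of (wave A H)) \<phi> = dist_of (wave A ?H) \<phi>"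
    by (simp add: dist_of_def)
qed

section \<open>Uniqueness of the representing function\<close>

lemma smooth_all_polynomial:
  "real_polynomial_function p \<Longrightarrow> smooth_all (\<lambda>x::'a::euclidean_space. complex_of_real (p x))"
proof (induction rule: real_polynomial_function.induct)
  case (linear f)
  have "f x = (\<Sum>b\<in>Basis. (x \<bullet> b) * f b)" for x
    using linear_sum[OF bounded_linear.linear[OF linear], of "\<lambda>b. (x \<bullet> b) *\<^sub>R b" Basis]
      linear_cmul[OF bounded_linear.linear[OF linear]]
    by (simp add: euclidean_representation)
  then have e: "(\<lambda>x. complex_of_real (f x)) = (\<lambda>x. \<Sum>b\<in>Basis. complex_of_real (x \<bullet> b) * complex_of_real (f b))"
    by (intro ext) (metis (no_types, lifting) of_real_mult of_real_sum sum.cong)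
  show ?case unfolding e
    by (intro smooth_all_sum smooth_all_mult smooth_all_linear smooth_all_const finite_Basis)
qed (simp_all add: smooth_all_const smooth_all_add smooth_all_mult)

text \<open>By Stone-Weierstrass, the test functions that are polynomials times \<open>\<theta>\<close> suffice.\<close>

lemma integral_test_continuous:
  fixes d :: "'a::euclidean_space \<Rightarrow> complex"
  assumes test: "\<And>\<phi>. cc_smooth \<phi> \<Longrightarrow> integrable lborel (\<lambda>x. d x * \<phi> x) \<and> (LINT x|lborel. d x * \<phi> x) = 0"
    and \<theta>: "cc_smooth \<theta>" and f: "continuous_on UNIV f"
  shows "(LINT x|lborel. (d x * \<theta> x) * complex_of_real (f x)) = 0"
proof -
  obtain r where r: "\<And>x. norm x > r \<Longrightarrow> \<theta> x = 0" using \<theta> unfolding cc_smooth_def by blast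
  let ?v = "\<lambda>x. d x * \<theta> x"
  have v: "integrable lborel ?v" using test[OF \<theta>] by blast
  have [measurable]: "f \<in> borel_measurable borel" using f by (rule borel_measurable_continuous_onI)
  have vf: "integrable lborel (\<lambda>x. ?v x * complex_of_real (f x))"
  proof -
    have "bounded (f ` cball 0 r)"
      by (intro compact_imp_bounded compact_continuous_image continuous_on_subset[OF f]) auto
    then obtain C where C': "\<forall>y\<in>f ` cball 0 r. norm y \<le> C" unfolding bounded_iff by blast
    have C: "\<bar>f x\<bar> \<le> \<bar>C\<bar>" if "norm x \<le> r" for x
    proof -
      have "norm (f x) \<le> C" using C' that by simp
      then show ?thesis by simp
    qed
    have "integrable lborel (\<lambda>x. complex_of_real (indicator (cball 0 r) x * f x) * ?v x)"
      by (rule integrable_bounded_mult[OF v, where C="\<bar>C\<bar>"]) (use C in \<open>auto simp: indicator_def norm_mult\<close>)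
    moreover have "complex_of_real (indicator (cball 0 r) x * f x) * ?v x = ?v x * complex_of_real (f x)" for x
      using r[of x] by (auto simp: indicator_def)
    ultimately show ?thesis by (simp only:)
  qed
  have bound: "norm (LINT x|lborel. ?v x * complex_of_real (f x)) \<le> e * (LINT x|lborel. norm (?v x))" if e: "e > 0" for e
  proof -
    obtain p where p: "real_polynomial_function p" "\<And>x. x \<in> cball 0 r \<Longrightarrow> \<bar>f x - p x\<bar> < e"
      using Stone_Weierstrass_real_polynomial_function[OF compact_cball continuous_on_subset[OF f subset_UNIV] e] by blast
    have "cc_smooth (\<lambda>x. \<theta> x * complex_of_real (p x))"
      by (rule cc_smooth_mult[OF \<theta> smooth_all_polynomial[OF p(1)]])
    from test[OF this] have ip: "integrable lborel (\<lambda>x. ?v x * complex_of_real (p x))"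
      and zp: "(LINT x|lborel. ?v x * complex_of_real (p x)) = 0" by (simp_all add: mult.assoc)
    have "(LINT x|lborel. ?v x * complex_of_real (f x)) = (LINT x|lborel. ?v x * complex_of_real (f x) - ?v x * complex_of_real (p x))"
      using vf ip zp by simp
    also have "norm \<dots> \<le> (LINT x|lborel. norm (?v x * complex_of_real (f x) - ?v x * complex_of_real (p x)))"
      by (rule integral_norm_bound)
    also have "\<dots> \<le> (LINT x|lborel. e * norm (?v x))"
    proof (rule integral_mono')
      show "integrable lborel (\<lambda>x. e * norm (?v x))" using v by simp
      fix x
      show "norm (?v x * complex_of_real (f x) - ?v x * complex_of_real (p x)) \<le> e * norm (?v x)"
      proof (cases "norm x \<le> r")
        case True
        have "?v x * complex_of_real (f x) - ?v x * complex_of_real (p x) = complex_of_real (f x - p x) * ?v x"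
          by (simp add: algebra_simps)
        then have "norm (?v x * complex_of_real (f x) - ?v x * complex_of_real (p x)) = \<bar>f x - p x\<bar> * norm (?v x)"
          by (metis norm_mult norm_of_real)
        then show ?thesis using p(2)[of x] True by (simp add: mult_right_mono)
      next
        case False
        then show ?thesis using r[of x] by simp
      qed
    qed (use e in simp)
    finally show ?thesis by simp
  qed
  have "norm (LINT x|lborel. ?v x * complex_of_real (f x)) \<le> 0"
  proof (rule field_le_epsilon)
    fix e :: real assume e: "e > 0"
    define K where "K = (LINT x|lborel. norm (?v x))"
    have K: "K \<ge> 0" unfolding K_def by simp
    have "norm (LINT x|lborel. ?v x * complex_of_real (f x)) \<le> e / (K + 1) * K"
      using bound[of "e / (K + 1)"] e K unfolding K_def by simp
    also have "\<dots> \<le> e" using e K by (simp add: field_simps)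
    finally show "norm (LINT x|lborel. ?v x * complex_of_real (f x)) \<le> 0 + e" by simp
  qed
  then show ?thesis by simp
qed

text \<open>The indicator of a closed set is the pointwise limit of the continuous functions
  \<open>max 0 (1 - j * infdist x C)\<close>, and \<open>norm (d x * \<theta> x)\<close> is an
  integrable majorant.\<close>

lemma integral_test_closed:
  fixes d :: "'a::euclidean_space \<Rightarrow> complex"
  assumes test: "\<And>\<phi>. cc_smooth \<phi> \<Longrightarrow> integrable lborel (\<lambda>x. d x * \<phi> x) \<and> (LINT x|lborel. d x * \<phi> x) = 0"
    and \<theta>: "cc_smooth \<theta>" and C: "closed C"
  shows "(LINT x|lborel. (d x * \<theta> x) * complex_of_real (indicator C x)) = 0"
proof (cases "C = {}")
  case False
  define f where "f j x = max 0 (1 - real j * infdist x C)" for j x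
  have fc: "continuous_on UNIV (f j)" for j unfolding f_def by (intro continuous_intros)
  have v: "integrable lborel (\<lambda>x. d x * \<theta> x)" using test[OF \<theta>] by blast
  have [measurable]: "(\<lambda>x. d x * \<theta> x) \<in> borel_measurable borel" using v by auto
  have [measurable]: "f j \<in> borel_measurable borel" for j by (rule borel_measurable_continuous_onI[OF fc])
  have [measurable]: "C \<in> sets borel" using C by simp
  have "(\<lambda>j. LINT x|lborel. (d x * \<theta> x) * complex_of_real (f j x)) \<longlonglongrightarrow> (LINT x|lborel. (d x * \<theta> x) * complex_of_real (indicator C x))"
  proof (rule integral_dominated_convergence)
    show "integrable lborel (\<lambda>x. norm (d x * \<theta> x))" using v by (rule integrable_norm)
    have "(\<lambda>j. f j x) \<longlonglongrightarrow> indicator C x" for x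
    proof (cases "x \<in> C")
      case True then show ?thesis by (simp add: f_def)
    next
      case False
      then have pos: "infdist x C > 0"
        using in_closed_iff_infdist_zero[OF C \<open>C \<noteq> {}\<close>] infdist_nonneg[of x C] by fastforce
      obtain N :: nat where N: "real N * infdist x C > 1" using ex_less_of_nat_mult[OF pos] by blast
      have "f j x = 0" if "j \<ge> N" for j
      proof -
        have "real N * infdist x C \<le> real j * infdist x C" using that pos by (intro mult_right_mono) auto
        then show ?thesis using N by (simp add: f_def)
      qed
      then show ?thesis using False
        by (auto intro!: tendsto_eventually eventually_sequentiallyI[of N])
    qed
    then show "AE x in lborel. (\<lambda>j. (d x * \<theta> x) * complex_of_real (f j x)) \<longlonglongrightarrow> (d x * \<theta> x) * complex_of_real (indicator C x)"
      by (intro AE_I2 tendsto_intros)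
    have "norm (complex_of_real (f j x)) \<le> 1" for j x
      by (simp add: f_def infdist_nonneg)
    then show "AE x in lborel. norm ((d x * \<theta> x) * complex_of_real (f j x)) \<le> norm (d x * \<theta> x)" for j
      by (intro AE_I2) (simp add: norm_mult mult_left_le)
  qed measurable
  then show ?thesis
    using integral_test_continuous[OF test \<theta> fc] by (simp add: LIMSEQ_const_iff)
qed simp

text \<open>If \<open>w\<close> were positive on a set of positive measure, inner regularity would
  give a closed subset of positive measure, over which the integral of \<open>w\<close> could not
  vanish.\<close>

lemma null_if_closed_integrals_zero:
  fixes w :: "'a::euclidean_space \<Rightarrow> real"
  assumes w: "integrable lborel w" and z: "\<And>C. closed C \<Longrightarrow> (LINT x|lborel. w x * indicator C x) = 0"
  shows "AE x in lborel. w x \<le> 0"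
proof -
  have [measurable]: "w \<in> borel_measurable borel" using w by auto
  define E where "E = {x. w x > 0}"
  have E[measurable]: "E \<in> sets borel" unfolding E_def by measurable
  have "emeasure lborel E = 0"
  proof (rule ccontr)
    assume ne: "emeasure lborel E \<noteq> 0"
    obtain e where e: "e > 0" "ennreal e \<le> emeasure lborel E"
    proof (cases "emeasure lborel E")
      case (real r) then show ?thesis using ne that[of r] by (cases "r = 0") auto
    next
      case top then show ?thesis using that[of 1] by simp
    qed
    obtain T where T: "closed T" "T \<subseteq> E" "emeasure lebesgue (E - T) < ennreal e"
      using sets_lebesgue_inner_closed[of E e] E e(1) by (metis sets_completionI_sets sets_lborel)
    have Tm[measurable]: "T \<in> sets borel" using T(1) by simp
    have "emeasure lborel (E - T) < ennreal e" using T(3) by simp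
    have i: "integrable lborel (\<lambda>x. w x * indicator T x)"
      using integrable_real_mult_indicator[of T lborel w] w by simp
    have "AE x in lborel. w x * indicator T x = 0"
    proof (rule integral_nonneg_eq_0_iff_AE[THEN iffD1, OF i _ z[OF T(1)]])
      show "AE x in lborel. 0 \<le> w x * indicator T x"
        using T(2) unfolding E_def by (intro AE_I2) (auto simp: indicator_def)
    qed
    then have "AE x in lborel. x \<notin> T"
    proof eventually_elim
      case (elim x) then show ?case using T(2) unfolding E_def by (auto simp: indicator_def)
    qed
    then have "emeasure lborel T = 0" by (simp add: AE_iff_null_sets[symmetric] null_setsD1[symmetric] emeasure_eq_0_AE)
    then have "emeasure lborel E \<le> emeasure lborel (E - T)"
      using emeasure_subadditive[of "E - T" lborel T] T(2)
      by (metis Diff_partition E Tm Un_commute add.right_neutral sets.Diff sets_lborel)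
    then show False using \<open>emeasure lborel (E - T) < ennreal e\<close> e(2) by simp
  qed
  then have "AE x in lborel. x \<notin> E" using E by (intro AE_not_in null_setsI) auto
  then show ?thesis unfolding E_def by (simp add: not_less)
qed

text \<open>Cut off by a dilate of \<open>\<kappa>\<close>, \<open>d\<close> becomes integrable. The
  balls on which the cutoffs equal 1 exhaust the space, so countably many null sets suffice.\<close>

lemma zero_if_test_zero:
  fixes d :: "'a::euclidean_space \<Rightarrow> complex"
  assumes test: "\<And>\<phi>. cc_smooth \<phi> \<Longrightarrow> integrable lborel (\<lambda>x. d x * \<phi> x) \<and> (LINT x|lborel. d x * \<phi> x) = 0"
    and \<kappa>: "cc_smooth \<kappa>" "\<And>x :: 'a. norm x < 1 \<Longrightarrow> \<kappa> x = 1"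
  shows "AE x in lborel. d x = 0"
proof -
  have "AE x in lborel. \<forall>j. d x * \<kappa> ((1 / real (Suc j)) *\<^sub>R (x - 0)) = 0"
    unfolding AE_all_countable
  proof
    fix j
    define \<theta> where "\<theta> = (\<lambda>x. \<kappa> ((1 / real (Suc j)) *\<^sub>R (x - 0)))"
    have \<theta>: "cc_smooth \<theta>" unfolding \<theta>_def by (rule cc_smooth_scale[OF \<kappa>(1)]) simp
    let ?v = "\<lambda>x. d x * \<theta> x"
    have v: "integrable lborel ?v" using test[OF \<theta>] by blast
    have z: "(LINT x|lborel. ?v x * complex_of_real (indicator C x)) = 0" if "closed C" for C
      by (rule integral_test_closed[OF test \<theta> that])
    have le: "AE x in lborel. Re (s * ?v x) \<le> 0" for s
    proof (rule null_if_closed_integrals_zero)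
      show "integrable lborel (\<lambda>x. Re (s * ?v x))" using v by (intro integrable_Re integrable_mult_right)
      fix C :: "'a set" assume C: "closed C"
      have i: "integrable lborel (\<lambda>x. s * (?v x * complex_of_real (indicator C x)))"
        using integrable_mult_indicator[of C lborel ?v] v C
        by (intro integrable_mult_right) (simp add: scaleR_conv_of_real mult.commute)
      have "(LINT x|lborel. Re (s * ?v x) * indicator C x) = (LINT x|lborel. Re (s * (?v x * complex_of_real (indicator C x))))"
        by (rule Bochner_Integration.integral_cong) (auto simp: indicator_def)
      also have "\<dots> = Re (LINT x|lborel. s * (?v x * complex_of_real (indicator C x)))"
        by (rule integral_Re[OF i])
      also have "\<dots> = 0" using z[OF C] by simp
      finally show "(LINT x|lborel. Re (s * ?v x) * indicator C x) = 0" .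
    qed
    \<comment> \<open>The factors \<open>1\<close>, \<open>-1\<close>, \<open>\<i>\<close> and
      \<open>-\<i>\<close> bound the real and the imaginary part from both sides.\<close>
    have "AE x in lborel. ?v x = 0"
      using le[of 1] le[of "-1"] le[of \<i>] le[of "-\<i>"]
    proof eventually_elim
      case (elim x) then show ?case by (simp add: complex_eq_iff)
    qed
    then show "AE x in lborel. d x * \<kappa> ((1 / real (Suc j)) *\<^sub>R (x - 0)) = 0" unfolding \<theta>_def .
  qed
  then show ?thesis
  proof eventually_elim
    case (elim x)
    obtain j where "norm x < real j" using reals_Archimedean2 by blast
    then have "\<kappa> ((1 / real (Suc j)) *\<^sub>R (x - 0)) = 1" by (intro \<kappa>(2)) (simp add: divide_simps)
    then show ?case using elim by (metis mult.right_neutral)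
  qed
qed

lemma represents_unique:
  fixes u :: "'n::finite dist"
  assumes g: "represents g u" and h: "represents h u"
    and \<kappa>: "cc_smooth \<kappa>" "\<And>x :: real^'n. norm x < 1 \<Longrightarrow> \<kappa> x = (1 :: complex)"
  shows "AE x in lborel. g x = h x"
proof -
  have "AE x in lborel. g x - h x = 0"
  proof (rule zero_if_test_zero[OF _ \<kappa>])
    fix \<phi> :: "real^'n \<Rightarrow> complex" assume "cc_smooth \<phi>"
    then have \<phi>: "\<phi> \<in> schwartz" by (rule cc_smooth_schwartz)
    have i: "integrable lborel (\<lambda>x. g x * \<phi> x)" "integrable lborel (\<lambda>x. h x * \<phi> x)"
      and e: "(LINT x|lborel. g x * \<phi> x) = (LINT x|lborel. h x * \<phi> x)"
      using g h \<phi> unfolding represents_def dist_of_def by metis+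
    then show "integrable lborel (\<lambda>x. (g x - h x) * \<phi> x) \<and> (LINT x|lborel. (g x - h x) * \<phi> x) = 0"
      by (simp add: left_diff_distrib)
  qed
  then show ?thesis by simp
qed

section \<open>Lebesgue and sequence quasi-norms\<close>

lemma epowr_ennreal: "0 \<le> a \<Longrightarrow> epowr (ennreal a) r = ennreal (a powr r)"
  by (simp add: epowr_def)

lemma epowr_mono: assumes "a \<le> b" "0 \<le> r" shows "epowr a r \<le> epowr b r"
proof (cases b)
  case (real b')
  then obtain a' where "a = ennreal a'" "0 \<le> a'" using assms(1) by (cases a) (auto simp: top_unique)
  then show ?thesis using assms real by (simp add: epowr_ennreal powr_mono2)
next
  case top then show ?thesis by (simp add: epowr_def)
qed

lemma epowr_epowr_inverse: assumes "0 < r" shows "epowr (epowr a r) (1 / r) = a"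
proof (cases a)
  case (real x) then show ?thesis using assms by (simp add: epowr_ennreal powr_powr)
next
  case top then show ?thesis by (simp add: epowr_def)
qed

lemma exponent_pos: "0 < p \<Longrightarrow> p \<noteq> \<infinity> \<Longrightarrow> 0 < enn2real p"
  by (metis enn2real_positive_iff infinity_ennreal_def less_top)

lemma dim_over_eq: assumes "0 < p" shows "dim_over TYPE('n::finite) p = real CARD('n) / enn2real p"
proof (cases p)
  case (real r)
  then have "0 < r" using assms by auto
  then show ?thesis using real
    by (simp add: dim_over_def divide_ennreal ennreal_of_nat_eq_real_of_nat)
next
  case top then show ?thesis by (simp add: dim_over_def)
qed

definition weight_mass :: "'a::euclidean_space itself \<Rightarrow> real" where
  "weight_mass _ = (LINT x::'a|lborel. 1 / (1 + norm x) ^ (2 * DIM('a)))"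

lemma weight_scaled:
  assumes \<rho>: "0 < \<rho>"
  shows "integrable lborel (\<lambda>x::'a::euclidean_space. 1 / (1 + \<rho> * norm (x - z)) ^ (2 * DIM('a)))"
    and "(LINT x::'a|lborel. 1 / (1 + \<rho> * norm (x - z)) ^ (2 * DIM('a))) = weight_mass TYPE('a) / \<rho> ^ DIM('a)"
proof -
  let ?f = "\<lambda>x::'a. 1 / (1 + norm x) ^ (2 * DIM('a))"
  have f: "integrable lborel ?f" by (rule integrable_weight) simp
  have e: "?f (- \<rho> *\<^sub>R z + \<rho> *\<^sub>R x) = 1 / (1 + \<rho> * norm (x - z)) ^ (2 * DIM('a))" for x
  proof -
    have "norm (- \<rho> *\<^sub>R z + \<rho> *\<^sub>R x) = \<rho> * norm (x - z)"
      using \<rho> by (metis abs_of_pos norm_scaleR scaleR_diff_right scaleR_minus_left uminus_add_conv_diff)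
    then show ?thesis by simp
  qed
  show "integrable lborel (\<lambda>x::'a. 1 / (1 + \<rho> * norm (x - z)) ^ (2 * DIM('a)))"
    using integrable_lborel_affine[OF f, of \<rho> "- \<rho> *\<^sub>R z"] \<rho> unfolding e by simp
  show "(LINT x::'a|lborel. 1 / (1 + \<rho> * norm (x - z)) ^ (2 * DIM('a))) = weight_mass TYPE('a) / \<rho> ^ DIM('a)"
    using integral_lborel_affine[OF _ f, of \<rho> "- \<rho> *\<^sub>R z"] \<rho> unfolding e weight_mass_def by simp
qed

lemma weight_mass_nonneg: "0 \<le> weight_mass TYPE('a::euclidean_space)"
  unfolding weight_mass_def by simp

text \<open>The condition on \<open>K\<close> puts the \<open>p\<close>-th power of the bound below
  the integrable weight, dilated by \<open>\<rho>\<close>. Adding 1 to \<open>weight_mass\<close>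
  keeps the base positive: for \<open>p = \<infinity>\<close> the exponent
  \<open>1 / enn2real p\<close> is 0, and the power has to be 1, whereas
  \<open>0 powr 0 = 0\<close>.\<close>

lemma Lp_norm_upper:
  fixes g :: "real^'n::finite \<Rightarrow> complex"
  assumes p: "0 < p" and K: "p = \<infinity> \<or> 2 * real CARD('n) \<le> real K * enn2real p"
    and A: "0 \<le> A" and \<rho>: "0 < \<rho>" and [measurable]: "g \<in> borel_measurable borel"
    and g: "\<And>x. norm (g x) \<le> A / (1 + \<rho> * norm x) ^ K"
  shows "Lp_norm p g \<le> ennreal ((1 + weight_mass TYPE(real^'n)) powr (1 / enn2real p) * A * \<rho> powr (- dim_over TYPE('n) p))"
proof (cases "p = \<infinity>")
  case True
  have "norm (g x) \<le> A" for x
  proof -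
    have "A / (1 + \<rho> * norm x) ^ K \<le> A / 1"
      using A \<rho> by (intro divide_left_mono) (auto simp: add_pos_nonneg intro!: one_le_power)
    then show ?thesis using g[of x] by simp
  qed
  then have "esssup lborel (\<lambda>x. ennreal (norm (g x))) \<le> ennreal A"
    by (intro esssup_I) (auto intro: ennreal_leI)
  moreover have "1 + weight_mass TYPE(real^'n) \<noteq> 0" using weight_mass_nonneg[where 'a="real^'n"] by linarith
  ultimately show ?thesis using True \<rho> by (simp add: Lp_norm_def dim_over_def)
next
  case False
  define P where "P = enn2real p"
  let ?n = "CARD('n)"
  let ?W = "weight_mass TYPE(real^'n)"
  have P: "0 < P" unfolding P_def using exponent_pos p False by blast
  have KP: "2 * real ?n \<le> real K * P" using K False P_def by simp
  have le: "norm (g x) powr P \<le> A powr P * (1 / (1 + \<rho> * norm (x - 0)) ^ (2 * DIM(real^'n)))" for x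
  proof -
    have pos: "1 \<le> 1 + \<rho> * norm x" using \<rho> by simp
    have "norm (g x) powr P \<le> (A / (1 + \<rho> * norm x) ^ K) powr P"
      using g[of x] P by (intro powr_mono2) auto
    also have "\<dots> = A powr P / ((1 + \<rho> * norm x) powr real K) powr P"
      using A pos powr_realpow[of "1 + \<rho> * norm x" K] by (simp add: powr_divide)
    also have "\<dots> = A powr P / (1 + \<rho> * norm x) powr (real K * P)"
      by (simp add: powr_powr)
    also have "\<dots> \<le> A powr P / (1 + \<rho> * norm x) powr (2 * real ?n)"
      using pos KP by (intro divide_left_mono powr_mono) auto
    also have "(1 + \<rho> * norm x) powr (2 * real ?n) = (1 + \<rho> * norm (x - 0)) ^ (2 * DIM(real^'n))"
      using pos powr_realpow[of "1 + \<rho> * norm x" "2 * ?n"] by simp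
    finally show ?thesis by simp
  qed
  have "(\<integral>\<^sup>+x. ennreal (norm (g x) powr P) \<partial>lborel) \<le> (\<integral>\<^sup>+x. ennreal (A powr P * (1 / (1 + \<rho> * norm (x - 0 :: real^'n)) ^ (2 * DIM(real^'n)))) \<partial>lborel)"
    by (intro nn_integral_mono ennreal_leI le)
  also have "\<dots> = ennreal (LINT x|lborel. A powr P * (1 / (1 + \<rho> * norm (x - 0 :: real^'n)) ^ (2 * DIM(real^'n))))"
    by (rule nn_integral_eq_integral[OF integrable_mult_right[OF weight_scaled(1)[OF \<rho>]]])
      (use \<rho> in \<open>auto intro!: AE_I2 mult_nonneg_nonneg\<close>)
  also have "\<dots> = ennreal (A powr P * (?W / \<rho> ^ ?n))"
    unfolding integral_mult_right_zero weight_scaled(2)[OF \<rho>] by simp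
  also have "\<dots> \<le> ennreal (A powr P * ((1 + ?W) / \<rho> ^ ?n))"
    using \<rho> by (intro ennreal_leI mult_left_mono divide_right_mono) auto
  finally have "Lp_norm p g \<le> epowr (ennreal (A powr P * ((1 + ?W) / \<rho> ^ ?n))) (1 / P)"
    using False P by (simp add: Lp_norm_def P_def epowr_mono)
  also have "\<dots> = ennreal ((A powr P * ((1 + ?W) / \<rho> ^ ?n)) powr (1 / P))"
    using \<rho> weight_mass_nonneg[where 'a="real^'n"] by (intro epowr_ennreal) auto
  also have "(A powr P * ((1 + ?W) / \<rho> ^ ?n)) powr (1 / P) = (1 + ?W) powr (1 / P) * A * \<rho> powr (- (real ?n / P))"
  proof -
    have "(A powr P * ((1 + ?W) / \<rho> ^ ?n)) powr (1 / P) = (A powr P) powr (1 / P) * ((1 + ?W) powr (1 / P) / (\<rho> powr real ?n) powr (1 / P))"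
      using \<rho> weight_mass_nonneg[where 'a="real^'n"] powr_realpow[OF \<rho>, of ?n] by (simp add: powr_mult powr_divide)
    then show ?thesis using A P by (simp add: powr_powr powr_minus_divide)
  qed
  finally show ?thesis using p by (simp add: P_def dim_over_eq)
qed

text \<open>Chebyshev's inequality. For \<open>p = \<infinity>\<close> the exponent
  \<open>1 / enn2real p\<close> is 0, so the factor with \<open>\<mu>\<close> is 1.\<close>

lemma Lp_norm_lower:
  fixes g :: "real^'n::finite \<Rightarrow> complex"
  assumes p: "0 < p" and [measurable]: "g \<in> borel_measurable borel" "E \<in> sets borel"
    and v: "0 \<le> v" "\<And>x. x \<in> E \<Longrightarrow> v \<le> norm (g x)" and \<mu>: "0 < \<mu>" "ennreal \<mu> \<le> emeasure lborel E"
  shows "ennreal (v * \<mu> powr (1 / enn2real p)) \<le> Lp_norm p g"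
proof (cases "p = \<infinity>")
  case True
  have "ennreal v \<le> esssup lborel (\<lambda>x. ennreal (norm (g x)))"
  proof (rule ccontr)
    assume "\<not> ?thesis"
    then have lt: "esssup lborel (\<lambda>x. ennreal (norm (g x))) < ennreal v" by simp
    have "AE x in lborel. ennreal (norm (g x)) \<le> esssup lborel (\<lambda>x. ennreal (norm (g x)))"
      by (rule esssup_AE)
    then have "AE x in lborel. x \<notin> E"
    proof eventually_elim
      case (elim x) then show ?case using lt v(2)[of x] by (meson ennreal_leI leD order.trans)
    qed
    then have "emeasure lborel E = 0" by (subst (asm) AE_iff_measurable[of E]) auto
    then show False using \<mu> by simp
  qed
  then show ?thesis using True \<mu> by (simp add: Lp_norm_def)
next
  case False
  define P where "P = enn2real p"
  have P: "0 < P" unfolding P_def using exponent_pos p False by blast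
  have "ennreal (v powr P * \<mu>) \<le> ennreal (v powr P) * emeasure lborel E"
    using \<mu> by (simp add: ennreal_mult mult_left_mono)
  also have "\<dots> = (\<integral>\<^sup>+x. ennreal (v powr P) * indicator E x \<partial>lborel)"
    by (simp add: nn_integral_cmult)
  also have "\<dots> \<le> (\<integral>\<^sup>+x. ennreal (norm (g x) powr P) \<partial>lborel)"
    using v P by (intro nn_integral_mono) (auto simp: indicator_def intro!: ennreal_leI powr_mono2)
  finally have "epowr (ennreal (v powr P * \<mu>)) (1 / P) \<le> Lp_norm p g"
    using False P by (simp add: Lp_norm_def P_def epowr_mono)
  moreover have "epowr (ennreal (v powr P * \<mu>)) (1 / P) = ennreal (v * \<mu> powr (1 / P))"
    using v(1) \<mu> P by (simp add: epowr_ennreal powr_mult powr_powr)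
  ultimately show ?thesis by (simp add: P_def)
qed

text \<open>\<open>dist_Lp_norm\<close> is an infimum over representing functions, so a lower bound
  requires that they all agree almost everywhere. The cutoff \<open>\<kappa>\<close> will be
  \<open>\<psi> 0\<close>.\<close>

lemma dist_Lp_norm_lower:
  fixes u :: "'n::finite dist"
  assumes g: "represents g u"
    and \<kappa>: "cc_smooth \<kappa>" "\<And>x :: real^'n. norm x < 1 \<Longrightarrow> \<kappa> x = (1 :: complex)"
  shows "Lp_norm p g \<le> dist_Lp_norm p u"
  unfolding dist_Lp_norm_def
proof (rule INF_greatest)
  fix h assume "h \<in> {h. represents h u}"
  then have h: "represents h u" by simp
  have ae: "AE x in lborel. g x = h x" by (rule represents_unique[OF g h \<kappa>])
  have m: "g \<in> borel_measurable lborel" "h \<in> borel_measurable lborel"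
    using g h unfolding represents_def by blast+
  have "esssup lborel (\<lambda>x. ennreal (norm (g x))) = esssup lborel (\<lambda>x. ennreal (norm (h x)))"
    using ae by (intro esssup_AE_cong) (use m in \<open>auto\<close>)
  moreover have "(\<integral>\<^sup>+x. ennreal (norm (g x) powr enn2real p) \<partial>lborel) = (\<integral>\<^sup>+x. ennreal (norm (h x) powr enn2real p) \<partial>lborel)"
    using ae by (intro nn_integral_cong_AE) auto
  ultimately show "Lp_norm p g \<le> Lp_norm p h" by (simp add: Lp_norm_def)
qed

lemma lq_norm_ge: assumes q: "0 < q" shows "a k \<le> lq_norm q a"
proof (cases "q = \<infinity>")
  case True then show ?thesis by (simp add: lq_norm_def SUP_upper)
next
  case False
  have Q: "0 < enn2real q" using exponent_pos q False by blast
  have "epowr (a k) (enn2real q) \<le> (\<Sum>k. epowr (a k) (enn2real q))"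
    using sum_le_suminf[OF summableI, of "{k}" "\<lambda>k. epowr (a k) (enn2real q)"] by simp
  then have "epowr (epowr (a k) (enn2real q)) (1 / enn2real q) \<le> lq_norm q a"
    using False Q by (simp add: lq_norm_def epowr_mono)
  then show ?thesis using Q by (simp add: epowr_epowr_inverse)
qed

lemma lq_norm_upper:
  assumes q: "0 < q" and F: "finite F" and z: "\<And>l. l \<notin> F \<Longrightarrow> a l = 0"
    and B: "0 \<le> B" "\<And>l. l \<in> F \<Longrightarrow> a l \<le> ennreal B"
  shows "lq_norm q a \<le> ennreal (real (card F) powr (1 / enn2real q) * B)"
proof (cases "q = \<infinity>")
  case True
  have "a l \<le> ennreal (real (card F) powr 0 * B)" for l
  proof (cases "l \<in> F")
    case True
    \<comment> \<open>The base of the power must be nonzero, because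
      \<open>0 powr 0 = 0\<close>.\<close>
    then have "card F \<noteq> 0" using F by auto
    then show ?thesis using B(2)[OF True] by simp
  qed (simp add: z)
  then show ?thesis using True by (simp add: lq_norm_def SUP_least)
next
  case False
  define Q where "Q = enn2real q"
  have Q: "0 < Q" unfolding Q_def using exponent_pos q False by blast
  have "(\<Sum>k. epowr (a k) Q) = (\<Sum>k\<in>F. epowr (a k) Q)"
    using z by (intro suminf_finite[OF F]) (simp add: epowr_def)
  also have "\<dots> \<le> (\<Sum>k\<in>F. ennreal (B powr Q))"
    using B Q epowr_mono by (intro sum_mono) (metis epowr_ennreal less_imp_le)
  also have "\<dots> = ennreal (real (card F) * B powr Q)"
    by (simp add: ennreal_mult ennreal_of_nat_eq_real_of_nat)
  finally have "lq_norm q a \<le> epowr (ennreal (real (card F) * B powr Q)) (1 / Q)"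
    using False Q by (simp add: lq_norm_def Q_def epowr_mono)
  also have "\<dots> = ennreal (real (card F) powr (1 / Q) * B)"
    using B(1) Q by (simp add: epowr_ennreal powr_mult powr_powr)
  finally show ?thesis by (simp add: Q_def)
qed

text \<open>Subadditivity of the measure. It takes the place of the triangle inequality, which fails
  for the quasi-norms with \<open>p < 1\<close>.\<close>

lemma pigeonhole_measure:
  fixes S :: "'i \<Rightarrow> 'a::euclidean_space set"
  assumes F: "finite F" "F \<noteq> {}" and S: "\<And>i. i \<in> F \<Longrightarrow> S i \<in> sets borel" and E: "E \<subseteq> (\<Union>i\<in>F. S i)"
    and \<mu>: "ennreal \<mu> \<le> emeasure lborel E"
  shows "\<exists>i\<in>F. ennreal (\<mu> / real (card F)) \<le> emeasure lborel (S i)"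
proof (rule ccontr)
  assume "\<not> ?thesis"
  then have lt: "emeasure lborel (S i) < ennreal (\<mu> / real (card F))" if "i \<in> F" for i using that by force
  have "0 < \<mu> / real (card F)"
    using lt F(2) by (metis all_not_in_conv ennreal_eq_0_iff leI not_less_zero)
  have "ennreal \<mu> \<le> emeasure lborel (\<Union>i\<in>F. S i)"
    by (rule order_trans[OF \<mu> emeasure_mono[OF E]]) (use S F in auto)
  also have "\<dots> \<le> (\<Sum>i\<in>F. emeasure lborel (S i))"
    using S F by (intro emeasure_subadditive_finite) auto
  also have "\<dots> = (\<Sum>i\<in>F. ennreal (measure lborel (S i)))"
    using lt by (intro sum.cong refl emeasure_eq_ennreal_measure) force
  also have "\<dots> = ennreal (\<Sum>i\<in>F. measure lborel (S i))" by (rule sum_ennreal) simp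
  finally have "\<mu> \<le> (\<Sum>i\<in>F. measure lborel (S i))"
    by (subst (asm) ennreal_le_iff) (auto intro: sum_nonneg)
  also have "\<dots> < (\<Sum>i\<in>F. \<mu> / real (card F))"
  proof (rule sum_strict_mono[OF F])
    fix i assume i: "i \<in> F"
    then have "ennreal (measure lborel (S i)) < ennreal (\<mu> / real (card F))"
      using lt[OF i] by (subst emeasure_eq_ennreal_measure[symmetric]) force+
    then show "measure lborel (S i) < \<mu> / real (card F)" by (simp add: ennreal_less_iff)
  qed
  also have "\<dots> = \<mu>" using F by simp
  finally show False by simp
qed

section \<open>Littlewood-Paley kernels and upper Besov bounds\<close>

lemma lp_schwartz: "littlewood_paley \<psi> \<Longrightarrow> \<psi> k \<in> schwartz"
  unfolding littlewood_paley_def by blast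

lemma lp_supp_0: assumes "littlewood_paley \<psi>" "\<psi> 0 \<xi> \<noteq> 0" shows "norm \<xi> \<le> 2"
proof -
  have "\<xi> \<in> closure {\<xi>. \<psi> 0 \<xi> \<noteq> 0}" using assms(2) by (intro subsetD[OF closure_subset]) simp
  then show ?thesis using assms(1) unfolding littlewood_paley_def by blast
qed

lemma lp_supp: assumes "littlewood_paley \<psi>" "\<psi> k \<xi> \<noteq> 0" "k \<ge> 1"
  shows "2 ^ (k - 1) \<le> norm \<xi>" "norm \<xi> \<le> 2 ^ (k + 1)"
proof -
  have "\<xi> \<in> closure {\<xi>. \<psi> k \<xi> \<noteq> 0}" using assms(2) by (intro subsetD[OF closure_subset]) simp
  then show "2 ^ (k - 1) \<le> norm \<xi>" "norm \<xi> \<le> 2 ^ (k + 1)"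
    using assms(1,3) unfolding littlewood_paley_def by blast+
qed

lemma lp_supp_upper: assumes "littlewood_paley \<psi>" "\<psi> k \<xi> \<noteq> 0" shows "norm \<xi> \<le> 2 * 2 ^ k"
proof (cases "k = 0")
  case True then show ?thesis using lp_supp_0[OF assms(1)] assms(2) by simp
next
  case False then show ?thesis using lp_supp(2)[OF assms] by simp
qed

lemma lp_cc_smooth: assumes "littlewood_paley \<psi>" shows "cc_smooth (\<psi> k)"
  unfolding cc_smooth_def
proof
  show "smooth_all (\<psi> k)" by (rule schwartz_smooth_all[OF lp_schwartz[OF assms]])
  show "\<exists>r. \<forall>x. r < norm x \<longrightarrow> \<psi> k x = 0"
    using lp_supp_upper[OF assms] by (meson not_le)
qed

lemma lp_sum:
  assumes "littlewood_paley \<psi>" "finite F" "\<And>l. l \<notin> F \<Longrightarrow> \<psi> l \<xi> = 0"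
  shows "(\<Sum>l\<in>F. \<psi> l \<xi>) = 1"
proof -
  have "(\<lambda>l. \<psi> l \<xi>) sums (\<Sum>l\<in>F. \<psi> l \<xi>)" using assms(2,3) by (rule sums_finite)
  moreover have "(\<lambda>l. \<psi> l \<xi>) sums 1" using assms(1) unfolding littlewood_paley_def by blast
  ultimately show ?thesis using sums_unique2 by blast
qed

text \<open>The annuli of the other pieces start at radius \<open>2 ^ (l - 1) \<ge> 1\<close>, so
  below radius 1 the partition of unity consists of \<open>\<psi> 0\<close> alone. Together with the
  support in the ball of radius 2 this makes \<open>\<psi> 0\<close> the profile of every bump used
  later.\<close>

lemma lp_one: assumes \<psi>: "littlewood_paley \<psi>" and \<xi>: "norm \<xi> < 1" shows "\<psi> 0 \<xi> = 1"
proof -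
  have "\<psi> l \<xi> = 0" if "l \<notin> {0}" for l
  proof (rule ccontr)
    assume "\<psi> l \<xi> \<noteq> 0"
    then have "2 ^ (l - 1) \<le> norm \<xi>" using lp_supp(1)[OF \<psi>, of l \<xi>] that by simp
    moreover have "(1::real) \<le> 2 ^ (l - 1)" by simp
    ultimately show False using \<xi> by linarith
  qed
  then show ?thesis using lp_sum[OF \<psi>, of "{0}" \<xi>] by simp
qed

lemma lp_annulus:
  assumes \<psi>: "littlewood_paley \<psi>" and \<xi>: "2 ^ k \<le> norm \<xi>" "norm \<xi> \<le> 2 ^ (k + L)" and l: "l \<notin> {k - 1..k + L + 1}"
  shows "\<psi> l \<xi> = 0"
proof (rule ccontr)
  assume ne: "\<psi> l \<xi> \<noteq> 0"
  have "(2::real) ^ k \<le> 2 ^ (l + 1)" using lp_supp_upper[OF \<psi> ne] \<xi>(1) by simp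
  then have "k \<le> l + 1" by (rule power_le_imp_le_exp[rotated]) simp
  then have "l > k + L + 1" using l by auto
  then have "2 ^ (l - 1) \<le> norm \<xi>" using lp_supp(1)[OF \<psi> ne] by simp
  then have "(2::real) ^ (l - 1) \<le> 2 ^ (k + L)" using \<xi>(2) by linarith
  then have "l - 1 \<le> k + L" by (rule power_le_imp_le_exp[rotated]) simp
  then show False using \<open>l > k + L + 1\<close> by simp
qed

section \<open>Kernels of the Littlewood-Paley pieces\<close>

lemma concat_map_replicate:
  "distinct bs \<Longrightarrow> b \<in> set bs \<Longrightarrow> concat (map (\<lambda>b'. replicate (if b' = b then K else 0) b') bs) = replicate K b"
proof (induction bs)
  case (Cons c bs)
  have z: "concat (map (\<lambda>b'. replicate (if b' = b then K else 0) b') bs) = []" if "b \<notin> set bs"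
    using that by auto
  show ?case using Cons z by (cases "c = b") auto
qed simp

lemma multi_partial_single:
  assumes "b \<in> Basis"
  shows "multi_partial (\<lambda>b'. if b' = b then K else 0) f = iter_partial (replicate K b) f"
  unfolding multi_partial_def
  using concat_map_replicate[of "basis_enum :: 'a list" b K] basis_enum[where 'a='a] assms by simp

lemma multi_order_single:
  assumes "b \<in> Basis" shows "multi_order (\<lambda>b'. if b' = b then K else 0) = K"
  unfolding multi_order_def using assms by simp

lemma multi_order_zero: "multi_order (\<lambda>_. 0) = 0"
  unfolding multi_order_def by simp

lemma iter_partial_replicate_scale:
  assumes f: "smooth_all f"
  shows "iter_partial (replicate K (c *\<^sub>R v)) f = (\<lambda>x. complex_of_real (c ^ K) * iter_partial (replicate K v) f x)"
proof (induction K)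
  case (Suc K)
  let ?g = "iter_partial (replicate K v) f"
  have g: "smooth_all ?g" by (rule smooth_all_iter_partial[OF f])
  have "((\<lambda>x. complex_of_real (c ^ K) * ?g x) has_derivative (\<lambda>w. complex_of_real (c ^ K) * dpart w ?g x)) (at x)" for x
    using has_derivative_mult_right[OF smooth_all_has_derivative[OF g]] .
  from dpart_eqI[OF this]
  have "dpart (c *\<^sub>R v) (\<lambda>x. complex_of_real (c ^ K) * ?g x) x = complex_of_real (c ^ K) * dpart (c *\<^sub>R v) ?g x" for x .
  moreover have "dpart (c *\<^sub>R v) ?g x = complex_of_real c * dpart v ?g x" for x
    using linear_cmul[OF linear_frechet_derivative[OF smooth_all_differentiable[OF g]]] by (simp add: scaleR_conv_of_real)
  ultimately show ?case using Suc by (simp add: mult_ac)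
qed simp

lemma osc_dilate:
  fixes h :: "'a::euclidean_space \<Rightarrow> complex"
  assumes h: "integrable lborel h" and c: "0 < c"
  shows "osc h x = complex_of_real (c ^ DIM('a)) * osc (\<lambda>\<eta>. h (c *\<^sub>R \<eta>)) (c *\<^sub>R x)"
  using integral_lborel_affine[OF _ osc_integrable[OF h, of x], of c 0] c
  unfolding osc_def by (simp add: scaleR_conv_of_real)

lemma osc_modulate:
  fixes h :: "'a::euclidean_space \<Rightarrow> complex"
  assumes h: "integrable lborel h"
  shows "osc (\<lambda>\<xi>. h (\<xi> - w)) x = cis (x \<bullet> w) * osc h x"
proof -
  have "integrable lborel (\<lambda>\<xi>. h (\<xi> - w))" using integrable_lborel_affine[OF h, of 1 "- w"] by (simp add: add.commute)
  from integral_lborel_affine[OF _ osc_integrable[OF this, of x], of 1 w]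
  have "osc (\<lambda>\<xi>. h (\<xi> - w)) x = (LINT \<xi>|lborel. cis (x \<bullet> (w + \<xi>)) * h \<xi>)"
    unfolding osc_def by simp
  also have "\<dots> = (LINT \<xi>|lborel. cis (x \<bullet> w) * (cis (x \<bullet> \<xi>) * h \<xi>))"
    by (simp add: inner_add_right cis_mult[symmetric] mult.assoc)
  finally show ?thesis unfolding osc_def by simp
qed

text \<open>Dilating \<open>\<psi> l\<close> by \<open>2 ^ l\<close> puts all pieces into the ball
  of radius 2, and the powers of 2 in the assumed derivative bounds cancel exactly those from the
  chain rule. So \<open>osc_decay\<close> applies with one constant for all \<open>l\<close>;
  undoing the dilation gives the factor \<open>(2 ^ l) ^ CARD('n)\<close>.\<close>

lemma lp_kernel:
  fixes \<psi> :: "nat \<Rightarrow> real^'n::finite \<Rightarrow> complex"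
  assumes \<psi>: "littlewood_paley \<psi>"
  shows "\<exists>C\<ge>0. \<forall>l x. norm (inv_fourier (\<psi> l) x) \<le> C * (2 ^ l) ^ CARD('n) / (1 + 2 ^ l * norm x) ^ K"
proof -
  let ?n = "CARD('n)"
  have "\<forall>\<alpha>. \<exists>C. \<forall>k \<xi>. norm (multi_partial \<alpha> (\<psi> k) \<xi>) \<le> C * 2 powr (- (real k * real (multi_order \<alpha>)))"
    using \<psi> unfolding littlewood_paley_def by blast
  then obtain M where M: "\<And>\<alpha> k \<xi>. norm (multi_partial \<alpha> (\<psi> k) \<xi>) \<le> M \<alpha> * 2 powr (- (real k * real (multi_order \<alpha>)))"
    by metis
  have M0: "norm (\<psi> k \<xi>) \<le> M (\<lambda>_. 0)" for k \<xi>
    using M[of "\<lambda>_. 0" k \<xi>] by (simp add: multi_partial_0 multi_order_zero)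
  define Mb where "Mb b = M (\<lambda>b'. if b' = b then K else 0)" for b
  have Mb: "norm (iter_partial (replicate K b) (\<psi> k) \<xi>) \<le> Mb b * 2 powr (- (real k * real K))" if "b \<in> Basis" for b k \<xi>
    using M[of "\<lambda>b'. if b' = b then K else 0" k \<xi>] that by (simp add: Mb_def multi_partial_single multi_order_single)
  have M0n: "0 \<le> M (\<lambda>_. 0)" using order_trans[OF norm_ge_zero M0[of 0 0]] .
  have Mbn: "0 \<le> Mb b" if "b \<in> Basis" for b
    using order_trans[OF norm_ge_zero Mb[OF that, of 0 0]] by simp
  define A where "A = M (\<lambda>_. 0) + sum Mb Basis"
  have A: "M (\<lambda>_. 0) \<le> A" "\<And>b. b \<in> Basis \<Longrightarrow> Mb b \<le> A" "0 \<le> A"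
    unfolding A_def using M0n Mbn sum_nonneg[of Basis Mb] member_le_sum[of _ Basis Mb] by fastforce+
  define C where "C = 2 ^ K * (1 + real DIM(real^'n) ^ K * real DIM(real^'n)) * (A * measure lborel (cball (0::real^'n) 2))"
  have Cn: "0 \<le> C" unfolding C_def using A(3) by simp
  have "norm (inv_fourier (\<psi> l) x) \<le> C * (2 ^ l) ^ ?n / (1 + 2 ^ l * norm x) ^ K" for l x
  proof -
    let ?h = "\<lambda>\<eta>. \<psi> l (2 ^ l *\<^sub>R \<eta>)"
    have cc: "cc_smooth ?h" using cc_smooth_scale[OF lp_cc_smooth[OF \<psi>, of l], of "2 ^ l" 0] by simp
    have sm: "smooth_all (\<psi> l)" by (rule schwartz_smooth_all[OF lp_schwartz[OF \<psi>]])
    have "(1 + norm (2 ^ l *\<^sub>R x)) ^ K * norm (osc ?h (2 ^ l *\<^sub>R x)) \<le> C"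
      unfolding C_def
    proof (rule osc_decay[OF cc])
      show "\<psi> l (2 ^ l *\<^sub>R \<eta>) = 0" if "2 < norm \<eta>" for \<eta>
        using lp_supp_upper[OF \<psi>, of l "2 ^ l *\<^sub>R \<eta>"] that by fastforce
      show "norm (\<psi> l (2 ^ l *\<^sub>R \<eta>)) \<le> A" for \<eta> using M0 A(1) order_trans by blast
      show "norm (iter_partial (replicate K b) ?h \<eta>) \<le> A" if b: "b \<in> Basis" for b \<eta>
      proof -
        have "iter_partial (replicate K b) (\<lambda>\<eta>. \<psi> l (0 + 2 ^ l *\<^sub>R \<eta>)) = (\<lambda>\<eta>. iter_partial (map ((*\<^sub>R) (2 ^ l)) (replicate K b)) (\<psi> l) (0 + 2 ^ l *\<^sub>R \<eta>))"
          by (rule iter_partial_affine[OF bounded_linear.linear[OF bounded_linear_scaleR_right] sm])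
        then have "norm (iter_partial (replicate K b) ?h \<eta>) = (2 ^ l) ^ K * norm (iter_partial (replicate K b) (\<psi> l) (2 ^ l *\<^sub>R \<eta>))"
          by (simp add: iter_partial_replicate_scale[OF sm] norm_mult norm_power)
        also have "\<dots> \<le> (2 ^ l) ^ K * (Mb b * 2 powr (- (real l * real K)))"
          by (intro mult_left_mono Mb b) simp
        also have "2 powr (- (real l * real K)) = 1 / (2 ^ l) ^ K"
          by (simp add: powr_minus_divide powr_realpow[symmetric] powr_powr)
        also have "(2 ^ l) ^ K * (Mb b * (1 / (2 ^ l) ^ K)) = Mb b" by simp
        finally show ?thesis using A(2)[OF b] by linarith
      qed
    qed
    then have 1: "norm (osc ?h (2 ^ l *\<^sub>R x)) \<le> C / (1 + 2 ^ l * norm x) ^ K"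
      by (subst pos_le_divide_eq) (auto simp: mult.commute add_pos_nonneg)
    have "norm (inv_fourier (\<psi> l) x) = (1 / (2 * pi) ^ ?n) * ((2 ^ l) ^ ?n * norm (osc ?h (2 ^ l *\<^sub>R x)))"
      using osc_dilate[OF rapid_integrable[OF schwartz_rapid[OF lp_schwartz[OF \<psi>, of l]]], of "2 ^ l" x]
      by (simp add: inv_fourier_osc norm_mult norm_power norm_divide)
    also have "\<dots> \<le> 1 * ((2 ^ l) ^ ?n * norm (osc ?h (2 ^ l *\<^sub>R x)))"
    proof (rule mult_right_mono)
      have "1 \<le> (2 * pi) ^ ?n" using pi_ge_two by (intro one_le_power) simp
      then show "1 / (2 * pi) ^ ?n \<le> 1" by (simp del: power_mult_distrib add: divide_le_eq_1)
    qed simp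
    also have "\<dots> \<le> (2 ^ l) ^ ?n * (C / (1 + 2 ^ l * norm x) ^ K)"
      using mult_left_mono[OF 1, of "(2 ^ l) ^ ?n"] by simp
    finally show ?thesis by (simp add: mult.commute)
  qed
  then show ?thesis using Cn by blast
qed

text \<open>The convolution theorem, from \<open>h = fourier (inv_fourier h)\<close> and
  Fubini.\<close>

lemma multiplier_kernel:
  fixes h :: "real^'n::finite \<Rightarrow> complex"
  assumes h: "cc_smooth h" and \<psi>: "cc_smooth \<psi>"
  shows "inv_fourier (\<lambda>\<xi>. \<psi> \<xi> * h \<xi>) x = (LINT y|lborel. inv_fourier h y * inv_fourier \<psi> (x - y))"
proof -
  let ?c = "complex_of_real (1 / (2 * pi) ^ CARD('n))"
  have f: "integrable lborel (inv_fourier h)" by (rule rapid_integrable[OF schwartz_rapid[OF inv_fourier_schwartz[OF h]]])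
  have i\<psi>: "integrable lborel \<psi>" by (rule rapid_integrable[OF cc_smooth_rapid[OF \<psi>]])
  have i: "integrable lborel (\<lambda>\<xi>. ?c * (cis (x \<bullet> \<xi>) * \<psi> \<xi>))" by (intro integrable_mult_right osc_integrable i\<psi>)
  have "inv_fourier (\<lambda>\<xi>. \<psi> \<xi> * h \<xi>) x = (LINT \<xi>|lborel. ?c * (cis (x \<bullet> \<xi>) * \<psi> \<xi>) * h \<xi>)"
    by (simp add: inv_fourier_def mult.assoc)
  also have "\<dots> = (LINT \<xi>|lborel. ?c * (cis (x \<bullet> \<xi>) * \<psi> \<xi>) * (LINT y|lborel. cis (- (fst (\<xi>, y) \<bullet> snd (\<xi>, y))) * inv_fourier h y))"
    by (subst fourier_inv_fourier[OF h, symmetric]) (simp add: fourier_def)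
  also have "\<dots> = (LINT y|lborel. inv_fourier h y * (LINT \<xi>|lborel. cis (- (fst (\<xi>, y) \<bullet> snd (\<xi>, y))) * (?c * (cis (x \<bullet> \<xi>) * \<psi> \<xi>))))"
    by (rule fubini_kernel[OF i f, of "\<lambda>p. cis (- (fst p \<bullet> snd p))"])
      (auto intro!: borel_measurable_continuous_onI continuous_intros)
  also have "\<dots> = (LINT y|lborel. inv_fourier h y * inv_fourier \<psi> (x - y))"
  proof (rule Bochner_Integration.integral_cong[OF refl])
    fix y
    have "cis (- (\<xi> \<bullet> y)) * (?c * (cis (x \<bullet> \<xi>) * \<psi> \<xi>)) = ?c * (cis ((x - y) \<bullet> \<xi>) * \<psi> \<xi>)" for \<xi>
    proof -
      have "cis ((x - y) \<bullet> \<xi>) = cis (- (\<xi> \<bullet> y)) * cis (x \<bullet> \<xi>)"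
        by (simp add: cis_mult inner_diff_left inner_commute[of \<xi> y])
      then show ?thesis by (simp only: mult_ac)
    qed
    then show "inv_fourier h y * (LINT \<xi>|lborel. cis (- (fst (\<xi>, y) \<bullet> snd (\<xi>, y))) * (?c * (cis (x \<bullet> \<xi>) * \<psi> \<xi>))) = inv_fourier h y * inv_fourier \<psi> (x - y)"
      by (simp only: inv_fourier_def fst_conv snd_conv integral_mult_right_zero)
  qed
  finally show ?thesis .
qed

text \<open>The weight \<open>1 + \<rho> * norm x\<close> is at most twice the product of
  \<open>1 + \<rho> * norm y\<close> and \<open>1 + R * norm (x - y)\<close> as long as
  \<open>\<rho> \<le> 2 * R\<close>. So the kernel spends \<open>K\<close> of its powers on passing
  the decay of \<open>f\<close> through and the other \<open>2 * DIM('a)\<close> on integrability,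
  which also absorbs the factor \<open>R ^ DIM('a)\<close>. The factor 2 in the hypothesis is there
  because a function of scale \<open>2 ^ k\<close> also meets the piece with index
  \<open>k - 1\<close>.\<close>

lemma weighted_convolution:
  fixes f k :: "'a::euclidean_space \<Rightarrow> complex"
  assumes f: "\<And>y. norm (f y) \<le> A / (1 + \<rho> * norm y) ^ K"
    and k: "\<And>y. norm (k y) \<le> C * R ^ DIM('a) / (1 + R * norm y) ^ (K + 2 * DIM('a))"
    and AC: "0 \<le> A" "0 \<le> C" and \<rho>: "0 < \<rho>" "\<rho> \<le> 2 * R"
  shows "norm (LINT y|lborel. f y * k (x - y)) \<le> (A * C * 2 ^ K * weight_mass TYPE('a)) / (1 + \<rho> * norm x) ^ K"
proof -
  let ?n = "DIM('a)"
  have R: "0 < R" using \<rho> by linarith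
  let ?B = "A * C * 2 ^ K * R ^ ?n / (1 + \<rho> * norm x) ^ K"
  have pt: "norm (f y * k (x - y)) \<le> ?B * (1 / (1 + R * norm (y - x)) ^ (2 * ?n))" for y
  proof -
    let ?a = "1 + \<rho> * norm x" and ?b = "1 + \<rho> * norm y" and ?d = "1 + R * norm (x - y)"
    have p: "1 \<le> ?a" "1 \<le> ?b" "1 \<le> ?d" using \<rho> R by auto
    have "?a \<le> 1 + \<rho> * (norm y + norm (x - y))"
      using \<rho> norm_triangle_ineq[of y "x - y"] by simp
    also have "\<dots> = ?b + \<rho> * norm (x - y)" by (simp add: algebra_simps)
    also have "\<dots> \<le> ?b + 2 * R * norm (x - y)" using \<rho>(2) by (intro add_left_mono mult_right_mono) auto
    also have "\<dots> \<le> ?b * (2 * ?d)"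
    proof -
      have "2 * R * norm (x - y) \<le> ?b * (2 * R * norm (x - y))" using mult_right_mono[OF p(2), of "2 * R * norm (x - y)"] R by simp
      then show ?thesis using p(2) by (simp only: distrib_left distrib_right mult.assoc mult_1_right mult.left_commute[of _ 2])
    qed
    finally have "?a ^ K \<le> (?b * (2 * ?d)) ^ K" using p by (intro power_mono) auto
    also have "\<dots> = ?b ^ K * 2 ^ K * ?d ^ K" by (simp only: power_mult_distrib mult.assoc)
    finally have key: "?a ^ K \<le> ?b ^ K * 2 ^ K * ?d ^ K" .
    have "norm (f y * k (x - y)) \<le> (A / ?b ^ K) * (C * R ^ ?n / ?d ^ (K + 2 * ?n))"
      unfolding norm_mult using AC p by (intro mult_mono f k) auto
    also have "\<dots> = (A * C * R ^ ?n / ?d ^ (2 * ?n)) * (1 / (?b ^ K * ?d ^ K))"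
      by (simp add: power_add mult_ac)
    also have "\<dots> \<le> (A * C * R ^ ?n / ?d ^ (2 * ?n)) * (2 ^ K / ?a ^ K)"
    proof (intro mult_left_mono)
      show "1 / (?b ^ K * ?d ^ K) \<le> 2 ^ K / ?a ^ K"
        using key p by (subst frac_le_eq) (auto simp: divide_simps mult_ac)
    qed (use AC R p in auto)
    also have "\<dots> = ?B * (1 / ?d ^ (2 * ?n))" by (simp add: mult_ac)
    finally show ?thesis by (simp add: norm_minus_commute)
  qed
  have "norm (LINT y|lborel. f y * k (x - y)) \<le> (LINT y|lborel. norm (f y * k (x - y)))"
    by (rule integral_norm_bound)
  also have "\<dots> \<le> (LINT y|lborel. ?B * (1 / (1 + R * norm (y - x)) ^ (2 * ?n)))"
    by (rule integral_mono'[OF integrable_mult_right[OF weight_scaled(1)[OF R]] pt])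
      (use AC R \<rho> in \<open>auto intro!: divide_nonneg_nonneg mult_nonneg_nonneg\<close>)
  also have "\<dots> = (A * C * 2 ^ K * weight_mass TYPE('a)) / (1 + \<rho> * norm x) ^ K"
    unfolding integral_mult_right_zero weight_scaled(2)[OF R] using R by simp
  finally show ?thesis .
qed

lemma inv_fourier_wave: 
  fixes h :: "real^'n::finite \<Rightarrow> complex"
  shows "inv_fourier h = wave (\<lambda>\<xi>. \<xi>) (\<lambda>\<xi>. complex_of_real (1 / (2 * pi) ^ CARD('n)) * h \<xi>)"
  unfolding inv_fourier_osc' osc_def[abs_def] wave_def[abs_def] ..

text \<open>Each piece inherits the pointwise decay of \<open>inv_fourier h\<close> through
  \<open>weighted_convolution\<close>, and only then is a norm taken; such an argument is valid for
  every \<open>p > 0\<close>. \<open>C\<close> is fixed before \<open>h\<close>, \<open>F\<close>,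
  \<open>A\<close>, \<open>\<rho>\<close> and \<open>S\<close>, since the bound is used along all
  scales.\<close>

lemma besov_norm_upper:
  fixes \<psi> :: "nat \<Rightarrow> real^'n::finite \<Rightarrow> complex"
  assumes \<psi>: "littlewood_paley \<psi>" and p: "0 < p" and q: "0 < q"
    and K: "p = \<infinity> \<or> 2 * real CARD('n) \<le> real K * enn2real p"
  shows "\<exists>C\<ge>0. \<forall>h F A \<rho> S. cc_smooth h \<longrightarrow> finite F \<longrightarrow> (\<forall>l. l \<notin> F \<longrightarrow> (\<forall>\<xi>. \<psi> l \<xi> * h \<xi> = 0)) \<longrightarrow> 0 \<le> A \<longrightarrow> 0 < \<rho> \<longrightarrow>
     (\<forall>y. norm (inv_fourier h y) \<le> A / (1 + \<rho> * norm y) ^ K) \<longrightarrow> (\<forall>l\<in>F. \<rho> \<le> 2 * 2 ^ l) \<longrightarrow> 0 \<le> S \<longrightarrow> (\<forall>l\<in>F. 2 powr (real l * s) \<le> S) \<longrightarrow>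
     besov_norm \<psi> s p q (dist_of (inv_fourier h)) \<le> ennreal (real (card F) powr (1 / enn2real q) * (S * (C * A * \<rho> powr (- dim_over TYPE('n) p))))"
proof -
  let ?n = "CARD('n)"
  let ?c = "complex_of_real (1 / (2 * pi) ^ CARD('n))"
  obtain C0 where C0: "0 \<le> C0" "\<And>l x. norm (inv_fourier (\<psi> l) x) \<le> C0 * (2 ^ l) ^ ?n / (1 + 2 ^ l * norm x) ^ (K + 2 * ?n)"
    using lp_kernel[OF \<psi>] by blast
  let ?W = "weight_mass TYPE(real^'n)"
  define C where "C = (1 + ?W) powr (1 / enn2real p) * (C0 * 2 ^ K * ?W)"
  have Cn: "0 \<le> C" unfolding C_def using C0 weight_mass_nonneg[where 'a="real^'n"] by simp
  have "besov_norm \<psi> s p q (dist_of (inv_fourier h)) \<le> ennreal (real (card F) powr (1 / enn2real q) * (S * (C * A * \<rho> powr (- dim_over TYPE('n) p))))"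
    if h: "cc_smooth h" and F: "finite F" and z: "\<And>l \<xi>. l \<notin> F \<Longrightarrow> \<psi> l \<xi> * h \<xi> = 0" and A: "0 \<le> A" and \<rho>: "0 < \<rho>"
      and f: "\<And>y. norm (inv_fourier h y) \<le> A / (1 + \<rho> * norm y) ^ K" and \<rho>l: "\<And>l. l \<in> F \<Longrightarrow> \<rho> \<le> 2 * 2 ^ l"
      and S: "0 \<le> S" "\<And>l. l \<in> F \<Longrightarrow> 2 powr (real l * s) \<le> S" for h F A \<rho> S
  proof -
    let ?u = "dist_of (inv_fourier h)"
    let ?g = "\<lambda>l. inv_fourier (\<lambda>\<xi>. \<psi> l \<xi> * h \<xi>)"
    have ch: "integrable lborel (\<lambda>\<xi>. ?c * h \<xi>)"
      by (intro integrable_mult_right rapid_integrable cc_smooth_rapid h)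
    have lin: "linear (\<lambda>\<xi>::real^'n. \<xi>)" by (rule linear_id[unfolded id_def])
    have rep: "represents (?g l) (fourier_multiplier (\<psi> l) ?u)" for l
      using fourier_multiplier_wave[OF lin ch lp_cc_smooth[OF \<psi>, of l]]
      by (simp add: inv_fourier_wave mult.left_commute)
    have le: "dist_Lp_norm p (fourier_multiplier (\<psi> l) ?u) \<le> Lp_norm p (?g l)" for l
      unfolding dist_Lp_norm_def using rep by (intro INF_lower) simp
    have meas: "?g l \<in> borel_measurable borel" for l using rep unfolding represents_def by simp
    show ?thesis
      unfolding besov_norm_def
    proof (rule lq_norm_upper[OF q F])
      fix l assume "l \<notin> F"
      then have "(\<lambda>\<xi>. \<psi> l \<xi> * h \<xi>) = (\<lambda>\<xi>. 0)" using z by blast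
      then have "?g l = (\<lambda>x. 0)" by (simp only:) (simp add: inv_fourier_def fun_eq_iff)
      then have "Lp_norm p (?g l) \<le> ennreal ((1 + ?W) powr (1 / enn2real p) * 0 * 1 powr (- dim_over TYPE('n) p))"
        by (intro Lp_norm_upper[OF p K _ _ meas]) auto
      then show "ennreal (2 powr (real l * s)) * dist_Lp_norm p (fourier_multiplier (\<psi> l) ?u) = 0"
        using le[of l] by simp
    next
      show "0 \<le> S * (C * A * \<rho> powr (- dim_over TYPE('n) p))" using S Cn A by simp
      fix l assume l: "l \<in> F"
      have "norm (?g l x) \<le> (A * C0 * 2 ^ K * ?W) / (1 + \<rho> * norm x) ^ K" for x
        unfolding multiplier_kernel[OF h lp_cc_smooth[OF \<psi>]]
        by (rule weighted_convolution[where R="2 ^ l", OF f _ A C0(1) \<rho> \<rho>l[OF l]]) (use C0(2) in simp)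
      then have "Lp_norm p (?g l) \<le> ennreal ((1 + ?W) powr (1 / enn2real p) * (A * C0 * 2 ^ K * ?W) * \<rho> powr (- dim_over TYPE('n) p))"
        using A C0(1) weight_mass_nonneg[where 'a="real^'n"] by (intro Lp_norm_upper[OF p K _ \<rho> meas]) auto
      also have "(1 + ?W) powr (1 / enn2real p) * (A * C0 * 2 ^ K * ?W) * \<rho> powr (- dim_over TYPE('n) p) = C * A * \<rho> powr (- dim_over TYPE('n) p)"
        by (simp add: C_def mult_ac)
      finally have "dist_Lp_norm p (fourier_multiplier (\<psi> l) ?u) \<le> ennreal (C * A * \<rho> powr (- dim_over TYPE('n) p))"
        using le order_trans by blast
      then have "ennreal (2 powr (real l * s)) * dist_Lp_norm p (fourier_multiplier (\<psi> l) ?u) \<le> ennreal S * ennreal (C * A * \<rho> powr (- dim_over TYPE('n) p))"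
        using S(2)[OF l] by (intro mult_mono ennreal_leI) auto
      then show "ennreal (2 powr (real l * s)) * dist_Lp_norm p (fourier_multiplier (\<psi> l) ?u) \<le> ennreal (S * (C * A * \<rho> powr (- dim_over TYPE('n) p)))"
        using S(1) Cn A by (simp add: ennreal_mult)
    qed
  qed
  then show ?thesis using Cn by (intro exI[of _ C]) blast
qed

section \<open>Rudin-Shapiro sums\<close>

text \<open>With z = \<open>cis t\<close>, the step from \<open>k\<close> to \<open>k + 1\<close>
  replaces a pair of polynomials P, Q by P + z^(2^k) Q and P - z^(2^k) Q; \<open>True\<close>
  selects the first, \<open>False\<close> the second.\<close>

fun rs_coeff :: "bool \<Rightarrow> nat \<Rightarrow> nat \<Rightarrow> real" where
  "rs_coeff b 0 j = 1"
| "rs_coeff b (Suc k) j = (if j < 2 ^ k then rs_coeff True k j else (if b then 1 else - 1) * rs_coeff False k (j - 2 ^ k))"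

definition rs_poly :: "bool \<Rightarrow> nat \<Rightarrow> real \<Rightarrow> complex" where
  "rs_poly b k t = (\<Sum>j<2 ^ k. complex_of_real (rs_coeff b k j) * cis (real j * t))"

lemma rs_coeff_sign: "rs_coeff b k j = 1 \<or> rs_coeff b k j = - 1"
proof (induction k arbitrary: b j)
  case (Suc k) then show ?case using Suc[of True j] Suc[of False "j - 2 ^ k"] by auto
qed simp

lemma rs_poly_0: "rs_poly b 0 t = 1"
  by (simp add: rs_poly_def)

lemma rs_poly_Suc:
  "rs_poly b (Suc k) t = rs_poly True k t + (if b then 1 else - 1) * (cis (2 ^ k * t) * rs_poly False k t)"
proof -
  let ?s = "if b then 1 else - 1 :: complex"
  let ?f = "\<lambda>j. complex_of_real (rs_coeff b (Suc k) j) * cis (real j * t)"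
  have "rs_poly b (Suc k) t = sum ?f {0..<2 ^ k + 2 ^ k}"
    by (simp add: rs_poly_def lessThan_atLeast0 mult_2)
  also have "\<dots> = sum ?f {0..<2 ^ k} + sum ?f {2 ^ k..<2 ^ k + 2 ^ k}"
    by (rule sum.atLeastLessThan_concat[symmetric]) auto
  also have "sum ?f {0..<2 ^ k} = rs_poly True k t"
    unfolding rs_poly_def lessThan_atLeast0 by (intro sum.cong) auto
  also have "sum ?f {2 ^ k..<2 ^ k + 2 ^ k} = (\<Sum>j<2 ^ k. ?f (j + 2 ^ k))"
    using sum.shift_bounds_nat_ivl[of ?f 0 "2 ^ k" "2 ^ k"] by (simp add: lessThan_atLeast0)
  also have "\<dots> = ?s * (cis (2 ^ k * t) * rs_poly False k t)"
    unfolding rs_poly_def sum_distrib_left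
  proof (rule sum.cong[OF refl])
    fix j :: nat assume "j \<in> {..<2 ^ k}"
    moreover have "cis (real (j + 2 ^ k) * t) = cis (2 ^ k * t) * cis (real j * t)"
      by (simp add: cis_mult distrib_right add.commute)
    ultimately show "?f (j + 2 ^ k) = ?s * (cis (2 ^ k * t) * (complex_of_real (rs_coeff False k j) * cis (real j * t)))"
      by simp
  qed
  finally show ?thesis .
qed

text \<open>The parallelogram law doubles the sum of squares in each step, since the factor
  \<open>cis\<close> has modulus 1. Both bounds on single polynomials come from here: neither
  exceeds \<open>sqrt 2 * 2 powr (k / 2)\<close>, and at each point the larger one reaches
  \<open>2 powr (k / 2)\<close>.\<close>

lemma rs_poly_parallelogram: "(norm (rs_poly True k t))\<^sup>2 + (norm (rs_poly False k t))\<^sup>2 = 2 * 2 ^ k"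
proof (induction k)
  case (Suc k)
  have "(norm (a + c))\<^sup>2 + (norm (a - c))\<^sup>2 = 2 * ((norm a)\<^sup>2 + (norm c)\<^sup>2)" for a c :: complex
    by (simp only: cmod_power2) (simp add: power2_eq_square algebra_simps)
  from this[of "rs_poly True k t" "cis (2 ^ k * t) * rs_poly False k t"] Suc
  show ?case by (simp add: rs_poly_Suc norm_mult)
qed (simp add: rs_poly_0)

lemma powr_half_power: "(2 powr (real k / 2)) ^ n = 2 powr (real k * real n / 2)"
  by (simp add: powr_power mult.commute)

lemma rs_poly_upper: "norm (rs_poly b k t) \<le> sqrt 2 * 2 powr (real k / 2)"
proof -
  have "(norm (rs_poly b k t))\<^sup>2 \<le> 2 * 2 ^ k"
    using rs_poly_parallelogram[of k t] by (cases b) (auto intro: add_increasing add_increasing2 simp flip: rs_poly_parallelogram[of k t])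
  also have "\<dots> = (sqrt 2 * 2 powr (real k / 2))\<^sup>2"
    by (simp add: power_mult_distrib powr_half_power powr_realpow)
  finally show ?thesis by (rule power2_le_imp_le) simp
qed

lemma rs_poly_lower: "\<exists>b. 2 powr (real k / 2) \<le> norm (rs_poly b k t)"
proof (rule ccontr)
  assume "\<not> ?thesis"
  then have lt: "norm (rs_poly b k t) < 2 powr (real k / 2)" for b by (simp add: not_le)
  have "(norm (rs_poly b k t))\<^sup>2 < 2 ^ k" for b
  proof -
    have "(norm (rs_poly b k t))\<^sup>2 < (2 powr (real k / 2))\<^sup>2"
      using lt[of b] by (intro power_strict_mono) auto
    also have "(2 powr (real k / 2))\<^sup>2 = 2 ^ k" by (simp add: powr_half_power powr_realpow)
    finally show ?thesis .
  qed
  from this[of True] this[of False] show False using rs_poly_parallelogram[of k t] by simp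
qed

section \<open>Lattice cubes and tensor products of Rudin-Shapiro polynomials\<close>

definition grid :: "nat \<Rightarrow> ('n \<Rightarrow> nat) set" where
  "grid k = {m. \<forall>i. m i < 2 ^ k}"

definition lat :: "('n::finite \<Rightarrow> nat) \<Rightarrow> real^'n" where
  "lat m = (\<chi> i. real (m i))"

lemma grid_PiE: "grid k = PiE UNIV (\<lambda>_. {..<2 ^ k})"
  by (auto simp: grid_def PiE_def)

lemma finite_grid: "finite (grid k :: ('n::finite \<Rightarrow> nat) set)"
  unfolding grid_PiE by (intro finite_PiE) auto

lemma card_grid: "card (grid k :: ('n::finite \<Rightarrow> nat) set) = (2 ^ k) ^ CARD('n)"
  unfolding grid_PiE by (subst card_PiE) auto

lemma norm_lat_le: assumes "m \<in> grid k" shows "norm (lat m :: real^'n::finite) \<le> real CARD('n) * 2 ^ k"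
proof -
  have "norm (lat m :: real^'n) \<le> (\<Sum>i\<in>UNIV. \<bar>lat m $ i\<bar>)" by (rule norm_le_l1_cart)
  also have "\<dots> \<le> (\<Sum>i\<in>(UNIV::'n set). 2 ^ k)"
  proof (rule sum_mono)
    fix i
    have "m i \<le> 2 ^ k" using assms by (simp add: grid_def less_imp_le)
    then have "real (m i) \<le> real (2 ^ k)" by (rule of_nat_mono)
    then show "\<bar>lat m $ i\<bar> \<le> 2 ^ k" by (simp add: lat_def)
  qed
  finally show ?thesis by simp
qed

lemma lat_separated:
  assumes "m \<noteq> m'" shows "1 \<le> norm (lat m - lat m' :: real^'n::finite)"
proof -
  obtain i where "m i \<noteq> m' i" using assms by auto
  then have "1 \<le> \<bar>real (m i) - real (m' i)\<bar>" by linarith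
  also have "\<dots> = \<bar>(lat m - lat m') $ i\<bar>" by (simp add: lat_def)
  also have "\<dots> \<le> norm (lat m - lat m')" by (rule component_le_norm_cart)
  finally show ?thesis .
qed

text \<open>In each coordinate \<open>e\<close> chooses one polynomial of the pair. For upper bounds
  any fixed choice will do; the lower bound involves all of them, because which polynomial is the
  larger one changes from point to point.\<close>

definition rs_sign :: "('n::finite \<Rightarrow> bool) \<Rightarrow> nat \<Rightarrow> ('n \<Rightarrow> nat) \<Rightarrow> real" where
  "rs_sign e k m = (\<Prod>i\<in>UNIV. rs_coeff (e i) k (m i))"

lemma rs_sign: "rs_sign e k m = 1 \<or> rs_sign e k m = - 1"
proof -
  have "\<bar>rs_sign e k m\<bar> = 1"
    unfolding rs_sign_def abs_prod using rs_coeff_sign by (intro prod.neutral) (metis abs_1 abs_minus_cancel)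
  then show ?thesis by linarith
qed

lemma rs_tensor:
  "(\<Sum>m\<in>grid k. complex_of_real (rs_sign e k m) * cis (x \<bullet> lat m)) = (\<Prod>i\<in>UNIV. rs_poly (e i) k (x $ i))"
proof -
  have "(\<Prod>i\<in>UNIV. rs_poly (e i) k (x $ i)) = (\<Sum>m\<in>PiE UNIV (\<lambda>_. {..<2 ^ k}). \<Prod>i\<in>UNIV. complex_of_real (rs_coeff (e i) k (m i)) * cis (real (m i) * x $ i))"
    unfolding rs_poly_def by (rule prod_sum_PiE) auto
  also have "\<dots> = (\<Sum>m\<in>grid k. complex_of_real (rs_sign e k m) * cis (x \<bullet> lat m))"
    unfolding grid_PiE
    by (intro sum.cong refl) (simp add: prod.distrib rs_sign_def inner_vec_def lat_def cis_sum mult.commute)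
  finally show ?thesis ..
qed

lemma rs_tensor_upper:
  fixes x :: "real^'n::finite"
  shows "norm (\<Sum>m\<in>grid k. complex_of_real (rs_sign e k m) * cis (x \<bullet> lat m)) \<le> sqrt 2 ^ CARD('n) * 2 powr (real k * real CARD('n) / 2)"
proof -
  have "norm (\<Sum>m\<in>grid k. complex_of_real (rs_sign e k m) * cis (x \<bullet> lat m)) \<le> (\<Prod>i\<in>(UNIV::'n set). sqrt 2 * 2 powr (real k / 2))"
    unfolding rs_tensor prod_norm[symmetric] by (intro prod_mono) (auto intro: rs_poly_upper)
  also have "\<dots> = sqrt 2 ^ CARD('n) * (2 powr (real k / 2)) ^ CARD('n)" by (simp add: power_mult_distrib)
  also have "(2 powr (real k / 2)) ^ CARD('n) = 2 powr (real k * real CARD('n) / 2)"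
    by (rule powr_half_power)
  finally show ?thesis .
qed

text \<open>For \<open>p \<ge> 2\<close> all signs are \<open>1\<close> and the sum peaks near the origin. For \<open>p < 2\<close>, at every point one of
  the \<open>2\<^sup>n\<close> products of Rudin-Shapiro polynomials is large, hence one of them is large on a substantial part
  of the ball. If \<open>p = \<infinity>\<close>, then \<open>1 / enn2real p = 0\<close>.\<close>

lemma exponential_sum_lower:
  fixes p :: ennreal
  assumes p: "0 < p"
  shows "\<exists>c>0. \<forall>k. \<exists>b E v \<mu>. (\<forall>m. b m = 1 \<or> b m = (- 1 :: real)) \<and> E \<in> sets borel \<and> E \<subseteq> ball (0 :: real^'n::finite) 1 \<and>
    0 \<le> v \<and> 0 < \<mu> \<and> ennreal \<mu> \<le> emeasure lborel E \<and>
    (\<forall>x\<in>E. v \<le> norm (\<Sum>m\<in>grid k. complex_of_real (b m) * cis (x \<bullet> lat m))) \<and>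
    c * 2 powr (real k * (real CARD('n) - min (dim_over TYPE('n) p) (real CARD('n) / 2))) \<le> v * \<mu> powr (1 / enn2real p)"
proof -
  let ?n = "CARD('n)"
  let ?P = "enn2real p"
  have dP: "dim_over TYPE('n) p = real ?n / ?P" by (rule dim_over_eq[OF p])
  define V where "V = unit_ball_vol (real ?n)"
  have V: "0 < V" unfolding V_def by simp
  show ?thesis
  proof (cases "real ?n / ?P \<le> real ?n / 2")
    case True
    define c where "c = V powr (1 / ?P) * (1 / (2 * real ?n)) powr (real ?n / ?P) / 2"
    have "\<exists>b E v \<mu>. (\<forall>m. b m = 1 \<or> b m = (- 1 :: real)) \<and> E \<in> sets borel \<and> E \<subseteq> ball (0 :: real^'n::finite) 1 \<and>
      0 \<le> v \<and> 0 < \<mu> \<and> ennreal \<mu> \<le> emeasure lborel E \<and>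
      (\<forall>x\<in>E. v \<le> norm (\<Sum>m\<in>grid k. complex_of_real (b m) * cis (x \<bullet> lat m))) \<and>
      c * 2 powr (real k * (real ?n - min (dim_over TYPE('n) p) (real ?n / 2))) \<le> v * \<mu> powr (1 / ?P)" for k
    proof -
      \<comment> \<open>On the ball of this radius every phase is at most 1/2, because
        \<open>norm (lat m) \<le> n * 2 ^ k\<close>; each term then has real part at least 1/2 and
        nothing cancels.\<close>
      define r where "r = 1 / (2 * real ?n * 2 ^ k)"
      have r: "0 < r" "r \<le> 1"
      proof -
        show "0 < r" by (simp add: r_def)
        have "1 \<le> real ?n" using zero_less_card_finite[where 'a='n] by linarith
        then have "1 \<le> 2 * real ?n" by linarith
        then have "1 * 1 \<le> (2 * real ?n) * 2 ^ k" by (rule mult_mono) simp_all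
        then show "r \<le> 1" by (simp add: r_def divide_le_eq_1)
      qed
      let ?E = "ball (0::real^'n) r"
      let ?v = "(2 ^ k) ^ ?n / 2 :: real"
      let ?\<mu> = "V * r ^ ?n"
      have low: "?v \<le> norm (\<Sum>m\<in>grid k. complex_of_real 1 * cis (x \<bullet> lat m))" if x: "x \<in> ?E" for x
      proof -
        have "1 / 2 \<le> Re (cis (x \<bullet> lat m))" if m: "m \<in> grid k" for m
        proof -
          have "\<bar>x \<bullet> lat m\<bar> \<le> norm x * norm (lat m :: real^'n)" by (rule Cauchy_Schwarz_ineq2)
          also have "\<dots> \<le> r * (real ?n * 2 ^ k)" using x norm_lat_le[OF m] r by (intro mult_mono) auto
          also have "\<dots> = 1 / 2" by (simp add: r_def)
          finally have *: "\<bar>x \<bullet> lat m\<bar> \<le> 1 / 2" .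
          then have "(x \<bullet> lat m)\<^sup>2 \<le> (1 / 2)\<^sup>2" using abs_le_square_iff[of "x \<bullet> lat m" "1 / 2"] by simp
          moreover have "1 - (x \<bullet> lat m)\<^sup>2 / 2 \<le> cos (x \<bullet> lat m)"
            using cos_double_sin[of "(x \<bullet> lat m) / 2"] abs_sin_x_le_abs_x[of "(x \<bullet> lat m) / 2"]
              abs_le_square_iff[of "sin ((x \<bullet> lat m) / 2)" "(x \<bullet> lat m) / 2"] by (simp add: power_divide)
          ultimately show ?thesis by (simp add: power2_eq_square)
        qed
        then have "(\<Sum>m\<in>(grid k :: ('n \<Rightarrow> nat) set). 1 / 2) \<le> (\<Sum>m\<in>grid k. Re (cis (x \<bullet> lat m)))" by (rule sum_mono)
        also have "\<dots> = Re (\<Sum>m\<in>grid k. complex_of_real 1 * cis (x \<bullet> lat m))" by simp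
        also have "\<dots> \<le> norm (\<Sum>m\<in>grid k. complex_of_real 1 * cis (x \<bullet> lat m))" by (rule complex_Re_le_cmod)
        finally show ?thesis by (simp add: card_grid)
      qed
      have val: "c * 2 powr (real k * (real ?n - min (dim_over TYPE('n) p) (real ?n / 2))) \<le> ?v * ?\<mu> powr (1 / ?P)"
      proof -
        have rr: "(r ^ ?n) powr (1 / ?P) = (1 / (2 * real ?n)) powr (real ?n / ?P) * 2 powr (- (real k * (real ?n / ?P)))"
        proof -
          have "r = (1 / (2 * real ?n)) * 2 powr (- real k)"
            by (simp add: r_def powr_minus_divide powr_realpow)
          then have "r powr (real ?n / ?P) = (1 / (2 * real ?n)) powr (real ?n / ?P) * (2 powr (- real k)) powr (real ?n / ?P)"
            by (simp only:) (subst powr_mult; simp)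
          moreover have "(2 powr (- real k)) powr (real ?n / ?P) = 2 powr (- (real k * (real ?n / ?P)))"
            by (simp only: powr_powr mult_minus_left)
          moreover have "(r ^ ?n) powr (1 / ?P) = r powr (real ?n / ?P)"
            using r by (simp flip: powr_realpow add: powr_powr)
          ultimately show ?thesis by (simp only:)
        qed
        have "?v * ?\<mu> powr (1 / ?P) = (2 powr (real k * real ?n) / 2) * (V powr (1 / ?P) * (r ^ ?n) powr (1 / ?P))"
        proof -
          have "((2::real) ^ k) ^ ?n = 2 powr (real k * real ?n)"
            by (simp flip: powr_realpow add: powr_powr)
          then show ?thesis using V r by (simp add: powr_mult)
        qed
        also have "\<dots> = c * (2 powr (real k * real ?n) * 2 powr (- (real k * (real ?n / ?P))))"
          unfolding rr c_def by simp
        also have "2 powr (real k * real ?n) * 2 powr (- (real k * (real ?n / ?P))) = 2 powr (real k * (real ?n - real ?n / ?P))"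
          by (simp add: powr_add[symmetric] right_diff_distrib)
        finally show ?thesis using True by (simp add: dP)
      qed
      show ?thesis
      proof (rule exI[of _ "\<lambda>_. 1"], rule exI[of _ ?E], rule exI[of _ ?v], rule exI[of _ ?\<mu>], intro conjI)
        show "ennreal ?\<mu> \<le> emeasure lborel ?E"
          using emeasure_ball[of r, where 'a="real^'n"] r by (simp add: V_def)
        show "?E \<subseteq> ball 0 1" using r by (intro subset_ball)
        show "\<forall>x\<in>?E. ?v \<le> norm (\<Sum>m\<in>grid k. complex_of_real 1 * cis (x \<bullet> lat m))" using low by blast
        show "c * 2 powr (real k * (real ?n - min (dim_over TYPE('n) p) (real ?n / 2))) \<le> ?v * ?\<mu> powr (1 / ?P)" by (rule val)
      qed (use V r in auto)
    qed
    moreover have "c > 0" using V by (simp add: c_def)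
    ultimately show ?thesis by blast
  next
    case False
    define c where "c = (V / 2 ^ ?n) powr (1 / ?P)"
    let ?\<mu> = "V / 2 ^ ?n"
    have "\<exists>b E v \<mu>. (\<forall>m. b m = 1 \<or> b m = (- 1 :: real)) \<and> E \<in> sets borel \<and> E \<subseteq> ball (0 :: real^'n::finite) 1 \<and>
      0 \<le> v \<and> 0 < \<mu> \<and> ennreal \<mu> \<le> emeasure lborel E \<and>
      (\<forall>x\<in>E. v \<le> norm (\<Sum>m\<in>grid k. complex_of_real (b m) * cis (x \<bullet> lat m))) \<and>
      c * 2 powr (real k * (real ?n - min (dim_over TYPE('n) p) (real ?n / 2))) \<le> v * \<mu> powr (1 / ?P)" for k
    proof -
      let ?v = "2 powr (real k * real ?n / 2)"
      let ?f = "\<lambda>e x. norm (\<Sum>m\<in>grid k. complex_of_real (rs_sign e k m) * cis (x \<bullet> lat m))"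
      define S where "S e = {x \<in> ball (0::real^'n) 1. ?v \<le> ?f e x}" for e :: "'n \<Rightarrow> bool"
      have S: "S e \<in> sets borel" for e
      proof -
        have "?f e \<in> borel_measurable borel"
          by (intro borel_measurable_continuous_onI continuous_intros)
        then show ?thesis unfolding S_def by measurable
      qed
      have cover: "ball (0::real^'n) 1 \<subseteq> (\<Union>e\<in>UNIV. S e)"
      proof
        fix x :: "real^'n" assume x: "x \<in> ball 0 1"
        have "\<forall>i. \<exists>b. 2 powr (real k / 2) \<le> norm (rs_poly b k (x $ i))" using rs_poly_lower by blast
        then obtain e where e: "\<And>i. 2 powr (real k / 2) \<le> norm (rs_poly (e i) k (x $ i))" by metis
        have "?v = (2 powr (real k / 2)) ^ ?n" by (rule powr_half_power[symmetric])
        also have "\<dots> = (\<Prod>i\<in>(UNIV::'n set). 2 powr (real k / 2))" by simp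
        also have "\<dots> \<le> ?f e x" unfolding rs_tensor prod_norm[symmetric] by (intro prod_mono) (use e in auto)
        finally show "x \<in> (\<Union>e\<in>UNIV. S e)" using x unfolding S_def by blast
      qed
      \<comment> \<open>There are \<open>2 ^ n\<close> sets \<open>S e\<close>, so one of them has
        at least the share \<open>V / 2 ^ n\<close> of the ball; which one may depend on
        \<open>k\<close>.\<close>
      have "\<exists>e\<in>UNIV. ennreal (V / real (card (UNIV :: ('n \<Rightarrow> bool) set))) \<le> emeasure lborel (S e)"
        using emeasure_ball[of 1, where 'a="real^'n"]
        by (intro pigeonhole_measure[OF _ _ S cover]) (auto simp: V_def)
      then obtain e where e: "ennreal ?\<mu> \<le> emeasure lborel (S e)"
        by (auto simp: card_fun)
      show ?thesis
      proof (rule exI[of _ "rs_sign e k"], rule exI[of _ "S e"], rule exI[of _ ?v], rule exI[of _ ?\<mu>], intro conjI)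
        show "\<forall>m. rs_sign e k m = 1 \<or> rs_sign e k m = - 1" using rs_sign by blast
        have "real k * (real ?n - real ?n / 2) = real k * real ?n / 2" by (simp add: field_simps)
        then show "c * 2 powr (real k * (real ?n - min (dim_over TYPE('n) p) (real ?n / 2))) \<le> ?v * ?\<mu> powr (1 / ?P)"
          using False by (simp add: dP c_def)
      qed (use S e V in \<open>auto simp: S_def\<close>)
    qed
    moreover have "c > 0" using V by (simp add: c_def)
    ultimately show ?thesis by blast
  qed
qed

section \<open>Test functions with prescribed frequencies\<close>

lemma inv_fourier_affine:
  fixes g :: "real^'n::finite \<Rightarrow> complex"
  assumes g: "cc_smooth g" and c: "0 < c"
  shows "inv_fourier (\<lambda>\<xi>. g (c *\<^sub>R (\<xi> - w))) x = complex_of_real ((1 / c) ^ CARD('n)) * cis (x \<bullet> w) * inv_fourier g ((1 / c) *\<^sub>R x)"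
proof -
  have cg: "cc_smooth (\<lambda>\<xi>. g (c *\<^sub>R \<xi>))" using cc_smooth_scale[OF g, of c 0] c by simp
  have i: "integrable lborel (\<lambda>\<xi>. g (c *\<^sub>R \<xi>))" by (rule rapid_integrable[OF cc_smooth_rapid[OF cg]])
  have "osc (\<lambda>\<xi>. g (c *\<^sub>R (\<xi> - w))) x = cis (x \<bullet> w) * osc (\<lambda>\<xi>. g (c *\<^sub>R \<xi>)) x"
    using osc_modulate[OF i] .
  also have "osc (\<lambda>\<xi>. g (c *\<^sub>R \<xi>)) x = complex_of_real ((1 / c) ^ CARD('n)) * osc g ((1 / c) *\<^sub>R x)"
    using osc_dilate[OF i, of "1 / c" x] c by simp
  finally show ?thesis by (simp add: inv_fourier_osc)
qed

lemma inv_fourier_cmult: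
  fixes g :: "real^'n::finite \<Rightarrow> complex"
  shows "inv_fourier (\<lambda>\<xi>. c * g \<xi>) x = c * inv_fourier g x"
proof -
  have "(LINT \<xi>|lborel. cis (x \<bullet> \<xi>) * (c * g \<xi>)) = (LINT \<xi>|lborel. c * (cis (x \<bullet> \<xi>) * g \<xi>))"
    by (rule Bochner_Integration.integral_cong) auto
  then show ?thesis by (simp only: inv_fourier_def integral_mult_right_zero mult.left_commute)
qed

lemma exponent_weight_exists:
  assumes p: "0 < p" shows "\<exists>K::nat. p = \<infinity> \<or> r \<le> real K * enn2real p"
proof (cases "p = \<infinity>")
  case False
  then have "0 < enn2real p" using exponent_pos p by blast
  then obtain K :: nat where "r / enn2real p < real K" using reals_Archimedean2 by blast
  then show ?thesis using \<open>0 < enn2real p\<close> by (intro exI[of _ K]) (simp add: pos_divide_less_eq less_imp_le)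
qed simp

text \<open>For \<open>p \<le> 2\<close>, \<open>h\<close> is one wide bump, whose inverse transform
  has height about \<open>2 powr (k * n)\<close> and width about \<open>2 powr (- k)\<close>. For
  \<open>p > 2\<close>, \<open>h\<close> is a sum of bumps of fixed size with Rudin-Shapiro signs,
  whose inverse transform is a fixed profile times a sum of size \<open>2 powr (k * n / 2)\<close>.
  In both cases \<open>h\<close> is constant near each lattice point, so multiplication with a
  narrow bump of the symbol leaves only a sign. The grid has side \<open>2 ^ (k + a)\<close> instead
  of \<open>2 ^ k\<close>, because the determined slot requires a larger cube. The hypothesis on
  \<open>W\<close> places the support of \<open>h\<close> in an annulus that meets a bounded number
  of pieces.\<close>

lemma test_function_exists:
  fixes \<psi> :: "nat \<Rightarrow> real^'n::finite \<Rightarrow> complex" and a L :: nat and s :: real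
  assumes \<psi>: "littlewood_paley \<psi>" and p: "0 < p" and q: "0 < q"
  defines "D \<equiv> 2 * (real CARD('n) + 1) * 2 ^ a"
  shows "\<exists>C>0. \<forall>k W. (\<forall>\<xi>. norm (\<xi> - W) \<le> D * 2 ^ k \<longrightarrow> 2 ^ k \<le> norm \<xi> \<and> norm \<xi> \<le> 2 ^ (k + L)) \<longrightarrow>
    (\<exists>h. cc_smooth h \<and>
      (\<forall>m\<in>grid (k + a). (h (W + lat m) = 1 \<or> h (W + lat m) = - 1) \<and>
         (\<forall>\<xi>. norm (\<xi> - (W + lat m)) < 1 / 8 \<longrightarrow> h \<xi> = h (W + lat m))) \<and>
      (\<forall>\<xi>. h \<xi> \<noteq> 0 \<longrightarrow> norm (\<xi> - W) \<le> D * 2 ^ k) \<and>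
      besov_norm \<psi> s p q (dist_of (inv_fourier h)) \<le>
        ennreal (C * 2 powr (real k * (s + real CARD('n) - max (dim_over TYPE('n) p) (real CARD('n) / 2)))))"
proof -
  let ?n = "CARD('n)"
  let ?d = "dim_over TYPE('n) p"
  obtain K where K: "p = \<infinity> \<or> 2 * real ?n \<le> real K * enn2real p" using exponent_weight_exists[OF p] by blast
  obtain C1 where C1: "0 \<le> C1" and up0: "\<forall>h F A \<rho> S. cc_smooth h \<longrightarrow> finite F \<longrightarrow> (\<forall>l. l \<notin> F \<longrightarrow> (\<forall>\<xi>. \<psi> l \<xi> * h \<xi> = 0)) \<longrightarrow> 0 \<le> A \<longrightarrow> 0 < \<rho> \<longrightarrow>
     (\<forall>y. norm (inv_fourier h y) \<le> A / (1 + \<rho> * norm y) ^ K) \<longrightarrow> (\<forall>l\<in>F. \<rho> \<le> 2 * 2 ^ l) \<longrightarrow> 0 \<le> S \<longrightarrow> (\<forall>l\<in>F. 2 powr (real l * s) \<le> S) \<longrightarrow>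
     besov_norm \<psi> s p q (dist_of (inv_fourier h)) \<le> ennreal (real (card F) powr (1 / enn2real q) * (S * (C1 * A * \<rho> powr (- ?d))))"
    using besov_norm_upper[OF \<psi> p q K, of s] by (elim exE conjE) (rule that)
  note up = up0[rule_format]
  obtain C0 where C0: "0 \<le> C0" and C0': "\<forall>l x. norm (inv_fourier (\<psi> l) x) \<le> C0 * (2 ^ l) ^ ?n / (1 + 2 ^ l * norm x) ^ K"
    using lp_kernel[OF \<psi>, of K] by (elim exE conjE) (rule that)
  have C0: "0 \<le> C0" "\<And>x. norm (inv_fourier (\<psi> 0) x) \<le> C0 / (1 + norm x) ^ K"
    using C0 C0'[rule_format, of 0] by simp_all
  \<comment> \<open>\<open>L + 3\<close> bounds the number of indices in \<open>?F k\<close> below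
    (at \<open>k = 0\<close> the subtraction \<open>k - 1\<close> truncates), and the power of 2
    pays for replacing \<open>2 powr (l * s)\<close> by \<open>2 powr (k * s)\<close> when
    \<open>l\<close> and \<open>k\<close> differ by at most \<open>L + 1\<close>.\<close>
  define T where "T = real (L + 3) powr (1 / enn2real q) * 2 powr ((real L + 1) * \<bar>s\<bar>) * C1"
  have T: "0 \<le> T" unfolding T_def using C1 by simp
  let ?F = "\<lambda>k. {k - 1..k + L + 1}"
  have up': "besov_norm \<psi> s p q (dist_of (inv_fourier h)) \<le> ennreal (T * 2 powr (real k * s) * (A * \<rho> powr (- ?d)))"
    if ann: "\<forall>\<xi>. norm (\<xi> - W) \<le> D * 2 ^ k \<longrightarrow> 2 ^ k \<le> norm \<xi> \<and> norm \<xi> \<le> 2 ^ (k + L)"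
      and h: "cc_smooth h" and supp: "\<And>\<xi>. h \<xi> \<noteq> 0 \<Longrightarrow> norm (\<xi> - W) \<le> D * 2 ^ k"
      and A: "0 \<le> A" and \<rho>: "0 < \<rho>" "\<rho> \<le> 2 ^ k" and f: "\<And>y. norm (inv_fourier h y) \<le> A / (1 + \<rho> * norm y) ^ K" for k W h A \<rho>
  proof -
    define S where "S = 2 powr ((real L + 1) * \<bar>s\<bar>) * 2 powr (real k * s)"
    have "besov_norm \<psi> s p q (dist_of (inv_fourier h)) \<le> ennreal (real (card (?F k)) powr (1 / enn2real q) * (S * (C1 * A * \<rho> powr (- ?d))))"
    proof (rule up[OF h _ _ A \<rho>(1) f])
      show "\<psi> l \<xi> * h \<xi> = 0" if "l \<notin> ?F k" for l \<xi>
        using lp_annulus[OF \<psi> _ _ that, of \<xi>] ann supp[of \<xi>] by (cases "h \<xi> = 0") auto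
      show "\<rho> \<le> 2 * 2 ^ l" if "l \<in> ?F k" for l
      proof -
        have "k \<le> Suc l" using that by auto
        then have "(2::real) ^ k \<le> 2 ^ Suc l" by (intro power_increasing) auto
        then show ?thesis using \<rho>(2) by simp
      qed
      show "0 \<le> S" by (simp add: S_def)
      show "2 powr (real l * s) \<le> S" if "l \<in> ?F k" for l
      proof -
        have "\<bar>real l - real k\<bar> \<le> real L + 1" using that by auto
        then have "\<bar>real l - real k\<bar> * \<bar>s\<bar> \<le> (real L + 1) * \<bar>s\<bar>" by (rule mult_right_mono) simp
        moreover have "(real l - real k) * s \<le> \<bar>real l - real k\<bar> * \<bar>s\<bar>" by (simp flip: abs_mult)
        ultimately have "real l * s \<le> (real L + 1) * \<bar>s\<bar> + real k * s" by (simp add: left_diff_distrib)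
        then show ?thesis unfolding S_def powr_add[symmetric] by (intro powr_mono) auto
      qed
    qed simp
    also have "\<dots> \<le> ennreal (real (L + 3) powr (1 / enn2real q) * (S * (C1 * A * \<rho> powr (- ?d))))"
    proof (intro ennreal_leI mult_right_mono powr_mono2)
      show "real (card (?F k)) \<le> real (L + 3)" by simp
    qed (use C1 A in \<open>auto simp: S_def\<close>)
    also have "real (L + 3) powr (1 / enn2real q) * (S * (C1 * A * \<rho> powr (- ?d))) = T * 2 powr (real k * s) * (A * \<rho> powr (- ?d))"
      by (simp add: T_def S_def mult_ac)
    finally show ?thesis .
  qed
  have cc0: "cc_smooth (\<psi> 0)" by (rule lp_cc_smooth[OF \<psi>])
  have latk: "norm (lat m :: real^'n) \<le> real ?n * 2 ^ (k + a)" if "m \<in> grid (k + a)" for m k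
    using norm_lat_le[OF that] .
  show ?thesis
  proof (cases "real ?n / 2 \<le> ?d")
    case True
    \<comment> \<open>\<open>n * 2 ^ (k + a)\<close> bounds the lattice vectors and the
      \<open>+ 1\<close> accommodates the distance 1/8, so \<open>\<psi> 0\<close>, dilated by
      \<open>R * 2 ^ k\<close>, is 1 near all of them. Its support has at most twice this radius,
      which is \<open>D * 2 ^ k\<close>.\<close>
    define R where "R = (real ?n + 1) * 2 ^ a"
    have R1: "1 \<le> R"
    proof -
      have "1 * 1 \<le> (real ?n + 1) * 2 ^ a" by (intro mult_mono) auto
      then show ?thesis by (simp add: R_def)
    qed
    have "\<exists>h. cc_smooth h \<and>
      (\<forall>m\<in>grid (k + a). (h (W + lat m) = 1 \<or> h (W + lat m) = - 1) \<and>
         (\<forall>\<xi>. norm (\<xi> - (W + lat m)) < 1 / 8 \<longrightarrow> h \<xi> = h (W + lat m))) \<and>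
      (\<forall>\<xi>. h \<xi> \<noteq> 0 \<longrightarrow> norm (\<xi> - W) \<le> D * 2 ^ k) \<and>
      besov_norm \<psi> s p q (dist_of (inv_fourier h)) \<le>
        ennreal ((T * (R ^ ?n * C0) + 1) * 2 powr (real k * (s + real ?n - max ?d (real ?n / 2))))"
      if ann: "\<forall>\<xi>. norm (\<xi> - W) \<le> D * 2 ^ k \<longrightarrow> 2 ^ k \<le> norm \<xi> \<and> norm \<xi> \<le> 2 ^ (k + L)" for k W
    proof -
      let ?c = "1 / (R * 2 ^ k)"
      define h where "h = (\<lambda>\<xi>. \<psi> 0 (?c *\<^sub>R (\<xi> - W)))"
      have c: "0 < ?c" using R1 by simp
      have h: "cc_smooth h" unfolding h_def using c by (intro cc_smooth_scale[OF cc0]) auto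
      have one: "h \<xi> = 1" if m: "m \<in> grid (k + a)" and \<xi>: "norm (\<xi> - (W + lat m)) < 1 / 8" for m \<xi>
      proof -
        have "norm (\<xi> - W) \<le> norm (\<xi> - (W + lat m)) + norm (lat m :: real^'n)"
          using norm_triangle_ineq[of "\<xi> - (W + lat m)" "lat m"] by simp
        also have "\<dots> < 1 * 2 ^ (k + a) + real ?n * 2 ^ (k + a)"
          using \<xi> latk[OF m] one_le_power[of "2::real" "k + a"] by linarith
        also have "\<dots> = R * 2 ^ k" by (simp add: R_def algebra_simps power_add)
        finally have "norm (?c *\<^sub>R (\<xi> - W)) < 1" using c R1 by (simp add: divide_simps)
        then show ?thesis unfolding h_def by (rule lp_one[OF \<psi>])
      qed
      have supp: "norm (\<xi> - W) \<le> D * 2 ^ k" if "h \<xi> \<noteq> 0" for \<xi>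
      proof -
        have "norm (?c *\<^sub>R (\<xi> - W)) \<le> 2" using that unfolding h_def by (rule lp_supp_0[OF \<psi>])
        then have "norm (\<xi> - W) \<le> 2 * (R * 2 ^ k)" using R1 by (simp add: divide_simps)
        then show ?thesis by (simp add: D_def R_def algebra_simps)
      qed
      have bnd: "norm (inv_fourier h y) \<le> (R ^ ?n * (2 ^ k) ^ ?n * C0) / (1 + 2 ^ k * norm y) ^ K" for y
      proof -
        have "norm (inv_fourier h y) = (R * 2 ^ k) ^ ?n * norm (inv_fourier (\<psi> 0) ((1 / ?c) *\<^sub>R y))"
          unfolding h_def inv_fourier_affine[OF cc0 c] using R1 by (simp add: norm_mult norm_power power_mult_distrib)
        also have "\<dots> \<le> (R * 2 ^ k) ^ ?n * (C0 / (1 + norm ((1 / ?c) *\<^sub>R y)) ^ K)"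
          using R1 by (intro mult_left_mono C0) auto
        also have "\<dots> \<le> (R * 2 ^ k) ^ ?n * (C0 / (1 + 2 ^ k * norm y) ^ K)"
        proof (intro mult_left_mono divide_left_mono power_mono)
          have "1 * (2 ^ k * norm y) \<le> R * (2 ^ k * norm y)" using R1 by (intro mult_right_mono) auto
          then show "1 + 2 ^ k * norm y \<le> 1 + norm ((1 / ?c) *\<^sub>R y)" using R1 by (simp add: mult.assoc)
        qed (use R1 C0 in \<open>auto intro!: mult_pos_pos zero_less_power add_pos_nonneg\<close>)
        finally show ?thesis by (simp add: power_mult_distrib)
      qed
      have "besov_norm \<psi> s p q (dist_of (inv_fourier h)) \<le> ennreal (T * 2 powr (real k * s) * ((R ^ ?n * (2 ^ k) ^ ?n * C0) * (2 ^ k) powr (- ?d)))"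
        by (rule up'[OF ann h supp _ _ _ bnd]) (use R1 C0 in auto)
      also have "T * 2 powr (real k * s) * ((R ^ ?n * (2 ^ k) ^ ?n * C0) * (2 ^ k) powr (- ?d)) = T * (R ^ ?n * C0) * 2 powr (real k * (s + real ?n - ?d))"
      proof -
        have "((2::real) ^ k) ^ ?n = 2 powr (real k * real ?n)" by (simp flip: powr_realpow add: powr_powr)
        moreover have "((2::real) ^ k) powr (- ?d) = 2 powr (real k * (- ?d))" by (simp flip: powr_realpow add: powr_powr)
        moreover have "2 powr (real k * (s + real ?n - ?d)) = 2 powr (real k * s) * 2 powr (real k * real ?n) * 2 powr (real k * (- ?d))"
          unfolding powr_add[symmetric] by (simp add: algebra_simps)
        ultimately show ?thesis by simp
      qed
      also have "ennreal \<dots> \<le> ennreal ((T * (R ^ ?n * C0) + 1) * 2 powr (real k * (s + real ?n - max ?d (real ?n / 2))))"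
        using max_absorb1[OF True] by (intro ennreal_leI) (simp only: mult_right_mono powr_ge_zero le_add_same_cancel1 zero_le_one)
      finally show ?thesis using h one supp by (intro exI[of _ h]) auto
    qed
    moreover have "0 < T * (R ^ ?n * C0) + 1" using T R1 C0(1) by (intro add_nonneg_pos) auto
    ultimately show ?thesis by blast
  next
    case False
    define A where "A = C0 * 8 ^ K * (sqrt 2 ^ ?n * 2 powr (real a * real ?n / 2))"
    have A: "0 \<le> A" unfolding A_def using C0(1) by simp
    have "\<exists>h. cc_smooth h \<and>
      (\<forall>m\<in>grid (k + a). (h (W + lat m) = 1 \<or> h (W + lat m) = - 1) \<and>
         (\<forall>\<xi>. norm (\<xi> - (W + lat m)) < 1 / 8 \<longrightarrow> h \<xi> = h (W + lat m))) \<and>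
      (\<forall>\<xi>. h \<xi> \<noteq> 0 \<longrightarrow> norm (\<xi> - W) \<le> D * 2 ^ k) \<and>
      besov_norm \<psi> s p q (dist_of (inv_fourier h)) \<le>
        ennreal ((T * A + 1) * 2 powr (real k * (s + real ?n - max ?d (real ?n / 2))))"
      if ann: "\<forall>\<xi>. norm (\<xi> - W) \<le> D * 2 ^ k \<longrightarrow> 2 ^ k \<le> norm \<xi> \<and> norm \<xi> \<le> 2 ^ (k + L)" for k W
    proof -
      let ?r = "rs_sign (\<lambda>_::'n. True) (k + a)"
      \<comment> \<open>Dilated by 8, the bump is 1 within distance 1/8 of its lattice point and
        vanishes beyond 1/4; lattice points have distance at least 1, so the bumps do not
        meet.\<close>
      define b where "b m \<xi> = \<psi> 0 (8 *\<^sub>R (\<xi> - (W + lat m)))" for m \<xi>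
      have b: "cc_smooth (b m)" for m unfolding b_def by (intro cc_smooth_scale[OF cc0]) simp
      define h where "h = (\<lambda>\<xi>. \<Sum>m\<in>grid (k + a). complex_of_real (?r m) * b m \<xi>)"
      have h: "cc_smooth h" unfolding h_def
        by (intro cc_smooth_sum finite_grid cc_smooth_mult' smooth_all_const b)
      have val: "h \<xi> = complex_of_real (?r m)" if m: "m \<in> grid (k + a)" and \<xi>: "norm (\<xi> - (W + lat m)) < 1 / 8" for m \<xi>
      proof -
        have z: "b m' \<xi> = 0" if "m' \<noteq> m" for m'
        proof (rule ccontr)
          assume "b m' \<xi> \<noteq> 0"
          then have "norm (8 *\<^sub>R (\<xi> - (W + lat m'))) \<le> 2" unfolding b_def by (rule lp_supp_0[OF \<psi>])
          then have "norm (\<xi> - (W + lat m')) \<le> 1 / 4" by simp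
          moreover have "norm (lat m - lat m' :: real^'n) \<le> norm (\<xi> - (W + lat m')) + norm (\<xi> - (W + lat m))"
            using norm_triangle_ineq4[of "\<xi> - (W + lat m')" "\<xi> - (W + lat m)"] by simp
          ultimately show False using lat_separated[of m m'] that \<xi> by auto
        qed
        have "h \<xi> = (\<Sum>m'\<in>{m}. complex_of_real (?r m') * b m' \<xi>)"
          unfolding h_def using m z by (intro sum.mono_neutral_right finite_grid) auto
        moreover have "b m \<xi> = 1" unfolding b_def using \<xi> by (intro lp_one[OF \<psi>]) simp
        ultimately show ?thesis by simp
      qed
      have supp: "norm (\<xi> - W) \<le> D * 2 ^ k" if "h \<xi> \<noteq> 0" for \<xi>
      proof -
        obtain m where m: "m \<in> grid (k + a)" "b m \<xi> \<noteq> 0"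
          using \<open>h \<xi> \<noteq> 0\<close> unfolding h_def by (metis (no_types, lifting) mult_zero_right sum.neutral)
        have "norm (8 *\<^sub>R (\<xi> - (W + lat m))) \<le> 2" using m(2) unfolding b_def by (rule lp_supp_0[OF \<psi>])
        then have "norm (\<xi> - (W + lat m)) \<le> 1 / 4" by simp
        moreover have "norm (\<xi> - W) \<le> norm (\<xi> - (W + lat m)) + norm (lat m :: real^'n)"
          using norm_triangle_ineq[of "\<xi> - (W + lat m)" "lat m"] by simp
        ultimately have "norm (\<xi> - W) \<le> 1 * 2 ^ (k + a) + real ?n * 2 ^ (k + a)"
          using latk[OF m(1)] one_le_power[of "2::real" "k + a"] by linarith
        also have "\<dots> \<le> 2 * (1 * 2 ^ (k + a) + real ?n * 2 ^ (k + a))" by simp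
        also have "\<dots> = D * 2 ^ k" by (simp add: D_def algebra_simps power_add)
        finally show ?thesis .
      qed
      have bnd: "norm (inv_fourier h y) \<le> (A * 2 powr (real k * real ?n / 2)) / (1 + 1 * norm y) ^ K" for y
      proof -
        have i: "integrable lborel (\<lambda>\<xi>. cis (y \<bullet> \<xi>) * (complex_of_real (?r m) * b m \<xi>))" for m
          by (intro osc_integrable integrable_mult_right rapid_integrable cc_smooth_rapid b)
        have "inv_fourier h y = complex_of_real (1 / (2 * pi) ^ ?n) * (LINT \<xi>|lborel. (\<Sum>m\<in>grid (k + a). cis (y \<bullet> \<xi>) * (complex_of_real (?r m) * b m \<xi>)))"
          by (simp only: inv_fourier_def h_def sum_distrib_left)
        also have "\<dots> = complex_of_real (1 / (2 * pi) ^ ?n) * (\<Sum>m\<in>grid (k + a). (LINT \<xi>|lborel. cis (y \<bullet> \<xi>) * (complex_of_real (?r m) * b m \<xi>)))"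
          by (subst Bochner_Integration.integral_sum[OF i]) (rule refl)
        also have "\<dots> = (\<Sum>m\<in>grid (k + a). inv_fourier (\<lambda>\<xi>. complex_of_real (?r m) * b m \<xi>) y)"
          by (simp only: inv_fourier_def sum_distrib_left)
        also have "\<dots> = (\<Sum>m\<in>grid (k + a). complex_of_real (?r m) * inv_fourier (b m) y)"
          by (intro sum.cong refl) (rule inv_fourier_cmult)
        \<comment> \<open>The bumps are translates of one another, so their inverse transforms share
          one profile and differ only by the phases \<open>cis (y \<bullet> lat m)\<close>.\<close>
        also have "\<dots> = (\<Sum>m\<in>grid (k + a). complex_of_real ((1 / 8) ^ ?n) * cis (y \<bullet> W) * inv_fourier (\<psi> 0) ((1 / 8) *\<^sub>R y) * (complex_of_real (?r m) * cis (y \<bullet> lat m)))"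
          unfolding b_def by (intro sum.cong refl, subst inv_fourier_affine[OF cc0]) (auto simp: inner_add_right cis_mult[symmetric] mult_ac)
        also have "\<dots> = complex_of_real ((1 / 8) ^ ?n) * cis (y \<bullet> W) * inv_fourier (\<psi> 0) ((1 / 8) *\<^sub>R y) * (\<Sum>m\<in>grid (k + a). complex_of_real (?r m) * cis (y \<bullet> lat m))"
          by (simp add: sum_distrib_left)
        finally have "norm (inv_fourier h y) = (1 / 8) ^ ?n * norm (inv_fourier (\<psi> 0) ((1 / 8) *\<^sub>R y)) * norm (\<Sum>m\<in>grid (k + a). complex_of_real (?r m) * cis (y \<bullet> lat m))"
          by (simp add: norm_mult norm_power norm_divide)
        also have "\<dots> \<le> 1 * (C0 / (1 + norm ((1 / 8) *\<^sub>R y)) ^ K) * (sqrt 2 ^ ?n * 2 powr (real (k + a) * real ?n / 2))"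
          by (intro mult_mono C0 rs_tensor_upper) (auto intro!: power_le_one mult_nonneg_nonneg divide_nonneg_nonneg C0)
        also have "\<dots> \<le> 1 * (C0 * 8 ^ K / (1 + norm y) ^ K) * (sqrt 2 ^ ?n * 2 powr (real (k + a) * real ?n / 2))"
        proof (intro mult_right_mono mult_left_mono)
          have "(1 + norm y) ^ K \<le> (8 * (1 + norm ((1 / 8) *\<^sub>R y))) ^ K" by (intro power_mono) auto
          then have "(1 + norm y) ^ K \<le> 8 ^ K * (1 + norm ((1 / 8) *\<^sub>R y)) ^ K" by (simp only: power_mult_distrib)
          moreover have "0 < (1 + norm y) ^ K" "0 < (1 + norm ((1 / 8) *\<^sub>R y)) ^ K"
            by (intro zero_less_power add_pos_nonneg; simp)+
          ultimately have "C0 * 8 ^ K / (8 ^ K * (1 + norm ((1 / 8) *\<^sub>R y)) ^ K) \<le> C0 * 8 ^ K / (1 + norm y) ^ K"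
            using C0(1) by (intro divide_left_mono) auto
          then show "C0 / (1 + norm ((1 / 8) *\<^sub>R y)) ^ K \<le> C0 * 8 ^ K / (1 + norm y) ^ K"
            by (simp only: mult.commute[of C0] mult_divide_mult_cancel_left_if power_eq_0_iff) simp
        qed auto
        also have "2 powr (real (k + a) * real ?n / 2) = 2 powr (real a * real ?n / 2) * 2 powr (real k * real ?n / 2)"
          unfolding powr_add[symmetric] by (simp add: field_simps)
        finally show ?thesis by (simp add: A_def mult_ac)
      qed
      \<comment> \<open>The decay is at unit scale, \<open>\<rho> = 1\<close>, so the power of
        \<open>\<rho>\<close> that would carry \<open>n / p\<close> is 1.\<close>
      have "besov_norm \<psi> s p q (dist_of (inv_fourier h)) \<le> ennreal (T * 2 powr (real k * s) * ((A * 2 powr (real k * real ?n / 2)) * 1 powr (- ?d)))"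
        by (rule up'[OF ann h supp _ _ _ bnd]) (use A in auto)
      also have "T * 2 powr (real k * s) * ((A * 2 powr (real k * real ?n / 2)) * 1 powr (- ?d)) = T * A * 2 powr (real k * (s + real ?n - real ?n / 2))"
      proof -
        have "2 powr (real k * (s + real ?n - real ?n / 2)) = 2 powr (real k * s) * 2 powr (real k * real ?n / 2)"
          unfolding powr_add[symmetric] by (simp add: field_simps)
        then show ?thesis by simp
      qed
      also have "ennreal \<dots> \<le> ennreal ((T * A + 1) * 2 powr (real k * (s + real ?n - max ?d (real ?n / 2))))"
        using max_absorb2[of ?d "real ?n / 2"] False by (intro ennreal_leI) (simp add: mult_right_mono)
      finally show ?thesis using h val supp rs_sign[of "\<lambda>_::'n. True" "k + a"] by (intro exI[of _ h]) fastforce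
    qed
    moreover have "0 < T * A + 1" using T A by (intro add_nonneg_pos) auto
    ultimately show ?thesis by blast
  qed
qed

section \<open>Lattice symbols\<close>

definition round_vec :: "(real^'n)^'N \<Rightarrow> (real^'n::finite)^'N::finite" where
  "round_vec \<xi> = (\<chi> j i. of_int (round (\<xi> $ j $ i)))"

definition integer_vec :: "(real^'n::finite)^'N::finite \<Rightarrow> bool" where
  "integer_vec \<nu> \<longleftrightarrow> (\<forall>j i. \<nu> $ j $ i \<in> \<int>)"

lemma integer_vec_round_vec: "integer_vec (round_vec \<xi>)"
  by (simp add: integer_vec_def round_vec_def)

lemma round_vec_unique:
  assumes "integer_vec \<nu>" and "\<And>j i. \<bar>\<xi> $ j $ i - \<nu> $ j $ i\<bar> < 1 / 2"
  shows "round_vec \<xi> = \<nu>"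
proof -
  have "of_int (round (\<xi> $ j $ i)) = \<nu> $ j $ i" for j i
  proof -
    obtain z where z: "\<nu> $ j $ i = of_int z" using assms(1) unfolding integer_vec_def by (metis Ints_cases)
    then show ?thesis using assms(2)[of j i] round_unique'[of "\<xi> $ j $ i" z] by simp
  qed
  then show ?thesis by (simp add: round_vec_def vec_eq_iff)
qed

lemma component2_le_norm: "\<bar>\<xi> $ j $ i\<bar> \<le> norm (\<xi> :: (real^'n::finite)^'N::finite)"
  by (rule order_trans[OF component_le_norm_cart Finite_Cartesian_Product.norm_nth_le])

text \<open>The bound 1/8 leaves a margin below 1/2: if a point lies in the support of the translate
  at an integer vector, then every point within distance 1/8 of it still rounds to that
  vector.\<close>

definition small_supp :: "((real^'n::finite)^'N::finite \<Rightarrow> complex) \<Rightarrow> bool" where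
  "small_supp H \<longleftrightarrow> (\<forall>\<xi> j i. H \<xi> \<noteq> 0 \<longrightarrow> \<bar>\<xi> $ j $ i\<bar> \<le> 1 / 8)"

lemma round_vec_of_small_supp:
  assumes "small_supp H" "integer_vec \<nu>" "H (\<xi> - \<nu>) \<noteq> 0" shows "round_vec \<xi> = \<nu>"
proof (rule round_vec_unique[OF assms(2)])
  show "\<bar>\<xi> $ j $ i - \<nu> $ j $ i\<bar> < 1 / 2" for j i
  proof -
    have "\<bar>(\<xi> - \<nu>) $ j $ i\<bar> \<le> 1 / 8" using assms(1,3) unfolding small_supp_def by blast
    then show ?thesis by simp
  qed
qed

text \<open>The value at \<open>\<xi>\<close> of \<open>\<Sum>\<nu>. c \<nu> * H (\<xi> - \<nu>)\<close>, where \<open>\<nu>\<close> ranges over all integer vectors: if \<open>H\<close> has small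
  support, only the nearest one contributes.\<close>

definition lattice_sum :: "((real^'n)^'N \<Rightarrow> complex) \<Rightarrow> ((real^'n)^'N \<Rightarrow> complex) \<Rightarrow> (real^'n::finite)^'N::finite \<Rightarrow> complex" where
  "lattice_sum c H \<xi> = c (round_vec \<xi>) * H (\<xi> - round_vec \<xi>)"

text \<open>Rounding jumps only where nothing is seen: if \<open>\<xi>0\<close> and
  \<open>\<xi>\<close> round to different vectors, both candidate terms vanish at
  \<open>\<xi>\<close>. Hence near every point the sum is a single fixed translate and can be
  differentiated as such.\<close>

lemma lattice_sum_local:
  assumes H: "small_supp H" and \<xi>: "\<xi> \<in> ball \<xi>0 (1 / 8)"
  shows "lattice_sum c H \<xi> = c (round_vec \<xi>0) * H (- round_vec \<xi>0 + \<xi>)"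
proof (cases "round_vec \<xi> = round_vec \<xi>0")
  case True then show ?thesis by (simp add: lattice_sum_def)
next
  case False
  have "H (\<xi> - round_vec \<xi>) = 0"
  proof (rule ccontr)
    assume ne: "H (\<xi> - round_vec \<xi>) \<noteq> 0"
    have "\<bar>\<xi>0 $ j $ i - round_vec \<xi> $ j $ i\<bar> < 1 / 2" for j i
    proof -
      have "\<bar>\<xi> $ j $ i - round_vec \<xi> $ j $ i\<bar> \<le> 1 / 8"
        using H ne unfolding small_supp_def by (metis vector_minus_component)
      moreover have "\<bar>\<xi>0 $ j $ i - \<xi> $ j $ i\<bar> < 1 / 8"
        using component2_le_norm[of "\<xi>0 - \<xi>" j i] \<xi> by (simp add: dist_norm)
      ultimately show ?thesis by linarith
    qed
    then show False using round_vec_unique[OF integer_vec_round_vec] False by metis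
  qed
  moreover have "H (\<xi> - round_vec \<xi>0) = 0"
    using round_vec_of_small_supp[OF H integer_vec_round_vec] False by blast
  ultimately show ?thesis by (simp add: lattice_sum_def)
qed

text \<open>\<open>P\<close> will be the product of the input transforms at \<open>\<xi>\<close>.
  Where the bump at \<open>\<nu>\<close> lives, it turns the coefficient \<open>c \<nu>\<close> of
  the symbol into the coefficient \<open>d \<nu>\<close> of the output, and it annihilates the bumps
  outside \<open>\<Theta>\<close>; thus an infinite symbol yields a finite sum.\<close>

lemma lattice_sum_eq:
  assumes H: "small_supp H" and \<Theta>: "finite \<Theta>" "\<And>\<nu>. \<nu> \<in> \<Theta> \<Longrightarrow> integer_vec \<nu>"
    and c: "\<And>\<nu>. integer_vec \<nu> \<Longrightarrow> H (\<xi> - \<nu>) \<noteq> 0 \<Longrightarrow> c \<nu> * P = (if \<nu> \<in> \<Theta> then d \<nu> else 0)"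
  shows "lattice_sum c H \<xi> * P = (\<Sum>\<nu>\<in>\<Theta>. d \<nu> * H (\<xi> - \<nu>))"
proof -
  have z: "H (\<xi> - \<nu>) = 0" if "\<nu> \<in> \<Theta>" "\<nu> \<noteq> round_vec \<xi>" for \<nu>
    using round_vec_of_small_supp[OF H \<Theta>(2)[OF that(1)]] that(2) by blast
  have l: "lattice_sum c H \<xi> * P = (c (round_vec \<xi>) * P) * H (\<xi> - round_vec \<xi>)" by (simp add: lattice_sum_def)
  show ?thesis
  proof (cases "round_vec \<xi> \<in> \<Theta>")
    case True
    have "(\<Sum>\<nu>\<in>\<Theta>. d \<nu> * H (\<xi> - \<nu>)) = (\<Sum>\<nu>\<in>{round_vec \<xi>}. d \<nu> * H (\<xi> - \<nu>))"
      using True z \<Theta>(1) by (intro sum.mono_neutral_right) auto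
    then show ?thesis unfolding l using c[OF integer_vec_round_vec] True by (cases "H (\<xi> - round_vec \<xi>) = 0") auto
  next
    case False
    then have "(\<Sum>\<nu>\<in>\<Theta>. d \<nu> * H (\<xi> - \<nu>)) = 0" using z by (intro sum.neutral) auto
    then show ?thesis unfolding l using c[OF integer_vec_round_vec] False by (cases "H (\<xi> - round_vec \<xi>) = 0") auto
  qed
qed

lemma iter_partial_cmult:
  assumes f: "smooth_all f" shows "iter_partial vs (\<lambda>x. c * f x) = (\<lambda>x. c * iter_partial vs f x)"
proof (induction vs)
  case (Cons v vs)
  have "((\<lambda>x. c * iter_partial vs f x) has_derivative (\<lambda>w. c * dpart w (iter_partial vs f) x)) (at x)" for x
    using has_derivative_mult_right[OF smooth_all_has_derivative[OF smooth_all_iter_partial[OF f]]] .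
  from dpart_eqI[OF this] show ?case by (simp add: Cons)
qed simp

lemma powr_comparable:
  assumes "0 < x" "0 < y" "x \<le> R * y" "y \<le> R * x" "1 \<le> R"
  shows "x powr m \<le> R powr \<bar>m\<bar> * (y powr m :: real)"
proof (cases "0 \<le> m")
  case True
  have "x powr m \<le> (R * y) powr m" using assms True by (intro powr_mono2) auto
  also have "\<dots> = R powr m * y powr m" using assms by (simp add: powr_mult)
  finally show ?thesis using True by simp
next
  case False
  have "y / R \<le> x" using assms by (simp add: pos_divide_le_eq mult.commute)
  then have "x powr m \<le> (y / R) powr m" using assms False by (intro powr_mono2') auto
  also have "\<dots> = y powr m / R powr m" using assms by (simp add: powr_divide)
  also have "\<dots> = R powr (- m) * y powr m" by (simp add: powr_minus_divide)
  finally show ?thesis using False by simp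
qed

text \<open>In this class derivatives gain no decay, so bumps of fixed size are admissible at every
  frequency. Near each point all derivatives fall on one translate of \<open>H\<close>, and on its
  support the weights at \<open>\<xi>\<close> and at the lattice point are comparable. Only the size
  of \<open>c\<close> enters, never a relation between different coefficients.\<close>

lemma lattice_sum_symbol:
  fixes H :: "(real^'n::finite)^'N::finite \<Rightarrow> complex"
  assumes H: "cc_smooth H" "small_supp H"
    and c: "\<And>\<nu>. integer_vec \<nu> \<Longrightarrow> norm (c \<nu>) \<le> C * (1 + (\<Sum>j\<in>UNIV. norm (\<nu> $ j))) powr m"
  shows "(\<lambda>(x, \<xi>). lattice_sum c H \<xi>) \<in> symbol_class m"
proof -
  let ?S = "lattice_sum c H"
  let ?w = "\<lambda>\<xi>::(real^'n)^'N. 1 + (\<Sum>j\<in>UNIV. norm (\<xi> $ j))"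
  have smH: "smooth_all H" using H(1) unfolding cc_smooth_def by blast
  have sh: "smooth_all (\<lambda>\<xi>. H (- \<nu> + \<xi>))" for \<nu>
    using smooth_all_affine[OF linear_id smH, of "- \<nu>"] by (simp add: id_def)
  have loc: "open (ball \<xi>0 (1/8))" "\<xi>0 \<in> ball \<xi>0 (1/8)" for \<xi>0 :: "(real^'n)^'N" by auto
  have smS: "smooth_all ?S"
  proof (rule smooth_all_local)
    fix \<xi>0
    show "\<exists>U g. open U \<and> \<xi>0 \<in> U \<and> smooth_all g \<and> (\<forall>\<xi>\<in>U. ?S \<xi> = g \<xi>)"
      using loc[of \<xi>0] lattice_sum_local[OF H(2), of _ \<xi>0 c] smooth_all_mult[OF smooth_all_const sh]
      by (intro exI[of _ "ball \<xi>0 (1/8)"] exI[of _ "\<lambda>\<xi>. c (round_vec \<xi>0) * H (- round_vec \<xi>0 + \<xi>)"]) auto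
  qed
  have it: "iter_partial vs ?S \<xi>0 = c (round_vec \<xi>0) * iter_partial vs H (- round_vec \<xi>0 + \<xi>0)" for vs \<xi>0
  proof -
    have "iter_partial vs ?S \<xi>0 = iter_partial vs (\<lambda>\<xi>. c (round_vec \<xi>0) * H (- round_vec \<xi>0 + \<xi>)) \<xi>0"
      by (rule iter_partial_cong_open[OF loc(1) lattice_sum_local[OF H(2)] loc(2)])
    also have "\<dots> = c (round_vec \<xi>0) * iter_partial vs (\<lambda>\<xi>. H (- round_vec \<xi>0 + id \<xi>)) \<xi>0"
      unfolding iter_partial_cmult[OF sh] by simp
    also have "iter_partial vs (\<lambda>\<xi>. H (- round_vec \<xi>0 + id \<xi>)) \<xi>0 = iter_partial vs H (- round_vec \<xi>0 + \<xi>0)"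
      unfolding iter_partial_affine[OF linear_id smH] by simp
    finally show ?thesis .
  qed
  \<comment> \<open>Where a derivative of \<open>H\<close> is seen, rounding moves each of the
    \<open>N\<close> components by at most \<open>n\<close>, so the two weights differ by at most
    this factor.\<close>
  define R where "R = 1 + real CARD('N) * real CARD('n)"
  have R: "1 \<le> R" unfolding R_def by simp
  have Cn: "0 \<le> C"
  proof -
    have "norm (c 0) \<le> C * 1 powr m" using c[of 0] by (simp add: integer_vec_def)
    then show ?thesis using norm_ge_zero[of "c 0"] by (simp only: powr_one_eq_one mult_1_right)
  qed
  have bnd: "\<exists>B. \<forall>\<xi>. norm (iter_partial vs ?S \<xi>) \<le> B * ?w \<xi> powr m" for vs
  proof -
    obtain M where M: "\<And>\<xi>. norm (iter_partial vs H \<xi>) \<le> M"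
      using cc_smooth_bounded[OF cc_smooth_iter_partial[OF H(1)]] by blast
    have Mn: "0 \<le> M" using order_trans[OF norm_ge_zero M] .
    have "norm (iter_partial vs ?S \<xi>) \<le> (C * R powr \<bar>m\<bar> * M) * ?w \<xi> powr m" for \<xi>
    proof (cases "iter_partial vs H (- round_vec \<xi> + \<xi>) = 0")
      case True then show ?thesis unfolding it using Cn Mn by simp
    next
      case False
      let ?K = "{\<xi>::(real^'n)^'N. \<forall>j i. \<bar>\<xi> $ j $ i\<bar> \<le> 1 / 8}"
      \<comment> \<open>Because the cube is closed, derivatives of \<open>H\<close> vanish outside
        it along with \<open>H\<close>.\<close>
      have cl: "closed ?K"
        by (intro closed_Collect_all closed_Collect_le continuous_intros)
      have "- round_vec \<xi> + \<xi> \<in> ?K"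
      proof (rule ccontr)
        assume "- round_vec \<xi> + \<xi> \<notin> ?K"
        then show False using iter_partial_vanishes[OF cl, of H "- round_vec \<xi> + \<xi>" vs] H(2) False
          unfolding small_supp_def by blast
      qed
      then have d: "\<bar>\<xi> $ j $ i - round_vec \<xi> $ j $ i\<bar> \<le> 1 / 8" for j i by (simp add: add.commute)
      have dj: "norm (\<xi> $ j - round_vec \<xi> $ j) \<le> real CARD('n)" for j
      proof -
        have "norm (\<xi> $ j - round_vec \<xi> $ j) \<le> (\<Sum>i\<in>UNIV. \<bar>(\<xi> $ j - round_vec \<xi> $ j) $ i\<bar>)" by (rule norm_le_l1_cart)
        also have "\<dots> \<le> (\<Sum>i\<in>(UNIV::'n set). 1)"
        proof (rule sum_mono)
          show "\<bar>(\<xi> $ j - round_vec \<xi> $ j) $ i\<bar> \<le> 1" for i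
            unfolding vector_minus_component using d[of j i] by linarith
        qed
        finally show ?thesis by simp
      qed
      have s1: "(\<Sum>j\<in>UNIV. norm (\<xi> $ j)) \<le> (\<Sum>j\<in>UNIV. norm (round_vec \<xi> $ j) + real CARD('n))"
      proof (rule sum_mono)
        show "norm (\<xi> $ j) \<le> norm (round_vec \<xi> $ j) + real CARD('n)" for j
          using norm_triangle_sub[of "\<xi> $ j" "round_vec \<xi> $ j"] dj[of j] by linarith
      qed
      have s2: "(\<Sum>j\<in>UNIV. norm (round_vec \<xi> $ j)) \<le> (\<Sum>j\<in>UNIV. norm (\<xi> $ j) + real CARD('n))"
      proof (rule sum_mono)
        show "norm (round_vec \<xi> $ j) \<le> norm (\<xi> $ j) + real CARD('n)" for j
          using norm_triangle_sub[of "round_vec \<xi> $ j" "\<xi> $ j"] dj[of j] norm_minus_commute[of "\<xi> $ j" "round_vec \<xi> $ j"] by linarith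
      qed
      have w: "?w \<xi> \<le> R * ?w (round_vec \<xi>)" "?w (round_vec \<xi>) \<le> R * ?w \<xi>"
      proof -
        have *: "1 + a \<le> R * (1 + b)" if "a \<le> b + real CARD('N) * real CARD('n)" "0 \<le> b" for a b
        proof -
          have "R * (1 + b) = 1 + b + real CARD('N) * real CARD('n) + real CARD('N) * real CARD('n) * b"
            by (simp add: R_def algebra_simps)
          moreover have "0 \<le> real CARD('N) * real CARD('n) * b" using that by simp
          ultimately show ?thesis using that by linarith
        qed
        show "?w \<xi> \<le> R * ?w (round_vec \<xi>)" "?w (round_vec \<xi>) \<le> R * ?w \<xi>"
          using s1 s2 by (intro *; simp add: sum.distrib sum_nonneg)+
      qed
      have pos: "0 < ?w \<xi>" for \<xi> by (intro add_pos_nonneg sum_nonneg) auto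
      have "norm (c (round_vec \<xi>)) \<le> C * ?w (round_vec \<xi>) powr m" by (rule c[OF integer_vec_round_vec])
      also have "\<dots> \<le> C * (R powr \<bar>m\<bar> * ?w \<xi> powr m)"
        by (intro mult_left_mono powr_comparable pos w R Cn)
      finally have "norm (c (round_vec \<xi>)) * norm (iter_partial vs H (- round_vec \<xi> + \<xi>)) \<le> C * (R powr \<bar>m\<bar> * ?w \<xi> powr m) * M"
        by (intro mult_mono M) (auto intro!: mult_nonneg_nonneg Cn)
      then show ?thesis unfolding it norm_mult by (simp add: mult_ac)
    qed
    then show ?thesis by blast
  qed
  have eq: "(\<lambda>(x, \<xi>). ?S \<xi>) = (\<lambda>p. ?S (0 + snd p))" by (auto simp: fun_eq_iff)
  show ?thesis
    unfolding symbol_class_def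
  proof (intro CollectI conjI allI)
    show "smooth (\<lambda>(x::real^'n, \<xi>). ?S \<xi>)"
      unfolding eq by (intro smooth_all_smooth smooth_all_affine bounded_linear.linear[OF bounded_linear_snd] smS)
    fix \<alpha> :: "(real^'n) \<times> ((real^'n)^'N) \<Rightarrow> nat"
    show "\<exists>B. \<forall>x \<xi>. norm (multi_partial \<alpha> (\<lambda>(x, \<xi>). ?S \<xi>) (x, \<xi>)) \<le> B * ?w \<xi> powr m"
      unfolding eq multi_partial_def iter_partial_affine[OF bounded_linear.linear[OF bounded_linear_snd] smS]
      using bnd by simp
  qed
qed

section \<open>Outputs of lattice symbols as plane-wave sums\<close>

lemma linear_sum_components: "linear (\<lambda>\<xi>::(real^'n::finite)^'N::finite. \<Sum>j\<in>UNIV. \<xi> $ j)"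
  by (intro linearI) (auto simp: sum.distrib scaleR_sum_right)

lemma pseudo_diff_wave:
  "pseudo_diff (\<lambda>(x, \<xi>). S \<xi>) f = wave (\<lambda>\<xi>. \<Sum>j\<in>UNIV. \<xi> $ j)
     (\<lambda>\<xi>::(real^'n::finite)^'N::finite. complex_of_real (1 / (2 * pi) ^ (CARD('N) * CARD('n))) * (S \<xi> * (\<Prod>j\<in>UNIV. fourier (f j) (\<xi> $ j))))"
  unfolding pseudo_diff_def wave_def
  by (rule ext, subst integral_mult_right_zero[symmetric]) (simp add: mult_ac)

lemma wave_translate:
  fixes A :: "'b::euclidean_space \<Rightarrow> 'a::euclidean_space"
  assumes A: "linear A" and H: "integrable lborel H"
  shows "wave A (\<lambda>\<xi>. H (\<xi> - \<nu>)) x = cis (x \<bullet> A \<nu>) * wave A H x"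
proof -
  have i: "integrable lborel (\<lambda>\<xi>. H (\<xi> - \<nu>))" using integrable_lborel_affine[OF H, of 1 "- \<nu>"] by (simp add: add.commute)
  have "wave A (\<lambda>\<xi>. H (\<xi> - \<nu>)) x = (LINT \<xi>|lborel. cis (x \<bullet> A (\<nu> + \<xi>)) * H \<xi>)"
    using integral_lborel_affine[OF _ wave_integrable[OF A i, of x], of 1 \<nu>] unfolding wave_def by simp
  also have "\<dots> = (LINT \<xi>|lborel. cis (x \<bullet> A \<nu>) * (cis (x \<bullet> A \<xi>) * H \<xi>))"
    by (simp add: linear_add[OF A] inner_add_right cis_mult[symmetric] mult.assoc)
  finally show ?thesis unfolding wave_def by simp
qed

lemma wave_sum:
  fixes A :: "'b::euclidean_space \<Rightarrow> 'a::euclidean_space"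
  assumes A: "linear A" and F: "finite F" and H: "\<And>l. l \<in> F \<Longrightarrow> integrable lborel (H l)"
  shows "wave A (\<lambda>\<xi>. \<Sum>l\<in>F. H l \<xi>) x = (\<Sum>l\<in>F. wave A (H l) x)"
  unfolding wave_def sum_distrib_left
  by (rule Bochner_Integration.integral_sum) (rule wave_integrable[OF A H])

lemma wave_cmult: "wave A (\<lambda>\<xi>. c * H \<xi>) x = c * wave A H x"
  unfolding wave_def by (subst integral_mult_right_zero[symmetric]) (simp add: mult.left_commute)

text \<open>Translates of \<open>H\<close> give the same profile up to a phase, so the wave factors
  into that profile and an exponential sum. The phases see only \<open>A \<nu>\<close>, so the
  coefficients of vectors with the same image are added.\<close>

lemma wave_lattice_sum:
  fixes A :: "'b::euclidean_space \<Rightarrow> 'a::euclidean_space"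
  assumes A: "linear A" and H: "integrable lborel H" and \<Theta>: "finite \<Theta>"
  shows "wave A (\<lambda>\<xi>. \<Sum>\<nu>\<in>\<Theta>. d \<nu> * H (\<xi> - \<nu>)) x = wave A H x * (\<Sum>\<nu>\<in>\<Theta>. d \<nu> * cis (x \<bullet> A \<nu>))"
proof -
  have i: "integrable lborel (\<lambda>\<xi>. H (\<xi> - \<nu>))" for \<nu> using integrable_lborel_affine[OF H, of 1 "- \<nu>"] by (simp add: add.commute)
  have "wave A (\<lambda>\<xi>. \<Sum>\<nu>\<in>\<Theta>. d \<nu> * H (\<xi> - \<nu>)) x = (\<Sum>\<nu>\<in>\<Theta>. d \<nu> * (cis (x \<bullet> A \<nu>) * wave A H x))"
    by (subst wave_sum[OF A \<Theta>]) (auto simp: wave_cmult wave_translate[OF A H] intro!: integrable_mult_right i)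
  then show ?thesis by (simp add: sum_distrib_left mult_ac)
qed

text \<open>Nothing is known about a single piece \<open>\<psi> l\<close>, but the pieces in \<open>F\<close> add up to the whole function, so one of
  them is large on a large part of \<open>E\<close>.\<close>

lemma besov_norm_lower:
  fixes \<psi> :: "nat \<Rightarrow> real^'n::finite \<Rightarrow> complex" and A :: "'b::euclidean_space \<Rightarrow> real^'n"
  assumes \<psi>: "littlewood_paley \<psi>" and p: "0 < p" and q: "0 < q" and A: "linear A" and H: "integrable lborel H"
    and F: "finite F" "F \<noteq> {}" and one: "\<And>\<xi>. H \<xi> \<noteq> 0 \<Longrightarrow> (\<Sum>l\<in>F. \<psi> l (A \<xi>)) = 1"
    and E: "E \<in> sets borel" and v: "0 \<le> v" "\<And>x. x \<in> E \<Longrightarrow> v \<le> norm (wave A H x)"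
    and \<mu>: "0 < \<mu>" "ennreal \<mu> \<le> emeasure lborel E"
  shows "\<exists>l\<in>F. ennreal (2 powr (real l * s) * (v / real (card F) * (\<mu> / real (card F)) powr (1 / enn2real p))) \<le> besov_norm \<psi> s p q (dist_of (wave A H))"
proof -
  let ?u = "dist_of (wave A H)"
  define g where "g l = wave A (\<lambda>\<xi>. \<psi> l (A \<xi>) * H \<xi>)" for l
  have cF: "0 < real (card F)" using F by (simp add: card_gt_0_iff)
  have rep: "represents (g l) (fourier_multiplier (\<psi> l) ?u)" for l
    unfolding g_def by (rule fourier_multiplier_wave[OF A H lp_cc_smooth[OF \<psi>]])
  then have meas[measurable]: "g l \<in> borel_measurable borel" for l unfolding represents_def by simp
  have i: "integrable lborel (\<lambda>\<xi>. \<psi> l (A \<xi>) * H \<xi>)" for l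
  proof -
    obtain M where M: "\<And>x. norm (\<psi> l x) \<le> M" using cc_smooth_bounded[OF lp_cc_smooth[OF \<psi>]] by blast
    have sm: "smooth_all (\<psi> l)" by (rule schwartz_smooth_all[OF lp_schwartz[OF \<psi>]])
    have "continuous_on UNIV (\<lambda>\<xi>. \<psi> l (A \<xi>))"
      by (intro continuous_on_compose2[OF smooth_all_continuous[OF sm, of UNIV]] linear_continuous_on_compose[OF continuous_on_id A]) auto
    then show ?thesis by (intro integrable_bounded_mult[OF H _ M]) (rule borel_measurable_continuous_onI)
  qed
  have sum: "wave A H x = (\<Sum>l\<in>F. g l x)" for x
  proof -
    have "H = (\<lambda>\<xi>. \<Sum>l\<in>F. \<psi> l (A \<xi>) * H \<xi>)"
    proof
      show "H \<xi> = (\<Sum>l\<in>F. \<psi> l (A \<xi>) * H \<xi>)" for \<xi>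
        using one[of \<xi>] by (cases "H \<xi> = 0") (auto simp: sum_distrib_right[symmetric])
    qed
    then have "wave A H x = wave A (\<lambda>\<xi>. \<Sum>l\<in>F. \<psi> l (A \<xi>) * H \<xi>) x" by (rule arg_cong)
    also have "\<dots> = (\<Sum>l\<in>F. g l x)" unfolding g_def by (rule wave_sum[OF A F(1) i])
    finally show ?thesis .
  qed
  \<comment> \<open>Where the whole wave has modulus at least \<open>v\<close>, the
    \<open>card F\<close> pieces cannot all be below \<open>v / card F\<close>.\<close>
  define S where "S l = {x \<in> E. v / real (card F) \<le> norm (g l x)}" for l
  have S: "S l \<in> sets borel" for l unfolding S_def using E by measurable
  have cover: "E \<subseteq> (\<Union>l\<in>F. S l)"
  proof
    fix x assume x: "x \<in> E"
    show "x \<in> (\<Union>l\<in>F. S l)"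
    proof (rule ccontr)
      assume "x \<notin> (\<Union>l\<in>F. S l)"
      then have "norm (g l x) < v / real (card F)" if "l \<in> F" for l using x that unfolding S_def by force
      then have "(\<Sum>l\<in>F. norm (g l x)) < (\<Sum>l\<in>F. v / real (card F))" using F by (intro sum_strict_mono) auto
      also have "\<dots> = v" using cF by simp
      finally have "norm (wave A H x) < v" unfolding sum using norm_sum[of "\<lambda>l. g l x" F] by linarith
      then show False using v(2)[OF x] by simp
    qed
  qed
  obtain l where l: "l \<in> F" "ennreal (\<mu> / real (card F)) \<le> emeasure lborel (S l)"
    using pigeonhole_measure[OF F S cover \<mu>(2)] by (elim bexE) (rule that)
  have "ennreal (v / real (card F) * (\<mu> / real (card F)) powr (1 / enn2real p)) \<le> Lp_norm p (g l)"
    using v(1) \<mu>(1) cF by (intro Lp_norm_lower[OF p meas S _ _ _ l(2)]) (auto simp: S_def)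
  also have "\<dots> \<le> dist_Lp_norm p (fourier_multiplier (\<psi> l) ?u)"
    by (rule dist_Lp_norm_lower[OF rep lp_cc_smooth[OF \<psi>] lp_one[OF \<psi>]])
  finally have "ennreal (2 powr (real l * s)) * ennreal (v / real (card F) * (\<mu> / real (card F)) powr (1 / enn2real p))
      \<le> ennreal (2 powr (real l * s)) * dist_Lp_norm p (fourier_multiplier (\<psi> l) ?u)"
    by (rule mult_left_mono) simp
  also have "\<dots> \<le> besov_norm \<psi> s p q ?u"
    unfolding besov_norm_def by (rule lq_norm_ge[OF q, where a="\<lambda>l. ennreal (2 powr (real l * s)) * dist_Lp_norm p (fourier_multiplier (\<psi> l) ?u)"])
  finally show ?thesis using l(1) by (intro bexI[of _ l]) (simp only: ennreal_mult'[OF powr_ge_zero])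
qed

text \<open>\<open>\<psi> 0\<close> may take complex values, so each factor is multiplied by its
  conjugate to make \<open>H\<close> nonnegative. Dilation by \<open>32 * N\<close> keeps the sum of
  the components so small that, for \<open>norm x \<le> 1\<close>, every phase is at most 1/2 and
  its cosine at least 1/2. The wave is then bounded below by half the measure of a ball on which
  \<open>H\<close> is 1.\<close>

lemma bump_exists:
  fixes \<psi> :: "nat \<Rightarrow> real^'n::finite \<Rightarrow> complex"
  assumes \<psi>: "littlewood_paley \<psi>"
  shows "\<exists>H :: (real^'n)^'N::finite \<Rightarrow> complex. \<exists>g>0. cc_smooth H \<and> small_supp H \<and>
    (\<forall>\<xi> j. H \<xi> \<noteq> 0 \<longrightarrow> norm (\<xi> $ j) < 1 / 8) \<and> (\<forall>\<xi>. H \<xi> \<noteq> 0 \<longrightarrow> norm (\<Sum>j\<in>UNIV. \<xi> $ j) \<le> 1 / 2) \<and>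
    (\<forall>x::real^'n. norm x \<le> 1 \<longrightarrow> g \<le> norm (wave (\<lambda>\<xi>. \<Sum>j\<in>UNIV. \<xi> $ j) H x))"
proof -
  let ?N = "real CARD('N)"
  let ?A = "\<lambda>\<xi>::(real^'n)^'N. \<Sum>j\<in>UNIV. \<xi> $ j"
  define R where "R = 32 * ?N"
  have N1: "1 \<le> ?N" using zero_less_card_finite[where 'a='N] by linarith
  have R: "32 \<le> R" "0 < R" using N1 by (auto simp: R_def)
  define \<theta> where "\<theta> z = \<psi> 0 (R *\<^sub>R z) * cnj (\<psi> 0 (R *\<^sub>R z))" for z
  define H where "H \<xi> = (\<Prod>j\<in>UNIV. \<theta> (\<xi> $ j))" for \<xi> :: "(real^'n)^'N"
  have sm: "smooth_all (\<psi> 0)" by (rule schwartz_smooth_all[OF lp_schwartz[OF \<psi>]])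
  have lin: "linear (\<lambda>\<xi>::(real^'n)^'N. R *\<^sub>R \<xi> $ j)" for j
    by (intro linearI) (auto simp: scaleR_add_right)
  have "smooth_all (\<lambda>\<xi>::(real^'n)^'N. \<psi> 0 (0 + R *\<^sub>R \<xi> $ j))" for j
    by (rule smooth_all_affine[OF lin sm])
  then have smj: "smooth_all (\<lambda>\<xi>::(real^'n)^'N. \<psi> 0 (R *\<^sub>R \<xi> $ j))" for j by simp
  have smH: "smooth_all H" unfolding H_def[abs_def] \<theta>_def
    by (intro smooth_all_prod smooth_all_mult smooth_all_cnj smj) simp
  have \<theta>0: "norm z \<le> 2 / R" if "\<theta> z \<noteq> 0" for z
  proof -
    have "\<psi> 0 (R *\<^sub>R z) \<noteq> 0" using that by (simp add: \<theta>_def)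
    then have "norm (R *\<^sub>R z) \<le> 2" by (rule lp_supp_0[OF \<psi>])
    then show ?thesis using R by (simp add: pos_le_divide_eq mult.commute)
  qed
  have supp: "norm (\<xi> $ j) \<le> 2 / R" if "H \<xi> \<noteq> 0" for \<xi> j
    using that \<theta>0[of "\<xi> $ j"] unfolding H_def by auto
  have R2: "2 / R < 1 / 8" using R by (simp add: divide_simps)
  have supp': "norm (?A \<xi>) \<le> 1 / 2" if "H \<xi> \<noteq> 0" for \<xi>
  proof -
    have "norm (?A \<xi>) \<le> (\<Sum>j\<in>(UNIV::'N set). 2 / R)" by (intro sum_norm_le supp that)
    also have "\<dots> \<le> 1 / 2" using N1 by (simp add: R_def)
    finally show ?thesis .
  qed
  have small: "small_supp H"
    unfolding small_supp_def
  proof (intro allI impI)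
    fix \<xi> j i assume "H \<xi> \<noteq> 0"
    then show "\<bar>\<xi> $ j $ i\<bar> \<le> 1 / 8"
      using supp[of \<xi> j] R2 component_le_norm_cart[of "\<xi> $ j" i] by linarith
  qed
  have cc: "cc_smooth H"
    unfolding cc_smooth_def
  proof (intro conjI smH exI[of _ ?N] allI impI)
    fix \<xi> :: "(real^'n)^'N" assume *: "?N < norm \<xi>"
    show "H \<xi> = 0"
    proof (rule ccontr)
      assume "H \<xi> \<noteq> 0"
      have "norm \<xi> \<le> (\<Sum>j\<in>UNIV. norm (\<xi> $ j))" unfolding norm_vec_def by (rule L2_set_le_sum) simp
      also have "\<dots> \<le> (\<Sum>j\<in>(UNIV::'N set). 1)"
        using supp[OF \<open>H \<xi> \<noteq> 0\<close>] R2 by (intro sum_mono) (smt (verit) divide_le_eq_1)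
      finally show False using * by simp
    qed
  qed
  have iH: "integrable lborel H" by (rule rapid_integrable[OF cc_smooth_rapid[OF cc]])
  have Hpos: "H \<xi> = complex_of_real (Re (H \<xi>))" "0 \<le> Re (H \<xi>)" for \<xi>
  proof -
    define r where "r = (\<Prod>j\<in>UNIV. (norm (\<psi> 0 (R *\<^sub>R \<xi> $ j)))\<^sup>2)"
    have "H \<xi> = complex_of_real r"
      by (simp only: r_def H_def \<theta>_def of_real_prod complex_norm_square)
    moreover have "0 \<le> r" unfolding r_def by (intro prod_nonneg) simp
    ultimately show "H \<xi> = complex_of_real (Re (H \<xi>))" "0 \<le> Re (H \<xi>)" by simp_all
  qed
  have iR: "integrable lborel (\<lambda>\<xi>. Re (H \<xi>))" using iH by simp
  define B where "B = ball (0::(real^'n)^'N) (1 / R)"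
  have HB: "Re (H \<xi>) = 1" if "\<xi> \<in> B" for \<xi>
  proof -
    have "\<theta> (\<xi> $ j) = 1" for j
    proof -
      have "norm (\<xi> $ j) < 1 / R" using that Finite_Cartesian_Product.norm_nth_le[of \<xi> j] unfolding B_def by simp
      then have "norm (R *\<^sub>R \<xi> $ j) < 1" using R by (simp add: pos_less_divide_eq mult.commute)
      then show ?thesis unfolding \<theta>_def by (simp add: lp_one[OF \<psi>])
    qed
    then show ?thesis by (simp add: H_def)
  qed
  define g where "g = measure lborel B / 2"
  have g: "0 < g"
    unfolding g_def B_def using R content_ball_pos[of "1 / R" "0::(real^'n)^'N"] by (simp add: measure_def)
  have low: "g \<le> norm (wave ?A H x)" if x: "norm x \<le> 1" for x
  proof -
    have iw: "integrable lborel (\<lambda>\<xi>. cis (x \<bullet> ?A \<xi>) * H \<xi>)" by (rule wave_integrable[OF linear_sum_components iH])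
    have "g = (LINT \<xi>|lborel. 1 / 2 * indicator B \<xi>)" by (simp add: g_def)
    also have "\<dots> \<le> (LINT \<xi>|lborel. 1 / 2 * Re (H \<xi>))"
    proof (rule integral_mono')
      show "1 / 2 * indicator B \<xi> \<le> 1 / 2 * Re (H \<xi>)" for \<xi>
        using HB[of \<xi>] Hpos(2)[of \<xi>] by (auto simp: indicator_def)
    qed (use iR Hpos(2) in auto)
    also have "\<dots> \<le> (LINT \<xi>|lborel. Re (cis (x \<bullet> ?A \<xi>) * H \<xi>))"
    proof (rule integral_mono)
      fix \<xi>
      show "1 / 2 * Re (H \<xi>) \<le> Re (cis (x \<bullet> ?A \<xi>) * H \<xi>)"
      proof (cases "H \<xi> = 0")
        case False
        have "\<bar>x \<bullet> ?A \<xi>\<bar> \<le> norm x * norm (?A \<xi>)" by (rule Cauchy_Schwarz_ineq2)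
        also have "\<dots> \<le> 1 * (1 / 2)" using x supp'[OF False] by (intro mult_mono) auto
        finally have b: "\<bar>x \<bullet> ?A \<xi>\<bar> \<le> 1 / 2" by simp
        have "(1::real) / 2 \<le> pi / 3" using pi_ge_two by simp
        then have "cos (pi / 3) \<le> cos \<bar>x \<bullet> ?A \<xi>\<bar>" using b by (intro cos_monotone_0_pi_le) auto
        then have "1 / 2 \<le> cos (x \<bullet> ?A \<xi>)" by (simp add: cos_60)
        then have "1 / 2 * Re (H \<xi>) \<le> cos (x \<bullet> ?A \<xi>) * Re (H \<xi>)" using Hpos(2) by (rule mult_right_mono)
        also have "\<dots> = Re (cis (x \<bullet> ?A \<xi>) * H \<xi>)" by (subst (2) Hpos(1)) simp
        finally show ?thesis .
      qed simp
    qed (intro integrable_mult_right iR integrable_Re iw)+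
    also have "\<dots> = Re (wave ?A H x)" unfolding wave_def by (rule integral_Re[OF iw])
    also have "\<dots> \<le> norm (wave ?A H x)" by (rule complex_Re_le_cmod)
    finally show ?thesis .
  qed
  show ?thesis
  proof (intro exI[of _ H] exI[of _ g] conjI g cc small allI impI)
    show "norm (\<xi> $ j) < 1 / 8" if "H \<xi> \<noteq> 0" for \<xi> j using supp[OF that, of j] R2 by linarith
  qed (use supp' low in auto)
qed

section \<open>The frequency configuration\<close>

text \<open>The input of a frozen slot. Pieces with index above 2 do not meet the support of
  \<open>\<psi> 0\<close>.\<close>

lemma besov_norm_low_frequency:
  fixes \<psi> :: "nat \<Rightarrow> real^'n::finite \<Rightarrow> complex"
  assumes \<psi>: "littlewood_paley \<psi>" and p: "0 < p" and q: "0 < q"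
  shows "\<exists>C>0. besov_norm \<psi> s p q (dist_of (inv_fourier (\<psi> 0))) \<le> ennreal C"
proof -
  obtain K where K: "p = \<infinity> \<or> 2 * real CARD('n) \<le> real K * enn2real p" using exponent_weight_exists[OF p] by blast
  let ?d = "dim_over TYPE('n) p"
  obtain C1 where C1: "0 \<le> C1" and up0: "\<forall>h F A \<rho> S. cc_smooth h \<longrightarrow> finite F \<longrightarrow> (\<forall>l. l \<notin> F \<longrightarrow> (\<forall>\<xi>. \<psi> l \<xi> * h \<xi> = 0)) \<longrightarrow> 0 \<le> A \<longrightarrow> 0 < \<rho> \<longrightarrow>
     (\<forall>y. norm (inv_fourier h y) \<le> A / (1 + \<rho> * norm y) ^ K) \<longrightarrow> (\<forall>l\<in>F. \<rho> \<le> 2 * 2 ^ l) \<longrightarrow> 0 \<le> S \<longrightarrow> (\<forall>l\<in>F. 2 powr (real l * s) \<le> S) \<longrightarrow>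
     besov_norm \<psi> s p q (dist_of (inv_fourier h)) \<le> ennreal (real (card F) powr (1 / enn2real q) * (S * (C1 * A * \<rho> powr (- ?d))))"
    using besov_norm_upper[OF \<psi> p q K, of s] by (elim exE conjE) (rule that)
  note up = up0[rule_format]
  obtain C0 where C0: "0 \<le> C0" and C0': "\<forall>l x. norm (inv_fourier (\<psi> l) x) \<le> C0 * (2 ^ l) ^ CARD('n) / (1 + 2 ^ l * norm x) ^ K"
    using lp_kernel[OF \<psi>, of K] by (elim exE conjE) (rule that)
  let ?R = "real (card {..2::nat}) powr (1 / enn2real q) * (2 powr (2 * \<bar>s\<bar>) * (C1 * C0 * 1 powr (- ?d)))"
  have "besov_norm \<psi> s p q (dist_of (inv_fourier (\<psi> 0))) \<le> ennreal ?R"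
  proof (rule up[OF lp_cc_smooth[OF \<psi>]])
    show "\<psi> l \<xi> * \<psi> 0 \<xi> = 0" if "l \<notin> {..2}" for l \<xi>
    proof (rule ccontr)
      assume "\<psi> l \<xi> * \<psi> 0 \<xi> \<noteq> 0"
      then have ne: "\<psi> l \<xi> \<noteq> 0" "\<psi> 0 \<xi> \<noteq> 0" by auto
      have "(2::real) ^ 2 \<le> 2 ^ (l - 1)" using that by (intro power_increasing) auto
      also have "\<dots> \<le> norm \<xi>" using that by (intro lp_supp(1)[OF \<psi> ne(1)]) simp
      also have "\<dots> \<le> 2" by (rule lp_supp_0[OF \<psi> ne(2)])
      finally show False by simp
    qed
    show "norm (inv_fourier (\<psi> 0) y) \<le> C0 / (1 + 1 * norm y) ^ K" for y using C0'[rule_format, of 0 y] by simp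
    show "1 \<le> 2 * (2::real) ^ l" for l using one_le_power[of "2::real" l] by linarith
    show "2 powr (real l * s) \<le> 2 powr (2 * \<bar>s\<bar>)" if "l \<in> {..2}" for l
    proof -
      have "real l * s \<le> real l * \<bar>s\<bar>" by (intro mult_left_mono) auto
      also have "\<dots> \<le> 2 * \<bar>s\<bar>" using that by (intro mult_right_mono) auto
      finally show ?thesis by (intro powr_mono) auto
    qed
  qed (use C0 in auto)
  also have "\<dots> \<le> ennreal (?R + 1)" by (intro ennreal_leI) simp
  finally show ?thesis using C0 C1 by (intro exI[of _ "?R + 1"]) (auto intro!: add_nonneg_pos)
qed

text \<open>The direction \<open>undefined\<close> is an arbitrary coordinate direction.\<close>

definition center :: "nat \<Rightarrow> nat \<Rightarrow> real^'n::finite" where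
  "center B k = real (B * 2 ^ k) *\<^sub>R axis undefined 1"

lemma norm_center: "norm (center B k :: real^'n::finite) = real B * 2 ^ k"
  by (simp add: center_def)

text \<open>The slots in \<open>J\<close> carry free frequencies, the slot \<open>j1\<close> adjusts the total frequency, and a remaining slot
  carries frequency \<open>0\<close>. The total frequency is about \<open>2\<^sup>k\<close> for \<open>t = 1\<close> and small for \<open>t = 0\<close>.\<close>

definition node :: "nat \<Rightarrow> nat \<Rightarrow> 'N set \<Rightarrow> 'N \<Rightarrow> nat \<Rightarrow> ('n \<Rightarrow> nat) \<times> ('N \<Rightarrow> 'n \<Rightarrow> nat) \<Rightarrow> (real^'n::finite)^'N::finite" where
  "node B t J j1 k zu = (\<chi> j. if j \<in> J then center B k + lat (snd zu j)
     else if j = j1 then lat (fst zu) - real t *\<^sub>R center B k - (\<Sum>i\<in>J. center B k + lat (snd zu i)) else 0)"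

text \<open>The correction in slot \<open>j1\<close> removes the free frequencies from the total, so
  all nodes with the same \<open>fst zu\<close> contribute to the same exponential.\<close>

lemma node_sum:
  assumes "j1 \<notin> J"
  shows "(\<Sum>j\<in>UNIV. node B t J j1 k zu $ j) = lat (fst zu) - real t *\<^sub>R center B k"
proof -
  have "(\<Sum>j\<in>UNIV. node B t J j1 k zu $ j) = (\<Sum>j\<in>insert j1 J. node B t J j1 k zu $ j)"
    by (intro sum.mono_neutral_right) (auto simp: node_def)
  also have "\<dots> = node B t J j1 k zu $ j1 + (\<Sum>j\<in>J. node B t J j1 k zu $ j)" using assms by simp
  also have "(\<Sum>j\<in>J. node B t J j1 k zu $ j) = (\<Sum>i\<in>J. center B k + lat (snd zu i))"
    by (intro sum.cong) (auto simp: node_def)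
  finally show ?thesis using assms by (simp add: node_def)
qed

lemma lat_component_int: "lat m $ i \<in> \<int>"
  by (simp add: lat_def)

lemma center_component_int: "center B k $ i \<in> \<int>"
  by (simp add: center_def axis_def)

lemma integer_vec_node: "integer_vec (node B t J j1 k zu)"
  unfolding integer_vec_def node_def
  by (auto intro!: Ints_diff Ints_add Ints_sum Ints_mult lat_component_int center_component_int)

lemma lat_inj: "lat m = lat m' \<longleftrightarrow> m = m'"
  by (auto simp: lat_def vec_eq_iff fun_eq_iff)

text \<open>The slots in \<open>J\<close> return the free indices and the total frequency returns
  \<open>fst zu\<close>; membership in \<open>PiE\<close> fixes the values outside
  \<open>J\<close>.\<close>

lemma node_inj:
  fixes J :: "'N::finite set"
  assumes "j1 \<notin> J"
  shows "inj_on (node B t J j1 k :: ('n::finite \<Rightarrow> nat) \<times> _ \<Rightarrow> _) (M \<times> PiE J (\<lambda>_. G))"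
proof (rule inj_onI)
  fix a b assume ab: "a \<in> M \<times> PiE J (\<lambda>_. G)" "b \<in> M \<times> PiE J (\<lambda>_. G)" and e: "node B t J j1 k a = node B t J j1 k b"
  have "snd a j = snd b j" if "j \<in> J" for j
  proof -
    have "node B t J j1 k a $ j = node B t J j1 k b $ j" using e by simp
    then have "lat (snd a j) = (lat (snd b j) :: real^'n)" using that by (simp add: node_def)
    then show ?thesis by (simp add: lat_inj)
  qed
  then have "snd a = snd b" using ab by (intro PiE_ext[of _ J "\<lambda>_. G"]) auto
  moreover have "lat (fst a) = (lat (fst b) :: real^'n)"
    using node_sum[OF assms, of B t k a] node_sum[OF assms, of B t k b] e by simp
  ultimately show "a = b" by (simp add: lat_inj prod_eq_iff)
qed

text \<open>Corner of the cube containing the frequency in slot \<open>j1\<close>. As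
  \<open>card J + t = N - 1\<close>, the centers add up to \<open>N - 1\<close> copies with a minus
  sign; the further shift by \<open>N * 2 ^ k\<close> in every coordinate makes the offset
  nonnegative although the free indices are subtracted.\<close>

definition center1 :: "'N::finite itself \<Rightarrow> nat \<Rightarrow> nat \<Rightarrow> real^'n::finite" where
  "center1 _ B k = - (real (CARD('N) - 1) *\<^sub>R center B k) - (\<chi> i. real (CARD('N) * 2 ^ k))"

lemma node_dependent:
  fixes J :: "'N::finite set" and zu :: "('n::finite \<Rightarrow> nat) \<times> ('N \<Rightarrow> 'n \<Rightarrow> nat)"
  assumes j1: "j1 \<notin> J" and card: "card J + t + 1 = CARD('N)"
    and z: "fst zu \<in> grid k" and u: "snd zu \<in> PiE J (\<lambda>_. grid k)"
  shows "\<exists>m\<in>grid (k + CARD('N)). node B t J j1 k zu $ j1 = center1 TYPE('N) B k + lat m"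
proof -
  let ?N = "CARD('N)"
  define s where "s i = (\<Sum>j\<in>J. snd zu j i)" for i
  have s: "s i \<le> ?N * 2 ^ k" for i
  proof -
    have "s i \<le> (\<Sum>j\<in>J. 2 ^ k)" unfolding s_def using u by (intro sum_mono) (auto simp: PiE_def Pi_def grid_def less_imp_le)
    also have "\<dots> \<le> ?N * 2 ^ k" using card by simp
    finally show ?thesis .
  qed
  \<comment> \<open>\<open>s i \<le> N * 2 ^ k\<close> makes the natural subtraction exact, and
    \<open>N + 1 \<le> 2 ^ N\<close> bounds the result by \<open>2 ^ (k + N)\<close>.\<close>
  define m where "m i = ?N * 2 ^ k + fst zu i - s i" for i
  have "m i < 2 ^ (k + ?N)" for i
  proof -
    have "m i < ?N * 2 ^ k + 2 ^ k" using z unfolding m_def grid_def by (metis add_less_cancel_left diff_le_self le_less_trans mem_Collect_eq)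
    also have "\<dots> = Suc ?N * 2 ^ k" by simp
    also have "\<dots> \<le> 2 ^ ?N * 2 ^ k" by (rule mult_right_mono[OF Suc_leI[OF less_exp]]) simp
    finally show ?thesis by (simp add: power_add mult.commute)
  qed
  then have m: "m \<in> grid (k + ?N)" by (simp add: grid_def)
  have N1: "real (?N - 1) = real (card J) + real t" using card by linarith
  have "node B t J j1 k zu $ j1 = lat (fst zu) - (real (?N - 1) *\<^sub>R center B k) - (\<Sum>i\<in>J. lat (snd zu i))"
    using j1 unfolding N1 by (simp add: node_def sum.distrib sum_constant_scaleR algebra_simps del: sum_constant)
  also have "\<dots> = center1 TYPE('N) B k + lat m"
  proof -
    have "real (m i) = real (?N * 2 ^ k) + real (fst zu i) - (\<Sum>j\<in>J. real (snd zu j i))" for i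
      using s[of i] unfolding m_def by (simp add: s_def of_nat_diff)
    then show ?thesis by (simp add: center1_def lat_def vec_eq_iff)
  qed
  finally show ?thesis using m by blast
qed

text \<open>The number \<open>D\<close> of \<open>test_function_exists\<close> for
  \<open>a = N\<close>, the enlargement of the grid forced by the determined slot.\<close>

definition radius :: "'n::finite itself \<Rightarrow> 'N::finite itself \<Rightarrow> real" where
  "radius _ _ = 2 * (real CARD('n) + 1) * 2 ^ CARD('N)"

section \<open>Positions and separation of the frequency supports\<close>

lemma norm_shift_le: "norm ((\<chi> i. real (CARD('N::finite) * 2 ^ k)) :: real^'n::finite) \<le> real CARD('N) * real CARD('n) * 2 ^ k"
  using norm_le_l1_cart[of "(\<chi> i. real (CARD('N) * 2 ^ k)) :: real^'n"] by (simp add: mult_ac)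

lemma center1_near:
  "norm (center1 TYPE('N::finite) B k + real (CARD('N) - 1) *\<^sub>R center B k :: real^'n::finite) \<le> real CARD('N) * real CARD('n) * 2 ^ k"
proof -
  have "center1 TYPE('N) B k + real (CARD('N) - 1) *\<^sub>R center B k = - ((\<chi> i. real (CARD('N) * 2 ^ k)) :: real^'n)"
    by (simp add: center1_def)
  then show ?thesis using norm_shift_le[of k] by (simp only: norm_minus_cancel)
qed

text \<open>\<open>B\<close> dominates all radii, which keeps the balls away from the origin, and
  \<open>L\<close> is a number of octaves that reaches past their far side. Neither depends on
  \<open>k\<close>.\<close>

lemma annulus_ball:
  fixes W \<xi> :: "real^'n::finite"
  assumes B: "4 * (real CARD('N::finite) * real CARD('n) + radius TYPE('n) TYPE('N) + 1) \<le> real B"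
    and L: "real CARD('N) * real B + real CARD('N) * real CARD('n) + radius TYPE('n) TYPE('N) + 1 \<le> 2 ^ L"
    and W: "(real B - real CARD('N) * real CARD('n)) * 2 ^ k \<le> norm W"
      "norm W \<le> (real CARD('N) * real B + real CARD('N) * real CARD('n)) * 2 ^ k"
    and \<xi>: "norm (\<xi> - W) \<le> (radius TYPE('n) TYPE('N) + 1) * 2 ^ k"
  shows "2 ^ k \<le> norm \<xi> \<and> norm \<xi> \<le> 2 ^ (k + L)"
proof -
  let ?r = "radius TYPE('n) TYPE('N)"
  define a where "a = real CARD('N) * real CARD('n)"
  have r: "0 \<le> ?r" "0 \<le> a" by (auto simp: radius_def a_def)
  note B = B[folded a_def] and L = L[folded a_def] and W = W[folded a_def]
  have "1 * 2 ^ k \<le> ((real B - a) - (?r + 1)) * 2 ^ k" using B r by (intro mult_right_mono) auto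
  also have "\<dots> = (real B - a) * 2 ^ k - (?r + 1) * 2 ^ k" by (simp only: left_diff_distrib)
  also have "\<dots> \<le> norm W - norm (\<xi> - W)" using W \<xi> by linarith
  also have "\<dots> \<le> norm \<xi>" using norm_triangle_ineq4[of \<xi> "\<xi> - W"] by simp
  finally have 1: "2 ^ k \<le> norm \<xi>" by simp
  have "norm \<xi> \<le> norm W + norm (\<xi> - W)" using norm_triangle_ineq[of W "\<xi> - W"] by simp
  also have "\<dots> \<le> (real CARD('N) * real B + a) * 2 ^ k + (?r + 1) * 2 ^ k" using W \<xi> by linarith
  also have "\<dots> = (real CARD('N) * real B + a + ?r + 1) * 2 ^ k" by (simp only: distrib_right)
  also have "\<dots> \<le> 2 ^ L * 2 ^ k" using L by (intro mult_right_mono) auto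
  finally show ?thesis using 1 by (simp add: power_add mult.commute)
qed

lemma norm_center_bounds:
  assumes "1 \<le> real CARD('N::finite)"
  shows "(real B - real CARD('N) * real CARD('n)) * 2 ^ k \<le> norm (center B k :: real^'n::finite)"
    "norm (center B k :: real^'n) \<le> (real CARD('N) * real B + real CARD('N) * real CARD('n)) * 2 ^ k"
proof -
  show "(real B - real CARD('N) * real CARD('n)) * 2 ^ k \<le> norm (center B k :: real^'n)"
    unfolding norm_center by (intro mult_right_mono) auto
  have "1 * real B \<le> real CARD('N) * real B" using assms by (intro mult_right_mono) auto
  then show "norm (center B k :: real^'n) \<le> (real CARD('N) * real B + real CARD('N) * real CARD('n)) * 2 ^ k"
    unfolding norm_center by (intro mult_right_mono) (auto intro: add_increasing2)
qed

lemma norm_center1_bounds: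
  assumes N: "2 \<le> CARD('N::finite)"
  shows "(real B - real CARD('N) * real CARD('n)) * 2 ^ k \<le> norm (center1 TYPE('N) B k :: real^'n::finite)"
    "norm (center1 TYPE('N) B k :: real^'n) \<le> (real CARD('N) * real B + real CARD('N) * real CARD('n)) * 2 ^ k"
proof -
  let ?W = "center1 TYPE('N) B k :: real^'n"
  let ?V = "real (CARD('N) - 1) *\<^sub>R center B k :: real^'n"
  have V: "norm ?V = real (CARD('N) - 1) * real B * 2 ^ k" by (simp add: norm_center)
  have n: "norm (?W + ?V) \<le> real CARD('N) * real CARD('n) * 2 ^ k" by (rule center1_near)
  have "1 * (real B * 2 ^ k) \<le> real (CARD('N) - 1) * (real B * 2 ^ k)" using N by (intro mult_right_mono) auto
  moreover have "norm ?V \<le> norm ?W + norm (?W + ?V)" using norm_triangle_ineq4[of "?W + ?V" ?W] by simp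
  ultimately show "(real B - real CARD('N) * real CARD('n)) * 2 ^ k \<le> norm ?W"
    using n unfolding V by (simp add: left_diff_distrib mult.assoc)
  have "norm ?W \<le> norm ?V + norm (?W + ?V)" using norm_triangle_ineq4[of "?W + ?V" ?V] by simp
  moreover have "real (CARD('N) - 1) * (real B * 2 ^ k) \<le> real CARD('N) * (real B * 2 ^ k)" by (intro mult_right_mono) auto
  ultimately show "norm ?W \<le> (real CARD('N) * real B + real CARD('N) * real CARD('n)) * 2 ^ k"
    using n unfolding V by (simp add: distrib_right mult.assoc)
qed

text \<open>In the ball of scale \<open>k\<close> the norm differs from
  \<open>(N - 1) * B * 2 ^ k\<close> by at most a quarter of it. A larger scale at least doubles
  this value, and 5/4 is less than twice 3/4, so the frequency in slot \<open>j1\<close> reveals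
  \<open>k\<close>. The hypothesis \<open>N \<ge> 2\<close> makes the factor \<open>N - 1\<close>
  positive.\<close>

lemma center1_separated:
  fixes \<xi> :: "real^'n::finite"
  assumes N: "2 \<le> CARD('N::finite)"
    and B: "4 * (real CARD('N) * real CARD('n) + radius TYPE('n) TYPE('N) + 1) \<le> real B"
    and k: "norm (\<xi> - center1 TYPE('N) B k) \<le> radius TYPE('n) TYPE('N) * 2 ^ k"
    and k': "norm (\<xi> - center1 TYPE('N) B k') \<le> radius TYPE('n) TYPE('N) * 2 ^ k'"
  shows "k = k'"
proof -
  let ?r = "radius TYPE('n) TYPE('N)"
  define a where "a = real CARD('N) * real CARD('n)"
  note B = B[folded a_def]
  let ?b = "real (CARD('N) - 1) * real B"
  have r: "0 \<le> ?r" "0 \<le> a" by (auto simp: radius_def a_def)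
  have b1: "4 * (a + ?r) + 4 \<le> real B" using B by (simp add: algebra_simps)
  have b2: "0 \<le> a + ?r" using r by (rule add_nonneg_nonneg[rotated])
  have b0: "0 < real B" by (rule less_le_trans[OF add_nonneg_pos b1]) (use b2 in simp_all)
  have "1 * real B \<le> ?b" using N by (intro mult_right_mono) auto
  then have bb: "4 * (a + ?r) \<le> ?b" "0 < ?b" using b0 b1 by linarith+
  have est: "\<bar>norm \<xi> - ?b * 2 ^ l\<bar> \<le> ?b / 4 * 2 ^ l" if "norm (\<xi> - center1 TYPE('N) B l) \<le> ?r * 2 ^ l" for l
  proof -
    let ?V = "real (CARD('N) - 1) *\<^sub>R center B l :: real^'n"
    have "norm (\<xi> + ?V) \<le> norm (\<xi> - center1 TYPE('N) B l) + norm (center1 TYPE('N) B l + ?V)"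
      using norm_triangle_ineq[of "\<xi> - center1 TYPE('N) B l" "center1 TYPE('N) B l + ?V"] by simp
    also have "\<dots> \<le> ?r * 2 ^ l + a * 2 ^ l" using that center1_near[where 'N='N and 'n='n, of B l, folded a_def] by linarith
    also have "\<dots> = (a + ?r) * 2 ^ l" by (simp add: distrib_right)
    also have "\<dots> \<le> ?b / 4 * 2 ^ l" using bb by (intro mult_right_mono) auto
    finally have "norm (\<xi> + ?V) \<le> ?b / 4 * 2 ^ l" .
    moreover have "\<bar>norm \<xi> - norm ?V\<bar> \<le> norm (\<xi> + ?V)"
      using norm_triangle_ineq3[of \<xi> "- ?V"] by simp
    moreover have "norm ?V = ?b * 2 ^ l" by (simp add: norm_center)
    ultimately show ?thesis by linarith
  qed
  have no: False if "i < l" "norm (\<xi> - center1 TYPE('N) B i) \<le> ?r * 2 ^ i" "norm (\<xi> - center1 TYPE('N) B l) \<le> ?r * 2 ^ l" for i l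
  proof -
    have "(2::real) ^ Suc i \<le> 2 ^ l" using that(1) by (intro power_increasing) auto
    then have "?b * (2 * 2 ^ i) \<le> ?b * 2 ^ l" using bb by (intro mult_left_mono) auto
    moreover have "0 < ?b * 2 ^ i" using bb by simp
    moreover have ar: False if "2 * x \<le> y" "0 < x" "\<bar>t - x\<bar> \<le> x / 4" "\<bar>t - y\<bar> \<le> y / 4" for x y t :: real
      using that unfolding abs_le_iff by linarith
    moreover have "2 * (?b * 2 ^ i) \<le> ?b * 2 ^ l"
      using \<open>?b * (2 * 2 ^ i) \<le> ?b * 2 ^ l\<close> by (simp only: mult.left_commute)
    ultimately show False using ar[of "?b * 2 ^ i" "?b * 2 ^ l" "norm \<xi>"] est[OF that(2)] est[OF that(3)]
      by (simp only: times_divide_eq_left)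
  qed
  show ?thesis using no[of k k'] no[of k' k] k k' by (meson linorder_neqE_nat)
qed

section \<open>The fundamental inequality\<close>

text \<open>The common core of both inequalities. The left side is the size of the output on
  \<open>E k\<close>: coefficient size, number of free combinations, and an exponential sum of
  modulus at least \<open>v k\<close> on a set of measure at least \<open>\<mu> k\<close>, reduced
  by the loss from pigeonholing over the pieces in \<open>F k\<close>. Which piece is large remains
  unknown, hence the quantifier over \<open>l\<close>. The right side is the product of the input
  quasi-norms, to which slots outside \<open>insert j1 J\<close> contribute only a constant.\<close>

lemma boundedness_estimate:
  fixes \<psi> :: "nat \<Rightarrow> real^'n::finite \<Rightarrow> complex"
    and p q :: ennreal and s m :: real
    and ps qs :: "'N::finite \<Rightarrow> ennreal" and ss :: "'N \<Rightarrow> real"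
    and J :: "'N set" and M :: "nat \<Rightarrow> ('n \<Rightarrow> nat) set" and b :: "nat \<Rightarrow> ('n \<Rightarrow> nat) \<Rightarrow> real"
  assumes \<psi>: "littlewood_paley \<psi>" and N: "2 \<le> CARD('N)" and p: "0 < p" and q: "0 < q"
    and ps: "\<And>j. 0 < ps j" and qs: "\<And>j. 0 < qs j"
    and Op: "Op_subset_B m (\<lambda>j. besov_norm \<psi> (ss j) (ps j) (qs j)) (besov_norm \<psi> s p q)"
    and B: "4 * (real CARD('N) * real CARD('n) + radius TYPE('n) TYPE('N) + 1) \<le> real B"
    and L: "real CARD('N) * real B + real CARD('N) * real CARD('n) + radius TYPE('n) TYPE('N) + 1 \<le> 2 ^ L"
    and j1: "j1 \<notin> J" and card: "card J + t + 1 = CARD('N)"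
    and M: "\<And>k. M k \<subseteq> grid k" and b: "\<And>k z. b k z = 1 \<or> b k z = - 1"
    and E: "\<And>k. E k \<in> sets borel" "\<And>k. E k \<subseteq> ball (0 :: real^'n) 1"
    and v: "\<And>k. 0 \<le> v k" "\<And>k x. x \<in> E k \<Longrightarrow> v k \<le> norm (\<Sum>z\<in>M k. complex_of_real (b k z) * cis (x \<bullet> lat z))"
    and \<mu>: "\<And>k. 0 < \<mu> k" "\<And>k. ennreal (\<mu> k) \<le> emeasure lborel (E k)"
    and F: "\<And>k. finite (F k)" "\<And>k. F k \<noteq> {}"
    and Fsum: "\<And>k z \<zeta>. z \<in> M k \<Longrightarrow> norm (\<zeta> - (lat z - real t *\<^sub>R center B k)) \<le> 1 / 2 \<Longrightarrow> (\<Sum>l\<in>F k. \<psi> l \<zeta>) = 1"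
  shows "\<exists>C>0. \<forall>k. \<exists>l\<in>F k. 2 powr (real l * s) *
      (2 powr (real k * m) * 2 powr (real k * (real CARD('n) * real (card J))) * v k / real (card (F k)) * (\<mu> k / real (card (F k))) powr (1 / enn2real p))
      \<le> C * 2 powr (real k * (\<Sum>j\<in>insert j1 J. ss j + real CARD('n) - max (dim_over TYPE('n) (ps j)) (real CARD('n) / 2)))"
proof -
  let ?n = "CARD('n)" and ?N = "CARD('N)"
  let ?A = "\<lambda>\<xi>::(real^'n)^'N. \<Sum>j\<in>UNIV. \<xi> $ j"
  let ?r = "radius TYPE('n) TYPE('N)"
  let ?Z = "\<lambda>k. real t *\<^sub>R (center B k :: real^'n)"
  define e where "e j = ss j + real ?n - max (dim_over TYPE('n) (ps j)) (real ?n / 2)" for j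
  obtain H :: "(real^'n)^'N \<Rightarrow> complex" and g where g: "0 < g" and H: "cc_smooth H" "small_supp H"
    and H1: "\<And>\<xi> j. H \<xi> \<noteq> 0 \<Longrightarrow> norm (\<xi> $ j) < 1 / 8" and H2: "\<And>\<xi>. H \<xi> \<noteq> 0 \<Longrightarrow> norm (?A \<xi>) \<le> 1 / 2"
    and H3: "\<And>x::real^'n. norm x \<le> 1 \<Longrightarrow> g \<le> norm (wave ?A H x)"
    using bump_exists[OF \<psi>, where 'N='N] by (elim exE conjE) (rule that, auto)
  have iH: "integrable lborel H" by (rule rapid_integrable[OF cc_smooth_rapid[OF H(1)]])
  define Q where "Q j k W C h \<longleftrightarrow> cc_smooth h \<and>
      (\<forall>z\<in>grid (k + ?N). (h (W + lat z) = 1 \<or> h (W + lat z) = - 1) \<and>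
         (\<forall>\<xi>. norm (\<xi> - (W + lat z)) < 1 / 8 \<longrightarrow> h \<xi> = h (W + lat z))) \<and>
      (\<forall>\<xi>. h \<xi> \<noteq> 0 \<longrightarrow> norm (\<xi> - W) \<le> ?r * 2 ^ k) \<and>
      besov_norm \<psi> (ss j) (ps j) (qs j) (dist_of (inv_fourier h)) \<le> ennreal (C * 2 powr (real k * e j))" for j k W C h
  have "\<forall>j. \<exists>C>0. \<forall>k W. (\<forall>\<xi>. norm (\<xi> - W) \<le> ?r * 2 ^ k \<longrightarrow> 2 ^ k \<le> norm \<xi> \<and> norm \<xi> \<le> 2 ^ (k + L)) \<longrightarrow> (\<exists>h. Q j k W C h)"
    unfolding Q_def radius_def e_def using test_function_exists[OF \<psi> ps qs] by blast
  then obtain C1 where C1: "\<And>j. 0 < C1 j" and Q: "\<And>j k W. (\<forall>\<xi>. norm (\<xi> - W) \<le> ?r * 2 ^ k \<longrightarrow> 2 ^ k \<le> norm \<xi> \<and> norm \<xi> \<le> 2 ^ (k + L)) \<Longrightarrow> \<exists>h. Q j k W (C1 j) h"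
    by metis
  have "\<forall>j. \<exists>C>0. besov_norm \<psi> (ss j) (ps j) (qs j) (dist_of (inv_fourier (\<psi> 0))) \<le> ennreal C"
    using besov_norm_low_frequency[OF \<psi> ps qs] by blast
  then obtain C2 where C2: "\<And>j. 0 < C2 j" "\<And>j. besov_norm \<psi> (ss j) (ps j) (qs j) (dist_of (inv_fourier (\<psi> 0))) \<le> ennreal (C2 j)"
    by metis
  define W where "W k j = (if j = j1 then center1 TYPE('N) B k else center B k :: real^'n)" for k j
  have N1: "1 \<le> real ?N" using N by linarith
  have ann: "2 ^ k \<le> norm \<xi> \<and> norm \<xi> \<le> 2 ^ (k + L)" if "norm (\<xi> - W k j) \<le> ?r * 2 ^ k" for \<xi> k j
  proof (rule annulus_ball[OF B L])
    show "(real B - real ?N * real ?n) * 2 ^ k \<le> norm (W k j)" "norm (W k j) \<le> (real ?N * real B + real ?N * real ?n) * 2 ^ k"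
      unfolding W_def using norm_center_bounds[OF N1] norm_center1_bounds[OF N] by auto
    have "?r * 2 ^ k \<le> (?r + 1) * 2 ^ k" by (intro mult_right_mono) auto
    then show "norm (\<xi> - W k j) \<le> (?r + 1) * 2 ^ k" using that by linarith
  qed
  have "\<forall>k j. \<exists>h. Q j k (W k j) (C1 j) h" using Q ann by blast
  then obtain hh where hh: "\<And>k j. Q j k (W k j) (C1 j) (hh k j)" by metis
  \<comment> \<open>The remaining slots, at frequency 0, receive \<open>\<psi> 0\<close>, which is 1
    near 0 and so behaves there like the other inputs near a node.\<close>
  define h where "h k j = (if j \<in> insert j1 J then hh k j else \<psi> 0)" for k j
  have cch: "cc_smooth (h k j)" for k j
    using hh[of j k] lp_cc_smooth[OF \<psi>, of 0] unfolding h_def Q_def by auto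
  have supp: "norm (\<xi> - W k j) \<le> ?r * 2 ^ k" if "j \<in> insert j1 J" "h k j \<xi> \<noteq> 0" for k j \<xi>
    using hh[of j k] that unfolding h_def Q_def by simp
  define \<Theta> where "\<Theta> k = node B t J j1 k ` (M k \<times> PiE J (\<lambda>_. grid k))" for k
  have grid_mono: "(grid k :: ('n \<Rightarrow> nat) set) \<subseteq> grid (k + ?N)" for k
  proof
    fix z :: "'n \<Rightarrow> nat" assume "z \<in> grid k"
    moreover have "(2::nat) ^ k \<le> 2 ^ (k + ?N)" by (intro power_increasing) auto
    ultimately show "z \<in> grid (k + ?N)" unfolding grid_def using less_le_trans by blast
  qed
  have near: "(h k j (\<nu> $ j) = 1 \<or> h k j (\<nu> $ j) = - 1) \<and> (\<forall>\<xi>. norm (\<xi> - \<nu> $ j) < 1 / 8 \<longrightarrow> h k j \<xi> = h k j (\<nu> $ j))"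
    if \<nu>: "\<nu> \<in> \<Theta> k" for k \<nu> j
  proof -
    obtain zu where zu: "zu \<in> M k \<times> PiE J (\<lambda>_. grid k)" "\<nu> = node B t J j1 k zu" using \<nu> unfolding \<Theta>_def by blast
    show ?thesis
    proof (cases "j \<in> insert j1 J")
      case True
      have "\<exists>z\<in>grid (k + ?N). \<nu> $ j = W k j + lat z"
      proof (cases "j = j1")
        case True
        then show ?thesis using node_dependent[OF j1 card, of zu k B] zu M[of k] unfolding W_def by auto
      next
        case False
        then have jJ: "j \<in> J" using True by simp
        then have "snd zu j \<in> grid k" using zu(1) by auto
        then have "snd zu j \<in> grid (k + ?N)" by (rule subsetD[OF grid_mono])
        then show ?thesis using jJ False unfolding W_def zu(2) node_def by auto
      qed
      then obtain z where z: "z \<in> grid (k + ?N)" "\<nu> $ j = W k j + lat z" by blast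
      have hj: "h k j = hh k j" using True unfolding h_def by simp
      have "\<forall>z\<in>grid (k + ?N). (hh k j (W k j + lat z) = 1 \<or> hh k j (W k j + lat z) = - 1) \<and>
         (\<forall>\<xi>. norm (\<xi> - (W k j + lat z)) < 1 / 8 \<longrightarrow> hh k j \<xi> = hh k j (W k j + lat z))"
        using hh[of j k] unfolding Q_def by (elim conjE)
      from bspec[OF this z(1)] show ?thesis unfolding hj z(2) .
    next
      case False
      then have "\<nu> $ j = 0" unfolding zu(2) node_def by simp
      then show ?thesis using False lp_one[OF \<psi>] unfolding h_def by auto
    qed
  qed
  have sep: "k = k'" if "h k j1 \<xi> \<noteq> 0" "h k' j1 \<xi> \<noteq> 0" for k k' \<xi>
    using center1_separated[OF N B, of \<xi> k k'] supp[of j1 k \<xi>] supp[of j1 k' \<xi>] that unfolding W_def by simp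
  have near1: "h k j (\<nu> $ j) = 1 \<or> h k j (\<nu> $ j) = - 1" if "\<nu> \<in> \<Theta> k" for k \<nu> j
    using near[OF that] by (rule conjunct1)
  have near2: "h k j \<xi> = h k j (\<nu> $ j)" if "\<nu> \<in> \<Theta> k" "norm (\<xi> - \<nu> $ j) < 1 / 8" for k \<nu> j \<xi>
    by (rule near[OF that(1), THEN conjunct2, rule_format, OF that(2)])
  have nz: "h k j (\<nu> $ j) \<noteq> 0" if "\<nu> \<in> \<Theta> k" for k \<nu> j
    using near1[OF that, of j] by (elim disjE) simp_all
  have nzn: "norm (h k j (\<nu> $ j)) = 1" if "\<nu> \<in> \<Theta> k" for k \<nu> j
    using near1[OF that, of j] by (elim disjE) simp_all
  have uniq: "k = k'" if "\<nu> \<in> \<Theta> k" "\<nu> \<in> \<Theta> k'" for k k' \<nu> using sep nz that by blast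
  \<comment> \<open>The coefficient has to be read off from the node. Its total frequency is
    \<open>lat z - ?Z k\<close>, from which adding \<open>?Z k\<close> and rounding the coordinates
    recovers \<open>z\<close>; at any other frequency the value is still a sign.\<close>
  define bb where "bb k \<zeta> = b k (\<lambda>i. nat (round ((\<zeta> + ?Z k) $ i)))" for k \<zeta>
  have bb_lat: "bb k (lat z - ?Z k) = b k z" for k z
  proof -
    have "lat z - ?Z k + ?Z k = lat z" by simp
    then show ?thesis unfolding bb_def by (simp add: lat_def)
  qed
  \<comment> \<open>\<open>d\<close> is the coefficient wanted in the output. \<open>c\<close>
    carries in addition the signs of the inputs at the node; these cancel against the inputs,
    because a sign is its own inverse. A node belongs to one scale only, so the choice of
    \<open>k\<close> inside \<open>c\<close> is forced.\<close>
  define d where "d k \<nu> = complex_of_real (2 powr (real k * m) * bb k (?A \<nu>))" for k \<nu>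
  define c where "c \<nu> = (if \<exists>k. \<nu> \<in> \<Theta> k then let k = (SOME k. \<nu> \<in> \<Theta> k) in d k \<nu> * (\<Prod>j\<in>UNIV. h k j (\<nu> $ j)) else 0)" for \<nu>
  have c_eq: "c \<nu> = d k \<nu> * (\<Prod>j\<in>UNIV. h k j (\<nu> $ j))" if "\<nu> \<in> \<Theta> k" for k \<nu>
  proof -
    have "(SOME k. \<nu> \<in> \<Theta> k) = k" using that uniq by (intro some_equality) auto
    then show ?thesis using that unfolding c_def by auto
  qed
  \<comment> \<open>All slots have norm at most \<open>2 ^ (k + L)\<close> and slot
    \<open>j1\<close> has norm at least \<open>2 ^ k\<close>, so the symbol weight at a node of
    scale \<open>k\<close> is comparable to \<open>2 ^ k\<close>.\<close>
  define R where "R = 1 + real ?N * 2 ^ L"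
  have R1: "1 \<le> R" by (simp add: R_def)
  have weight: "2 ^ k \<le> 1 + (\<Sum>j\<in>UNIV. norm (\<nu> $ j))" "1 + (\<Sum>j\<in>UNIV. norm (\<nu> $ j)) \<le> R * 2 ^ k" if \<nu>: "\<nu> \<in> \<Theta> k" for k \<nu>
  proof -
    have "2 ^ k \<le> norm (\<nu> $ j1)" using ann[OF supp[OF _ nz[OF \<nu>]]] by blast
    also have "\<dots> \<le> (\<Sum>j\<in>UNIV. norm (\<nu> $ j))" by (rule member_le_sum) auto
    finally show "2 ^ k \<le> 1 + (\<Sum>j\<in>UNIV. norm (\<nu> $ j))" by simp
    have "norm (\<nu> $ j) \<le> 2 ^ (k + L)" for j
    proof (cases "j \<in> insert j1 J")
      case True then show ?thesis using ann[OF supp[OF True nz[OF \<nu>]]] by blast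
    next
      case False
      then have "\<nu> $ j = 0" using \<nu> unfolding \<Theta>_def node_def by auto
      then show ?thesis by simp
    qed
    then have "(\<Sum>j\<in>UNIV. norm (\<nu> $ j)) \<le> (\<Sum>j\<in>(UNIV::'N set). 2 ^ (k + L))" by (intro sum_mono)
    also have "\<dots> = real ?N * 2 ^ L * 2 ^ k" by (simp add: power_add)
    finally have S: "(\<Sum>j\<in>UNIV. norm (\<nu> $ j)) \<le> real ?N * 2 ^ L * 2 ^ k" .
    have "(1::real) \<le> 2 ^ k" by simp
    from add_mono[OF this S] show "1 + (\<Sum>j\<in>UNIV. norm (\<nu> $ j)) \<le> R * 2 ^ k"
      by (simp only: R_def distrib_right mult_1)
  qed
  have absd: "norm (d k \<nu>) = 2 powr (real k * m)" for k \<nu>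
    using b[of k "\<lambda>i. nat (round ((?A \<nu> + ?Z k) $ i))"] unfolding d_def bb_def by (auto simp: norm_mult)
  have cbound: "norm (c \<nu>) \<le> R powr \<bar>m\<bar> * (1 + (\<Sum>j\<in>UNIV. norm (\<nu> $ j))) powr m" for \<nu>
  proof (cases "\<exists>k. \<nu> \<in> \<Theta> k")
    case True
    then obtain k where k: "\<nu> \<in> \<Theta> k" by blast
    let ?w = "1 + (\<Sum>j\<in>UNIV. norm (\<nu> $ j))"
    have "norm (\<Prod>j\<in>UNIV. h k j (\<nu> $ j)) = (\<Prod>j\<in>(UNIV::'N set). 1)"
      unfolding prod_norm[symmetric] by (intro prod.cong refl nzn[OF k])
    then have "norm (c \<nu>) = 2 powr (real k * m)" unfolding c_eq[OF k] norm_mult absd by simp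
    also have "\<dots> = (2 ^ k) powr m" by (simp flip: powr_realpow add: powr_powr)
    also have "\<dots> \<le> R powr \<bar>m\<bar> * ?w powr m"
    proof (rule powr_comparable[OF _ _ _ _ R1])
      show w0: "0 < ?w" by (intro add_pos_nonneg sum_nonneg) auto
      have "1 * ?w \<le> R * ?w" using R1 w0 by (intro mult_right_mono) auto
      from order_trans[OF weight(1)[OF k] this[unfolded mult_1]] show "2 ^ k \<le> R * ?w" .
    qed (use weight(2)[OF k] in auto)
    finally show ?thesis .
  next
    case False then show ?thesis unfolding c_def by simp
  qed
  have "(\<lambda>(x, \<xi>). lattice_sum c H \<xi>) \<in> symbol_class m" by (rule lattice_sum_symbol[OF H cbound])
  then have "bounded_operator (pseudo_diff (\<lambda>(x, \<xi>). lattice_sum c H \<xi>)) (\<lambda>j. besov_norm \<psi> (ss j) (ps j) (qs j)) (besov_norm \<psi> s p q)"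
    using Op unfolding Op_subset_B_def by blast
  \<comment> \<open>\<open>C0\<close> belongs to the one symbol that contains all scales;
    \<open>k\<close> is fixed only afterwards.\<close>
  then obtain C0 where C0: "0 < C0" and bo: "\<And>f. (\<forall>j. f j \<in> schwartz \<and> dist_of (f j) \<in> space_of (besov_norm \<psi> (ss j) (ps j) (qs j))) \<Longrightarrow>
      besov_norm \<psi> s p q (dist_of (pseudo_diff (\<lambda>(x, \<xi>). lattice_sum c H \<xi>) f)) \<le> ennreal C0 * (\<Prod>j\<in>UNIV. besov_norm \<psi> (ss j) (ps j) (qs j) (dist_of (f j)))"
    unfolding bounded_operator_def by blast
  define CC where "CC j = (if j \<in> insert j1 J then C1 j else C2 j)" for j
  have CC: "0 < CC j" for j using C1 C2 by (simp add: CC_def)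
  define e' where "e' j = (if j \<in> insert j1 J then e j else 0)" for j
  define c0 where "c0 = 1 / (2 * pi) ^ (?N * ?n)"
  have c0: "0 < c0" by (simp add: c0_def)
  define CF where "CF = C0 * (\<Prod>j\<in>UNIV. CC j) / (c0 * g)"
  have CF: "0 < CF" unfolding CF_def using C0 CC c0 g by (simp add: prod_pos)
  have main: "\<exists>l\<in>F k. 2 powr (real l * s) *
      (2 powr (real k * m) * 2 powr (real k * (real ?n * real (card J))) * v k / real (card (F k)) * (\<mu> k / real (card (F k))) powr (1 / enn2real p))
      \<le> CF * 2 powr (real k * (\<Sum>j\<in>insert j1 J. e j))" for k
  proof -
    define f where "f j = inv_fourier (h k j)" for j
    have fs: "f j \<in> schwartz" for j unfolding f_def by (rule inv_fourier_schwartz[OF cch])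
    have Xb: "besov_norm \<psi> (ss j) (ps j) (qs j) (dist_of (f j)) \<le> ennreal (CC j * 2 powr (real k * e' j))" for j
      using hh[of j k] C2(2)[of j] unfolding f_def h_def CC_def e'_def Q_def by auto
    have "dist_of (f j) \<in> space_of (besov_norm \<psi> (ss j) (ps j) (qs j))" for j
      unfolding space_of_def using tempered_dist_of[OF rapid_integrable[OF schwartz_rapid[OF fs]]] Xb[of j]
      by (auto intro: le_less_trans)
    then have "besov_norm \<psi> s p q (dist_of (pseudo_diff (\<lambda>(x, \<xi>). lattice_sum c H \<xi>) f)) \<le> ennreal C0 * (\<Prod>j\<in>UNIV. besov_norm \<psi> (ss j) (ps j) (qs j) (dist_of (f j)))"
      using bo fs by blast
    also have "\<dots> \<le> ennreal C0 * (\<Prod>j\<in>UNIV. ennreal (CC j * 2 powr (real k * e' j)))"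
      by (intro mult_left_mono prod_mono_ennreal Xb) auto
    also have "\<dots> = ennreal (C0 * (\<Prod>j\<in>UNIV. CC j * 2 powr (real k * e' j)))"
      using CC C0 by (subst prod_ennreal) (auto simp: less_imp_le ennreal_mult' prod_nonneg)
    also have "(\<Prod>j\<in>UNIV. CC j * 2 powr (real k * e' j)) = (\<Prod>j\<in>UNIV. CC j) * 2 powr (real k * (\<Sum>j\<in>insert j1 J. e j))"
    proof -
      have "(\<Sum>j\<in>UNIV. e' j) = (\<Sum>j\<in>insert j1 J. e j)"
        unfolding e'_def by (subst sum.inter_filter[symmetric]) (auto intro: sum.cong)
      then have "(\<Prod>j\<in>(UNIV::'N set). 2 powr (real k * e' j)) = 2 powr (real k * (\<Sum>j\<in>insert j1 J. e j))"
        by (simp add: powr_sum[symmetric] sum_distrib_left[symmetric])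
      then show ?thesis by (simp add: prod.distrib)
    qed
    finally have up: "besov_norm \<psi> s p q (dist_of (pseudo_diff (\<lambda>(x, \<xi>). lattice_sum c H \<xi>) f)) \<le> ennreal (C0 * ((\<Prod>j\<in>UNIV. CC j) * 2 powr (real k * (\<Sum>j\<in>insert j1 J. e j))))" .
    have fin\<Theta>: "finite (\<Theta> k)"
      unfolding \<Theta>_def using finite_subset[OF M finite_grid] by (intro finite_imageI finite_cartesian_product finite_PiE finite_grid) auto
    define Ht where "Ht \<xi> = complex_of_real c0 * (\<Sum>\<nu>\<in>\<Theta> k. d k \<nu> * H (\<xi> - \<nu>))" for \<xi>
    have pd: "pseudo_diff (\<lambda>(x, \<xi>). lattice_sum c H \<xi>) f = wave ?A Ht"
    proof -
      have "lattice_sum c H \<xi> * (\<Prod>j\<in>UNIV. fourier (f j) (\<xi> $ j)) = (\<Sum>\<nu>\<in>\<Theta> k. d k \<nu> * H (\<xi> - \<nu>))" for \<xi>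
      proof (rule lattice_sum_eq[OF H(2) fin\<Theta>])
        show "integer_vec \<nu>" if "\<nu> \<in> \<Theta> k" for \<nu> using that integer_vec_node unfolding \<Theta>_def by blast
        fix \<nu> assume "H (\<xi> - \<nu>) \<noteq> 0"
        then have nr: "norm (\<xi> $ j - \<nu> $ j) < 1 / 8" for j using H1[of "\<xi> - \<nu>" j] by simp
        have ff: "(\<Prod>j\<in>UNIV. fourier (f j) (\<xi> $ j)) = (\<Prod>j\<in>UNIV. h k j (\<xi> $ j))"
          unfolding f_def fourier_inv_fourier[OF cch] ..
        show "c \<nu> * (\<Prod>j\<in>UNIV. fourier (f j) (\<xi> $ j)) = (if \<nu> \<in> \<Theta> k then d k \<nu> else 0)"
        proof (cases "\<nu> \<in> \<Theta> k")
          case True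
          have "h k j (\<nu> $ j) * h k j (\<xi> $ j) = 1" for j
          proof -
            have "h k j (\<xi> $ j) = h k j (\<nu> $ j)" by (rule near2[OF True nr])
            then show ?thesis using near1[OF True, of j] by (elim disjE) simp_all
          qed
          then have "(\<Prod>j\<in>UNIV. h k j (\<nu> $ j)) * (\<Prod>j\<in>UNIV. h k j (\<xi> $ j)) = 1"
            unfolding prod.distrib[symmetric] by simp
          then show ?thesis unfolding ff c_eq[OF True] using True by (simp add: mult.assoc)
        next
          case False
          show ?thesis
          proof (cases "\<exists>k'. \<nu> \<in> \<Theta> k'")
            case True
            then obtain k' where k': "\<nu> \<in> \<Theta> k'" by blast
            \<comment> \<open>Near a node of another scale \<open>k'\<close> the input of scale
              \<open>k'\<close> in slot \<open>j1\<close> does not vanish, hence the input of scale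
              \<open>k\<close> in that slot does.\<close>
            have "h k' j1 (\<xi> $ j1) = h k' j1 (\<nu> $ j1)" by (rule near2[OF k' nr])
            then have "h k' j1 (\<xi> $ j1) \<noteq> 0" using nz[OF k', of j1] by simp
            moreover have "k' \<noteq> k" using False k' by auto
            ultimately have "h k j1 (\<xi> $ j1) = 0" using sep by blast
            then have "(\<Prod>j\<in>UNIV. h k j (\<xi> $ j)) = 0" by (intro prod_zero) auto
            then show ?thesis unfolding ff using False by simp
          next
            case none: False
            then have "c \<nu> = 0" unfolding c_def by simp
            then show ?thesis using False by simp
          qed
        qed
      qed
      then show ?thesis unfolding pseudo_diff_wave Ht_def c0_def by simp
    qed
    have itr: "integrable lborel (\<lambda>\<xi>. H (\<xi> - \<nu>))" for \<nu>
      using integrable_lborel_affine[OF iH, of 1 "- \<nu>"] by (simp add: add.commute)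
    have iHt: "integrable lborel Ht"
      unfolding Ht_def by (intro integrable_mult_right Bochner_Integration.integrable_sum itr)
    have val: "wave ?A Ht x = complex_of_real c0 * (wave ?A H x * (complex_of_real (2 powr (real k * m) * 2 powr (real k * (real ?n * real (card J)))) *
       (cis (- (x \<bullet> ?Z k)) * (\<Sum>z\<in>M k. complex_of_real (b k z) * cis (x \<bullet> lat z)))))" for x
    proof -
      let ?P = "PiE J (\<lambda>_. grid k :: ('n \<Rightarrow> nat) set)"
      have "(\<Sum>\<nu>\<in>\<Theta> k. d k \<nu> * cis (x \<bullet> ?A \<nu>)) = (\<Sum>zu\<in>M k \<times> ?P. d k (node B t J j1 k zu) * cis (x \<bullet> ?A (node B t J j1 k zu)))"
        unfolding \<Theta>_def by (subst sum.reindex[OF node_inj[OF j1]]) simp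
      also have "\<dots> = (\<Sum>zu\<in>M k \<times> ?P. complex_of_real (2 powr (real k * m)) * cis (- (x \<bullet> ?Z k)) * (complex_of_real (b k (fst zu)) * cis (x \<bullet> lat (fst zu))))"
      proof (rule sum.cong[OF refl])
        fix zu :: "('n \<Rightarrow> nat) \<times> ('N \<Rightarrow> 'n \<Rightarrow> nat)"
        have "cis (x \<bullet> (lat (fst zu) - ?Z k)) = cis (- (x \<bullet> ?Z k)) * cis (x \<bullet> lat (fst zu))"
          by (simp only: inner_diff_right cis_mult) (simp add: add.commute)
        then show "d k (node B t J j1 k zu) * cis (x \<bullet> ?A (node B t J j1 k zu)) =
            complex_of_real (2 powr (real k * m)) * cis (- (x \<bullet> ?Z k)) * (complex_of_real (b k (fst zu)) * cis (x \<bullet> lat (fst zu)))"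
          unfolding d_def node_sum[OF j1] bb_lat by (simp only: of_real_mult mult_ac)
      qed
      \<comment> \<open>The summand does not depend on \<open>u\<close>: all free combinations add
        up with the same phase, which produces the factor \<open>card ?P\<close>.\<close>
      also have "\<dots> = (\<Sum>z\<in>M k. \<Sum>u\<in>?P. complex_of_real (2 powr (real k * m)) * cis (- (x \<bullet> ?Z k)) * (complex_of_real (b k z) * cis (x \<bullet> lat z)))"
        by (simp only: sum.cartesian_product) (auto intro!: sum.cong)
      also have "\<dots> = of_nat (card ?P) * (complex_of_real (2 powr (real k * m)) * (cis (- (x \<bullet> ?Z k)) * (\<Sum>z\<in>M k. complex_of_real (b k z) * cis (x \<bullet> lat z))))"
        by (simp add: sum_distrib_left mult_ac)
      also have "of_nat (card ?P) = complex_of_real (2 powr (real k * (real ?n * real (card J))))"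
      proof -
        have "card ?P = ((2 ^ k) ^ ?n) ^ card J" by (simp add: card_PiE card_grid)
        then have "real (card ?P) = 2 powr (real k * (real ?n * real (card J)))"
          by (simp flip: powr_realpow add: powr_powr mult.assoc)
        then show ?thesis by (metis of_real_of_nat_eq)
      qed
      finally show ?thesis
        unfolding Ht_def wave_cmult wave_lattice_sum[OF linear_sum_components iH fin\<Theta>] by (simp only: of_real_mult mult_ac)
    qed
    define V where "V = c0 * g * (2 powr (real k * m) * 2 powr (real k * (real ?n * real (card J))) * v k)"
    have low: "V \<le> norm (wave ?A Ht x)" if x: "x \<in> E k" for x
    proof -
      have "norm x \<le> 1" using x E(2)[of k] by auto
      then have "g * v k \<le> norm (wave ?A H x) * norm (\<Sum>z\<in>M k. complex_of_real (b k z) * cis (x \<bullet> lat z))"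
        using g v(1)[of k] v(2)[OF x] by (intro mult_mono H3) auto
      then have "c0 * (2 powr (real k * m) * 2 powr (real k * (real ?n * real (card J)))) * (g * v k) \<le>
         c0 * (2 powr (real k * m) * 2 powr (real k * (real ?n * real (card J)))) * (norm (wave ?A H x) * norm (\<Sum>z\<in>M k. complex_of_real (b k z) * cis (x \<bullet> lat z)))"
        using c0 by (intro mult_left_mono) auto
      moreover have "norm (wave ?A Ht x) = c0 * (norm (wave ?A H x) * ((2 powr (real k * m) * 2 powr (real k * (real ?n * real (card J)))) * norm (\<Sum>z\<in>M k. complex_of_real (b k z) * cis (x \<bullet> lat z))))"
        by (simp only: val norm_mult norm_of_real norm_cis abs_mult abs_of_pos[OF c0] abs_of_nonneg[OF powr_ge_zero] mult_1)
      ultimately show ?thesis by (simp only: V_def mult_ac)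
    qed
    have V0: "0 \<le> V" unfolding V_def using c0 g v(1)[of k] by simp
    \<comment> \<open>Every point where \<open>Ht\<close> is nonzero has total frequency within 1/2
      of that of a node, which is the region covered by \<open>Fsum\<close>.\<close>
    have one: "(\<Sum>l\<in>F k. \<psi> l (?A \<xi>)) = 1" if "Ht \<xi> \<noteq> 0" for \<xi>
    proof -
      have "\<exists>\<nu>\<in>\<Theta> k. H (\<xi> - \<nu>) \<noteq> 0"
      proof (rule ccontr)
        assume "\<not> ?thesis"
        then have "(\<Sum>\<nu>\<in>\<Theta> k. d k \<nu> * H (\<xi> - \<nu>)) = 0" by (intro sum.neutral) auto
        then show False using that unfolding Ht_def by simp
      qed
      then obtain \<nu> where \<nu>: "\<nu> \<in> \<Theta> k" "H (\<xi> - \<nu>) \<noteq> 0" by blast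
      obtain zu where zu: "zu \<in> M k \<times> PiE J (\<lambda>_. grid k)" "\<nu> = node B t J j1 k zu" using \<nu>(1) unfolding \<Theta>_def by blast
      have "?A (\<xi> - \<nu>) = ?A \<xi> - (lat (fst zu) - ?Z k)"
        using linear_diff[OF linear_sum_components, of \<xi> \<nu>] node_sum[OF j1, of B t k zu] zu(2) by simp
      then have "norm (?A \<xi> - (lat (fst zu) - ?Z k)) \<le> 1 / 2" using H2[OF \<nu>(2)] by simp
      then show ?thesis using zu(1) by (intro Fsum[of "fst zu" k]) auto
    qed
    have "\<exists>l\<in>F k. ennreal (2 powr (real l * s) * (V / real (card (F k)) * (\<mu> k / real (card (F k))) powr (1 / enn2real p))) \<le> besov_norm \<psi> s p q (dist_of (wave ?A Ht))"
      by (rule besov_norm_lower[OF \<psi> p q linear_sum_components iHt F(1) F(2) one E(1) V0 low \<mu>(1) \<mu>(2)])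
    then obtain l where l: "l \<in> F k" "ennreal (2 powr (real l * s) * (V / real (card (F k)) * (\<mu> k / real (card (F k))) powr (1 / enn2real p))) \<le> besov_norm \<psi> s p q (dist_of (wave ?A Ht))"
      by (elim bexE) (rule that)
    have "ennreal (2 powr (real l * s) * (V / real (card (F k)) * (\<mu> k / real (card (F k))) powr (1 / enn2real p)))
       \<le> ennreal (C0 * ((\<Prod>j\<in>UNIV. CC j) * 2 powr (real k * (\<Sum>j\<in>insert j1 J. e j))))"
      using l(2) up unfolding pd by (rule order_trans)
    moreover have "0 \<le> C0 * ((\<Prod>j\<in>UNIV. CC j) * 2 powr (real k * (\<Sum>j\<in>insert j1 J. e j)))"
      using C0 CC by (intro mult_nonneg_nonneg prod_nonneg) (auto simp: less_imp_le)
    ultimately have "2 powr (real l * s) * (V / real (card (F k)) * (\<mu> k / real (card (F k))) powr (1 / enn2real p))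
       \<le> C0 * ((\<Prod>j\<in>UNIV. CC j) * 2 powr (real k * (\<Sum>j\<in>insert j1 J. e j)))"
      by (simp only: ennreal_le_iff)
    then have "(c0 * g) * (2 powr (real l * s) *
      (2 powr (real k * m) * 2 powr (real k * (real ?n * real (card J))) * v k / real (card (F k)) * (\<mu> k / real (card (F k))) powr (1 / enn2real p)))
      \<le> C0 * (\<Prod>j\<in>UNIV. CC j) * 2 powr (real k * (\<Sum>j\<in>insert j1 J. e j))"
      by (simp add: V_def mult_ac)
    then have "2 powr (real l * s) *
      (2 powr (real k * m) * 2 powr (real k * (real ?n * real (card J))) * v k / real (card (F k)) * (\<mu> k / real (card (F k))) powr (1 / enn2real p))
      \<le> CF * 2 powr (real k * (\<Sum>j\<in>insert j1 J. e j))"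
      using c0 g unfolding CF_def times_divide_eq_left by (subst pos_le_divide_eq) (auto simp: mult_ac)
    then show ?thesis using l(1) by blast
  qed
  show ?thesis
  proof (intro exI[of _ CF] conjI CF allI)
    fix k show "\<exists>l\<in>F k. 2 powr (real l * s) *
      (2 powr (real k * m) * 2 powr (real k * (real ?n * real (card J))) * v k / real (card (F k)) * (\<mu> k / real (card (F k))) powr (1 / enn2real p))
      \<le> CF * 2 powr (real k * (\<Sum>j\<in>insert j1 J. ss j + real ?n - max (dim_over TYPE('n) (ps j)) (real ?n / 2)))"
      using main[of k] unfolding e_def .
  qed
qed

text \<open>For \<open>p > 1\<close> the conjugate exponent gives \<open>n - n / p\<close>, and the
  identity is \<open>min x (n / 2) - n = - max (n - x) (n / 2)\<close>; for \<open>p \<le> 1\<close>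
  both sides are \<open>- n / 2\<close>.\<close>

lemma min_dim_over_conj:
  assumes p: "0 < p"
  shows "min (dim_over TYPE('n::finite) p) (real CARD('n) / 2) - real CARD('n) = - max (dim_over TYPE('n) (conj_exponent p)) (real CARD('n) / 2)"
proof -
  consider "p \<le> 1" | "p = \<infinity>" | r where "p = ennreal r" "1 < r"
    by (cases p) (force simp: not_le)+
  then show ?thesis
  proof cases
    case 1
    then obtain r where r: "p = ennreal r" "0 < r" "r \<le> 1" using p by (cases p) (auto simp: top_unique)
    have "real CARD('n) / 2 \<le> real CARD('n) / r" using r by (intro divide_left_mono) auto
    then show ?thesis using 1 p r by (simp add: conj_exponent_def dim_over_def[of _ "\<infinity>"] dim_over_eq)
  next
    case 2
    then show ?thesis by (simp add: conj_exponent_def dim_over_eq top_unique)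
  next
    case 3
    have "conj_exponent p = ennreal (1 / (1 - 1 / r))"
    proof -
      have "1 / p = ennreal (1 / r)" using 3 by (simp add: divide_ennreal flip: ennreal_1)
      then have "1 - 1 / p = ennreal (1 - 1 / r)" using 3 by (simp add: ennreal_minus flip: ennreal_1)
      then have "1 / (1 - 1 / p) = ennreal (1 / (1 - 1 / r))" using 3 by (simp add: divide_ennreal flip: ennreal_1)
      then show ?thesis using 3 by (simp add: conj_exponent_def ennreal_le_1)
    qed
    then have "dim_over TYPE('n) (conj_exponent p) = real CARD('n) - real CARD('n) / r"
      using 3 by (simp add: dim_over_eq right_diff_distrib)
    moreover have "dim_over TYPE('n) p = real CARD('n) / r" using 3 p by (simp add: dim_over_eq)
    moreover have "min x (y / 2) - y = - max (y - x) (y / 2)" for x y :: real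
      by (simp add: min_def max_def)
    ultimately show ?thesis by simp
  qed
qed

lemma exponent_nonpos_if_bounded:
  assumes c: "0 < c" and le: "\<And>k::nat. c * 2 powr (real k * a) \<le> C * 2 powr (real k * b)"
  shows "a \<le> (b :: real)"
proof (rule ccontr)
  assume "\<not> a \<le> b"
  then have "1 < 2 powr (a - b)" by simp
  then obtain k where k: "C / c < (2 powr (a - b)) ^ k" using real_arch_pow by blast
  have "(2 powr (a - b)) ^ k * 2 powr (real k * b) = 2 powr (real k * a)"
    by (simp add: powr_power powr_add[symmetric] algebra_simps)
  then have "c * (2 powr (a - b)) ^ k * 2 powr (real k * b) \<le> C * 2 powr (real k * b)" using le[of k] by (simp add: mult.assoc)
  then have "c * (2 powr (a - b)) ^ k \<le> C" by simp
  then show False using k c by (simp add: pos_divide_less_eq mult.commute)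
qed

theorem theorem1p2:
  fixes \<psi> :: "nat \<Rightarrow> real^'n::finite \<Rightarrow> complex"
    and p q :: ennreal and s m :: real
    and ps qs :: "'N::finite \<Rightarrow> ennreal" and ss :: "'N \<Rightarrow> real"
  assumes "littlewood_paley \<psi>"
    and "CARD('N) \<ge> 2"
    and "0 < p" and "0 < q"
    and "\<And>j. 0 < ps j" and "\<And>j. 0 < qs j"
    and "m = min (dim_over TYPE('n) p) (real CARD('n) / 2)
             - (\<Sum>j\<in>UNIV. max (dim_over TYPE('n) (ps j)) (real CARD('n) / 2))
             + (\<Sum>j\<in>UNIV. ss j) - s"
    and "Op_subset_B m (\<lambda>j. besov_norm \<psi> (ss j) (ps j) (qs j)) (besov_norm \<psi> s p q)"
  shows "(\<forall>j. ss j \<le> max (dim_over TYPE('n) (ps j)) (real CARD('n) / 2)) \<and>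
         s \<ge> - max (dim_over TYPE('n) (conj_exponent p)) (real CARD('n) / 2)"
proof -
  note \<psi> = assms(1) and N = assms(2) and p = assms(3) and q = assms(4)
  let ?n = "CARD('n)" and ?N = "CARD('N)"
  let ?P = "enn2real p"
  define mn where "mn = min (dim_over TYPE('n) p) (real ?n / 2)"
  define mx where "mx j = max (dim_over TYPE('n) (ps j)) (real ?n / 2)" for j
  have m: "m = mn - sum mx UNIV + sum ss UNIV - s" using assms(7) unfolding mn_def mx_def by simp
  obtain B :: nat where B: "4 * (real ?N * real ?n + radius TYPE('n) TYPE('N) + 1) \<le> real B"
    using real_arch_simple by blast
  obtain L :: nat where "real ?N * real B + real ?N * real ?n + radius TYPE('n) TYPE('N) + 1 < 2 ^ L"
    using real_arch_pow[of 2] by (metis one_less_numeral_iff semiring_norm(76))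
  then have L: "real ?N * real B + real ?N * real ?n + radius TYPE('n) TYPE('N) + 1 \<le> 2 ^ L" by simp
  have r0: "real ?n + 1 \<le> radius TYPE('n) TYPE('N)"
  proof -
    have "(1::real) \<le> 2 ^ ?N" by simp
    then have "(1::real) \<le> 2 * 2 ^ ?N" by linarith
    then have "(real ?n + 1) * 1 \<le> (real ?n + 1) * (2 * 2 ^ ?N)" by (rule mult_left_mono) simp
    then show ?thesis by (simp only: radius_def mult_1_right mult_1_left mult_ac)
  qed
  have partA: "ss j0 \<le> mx j0" for j0
  proof -
    obtain j1 :: 'N where j1: "j1 \<noteq> j0"
    proof -
      have "\<not> (UNIV :: 'N set) \<subseteq> {j0}"
        using card_mono[of "{j0}" "UNIV :: 'N set"] N by auto
      then show ?thesis using that by blast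
    qed
    \<comment> \<open>Slot \<open>j0\<close> is frozen, \<open>j1\<close> is determined and the
      others are free. For \<open>N = 2\<close> the set \<open>J\<close> is empty and the count of
      combinations is 1.\<close>
    define J where "J = UNIV - {j0, j1}"
    have cJ: "card J = ?N - 2" unfolding J_def using j1 by (subst card_Diff_subset) auto
    have insJ: "insert j1 J = UNIV - {j0}" unfolding J_def using j1 by auto
    have j1J: "j1 \<notin> J" unfolding J_def by simp
    have card: "card J + 1 + 1 = ?N" using cJ N by simp
    obtain c where c: "0 < c" and ex0: "\<forall>k. \<exists>b E v \<mu>. (\<forall>m. b m = 1 \<or> b m = (- 1 :: real)) \<and> E \<in> sets borel \<and> E \<subseteq> ball (0 :: real^'n::finite) 1 \<and>
      0 \<le> v \<and> 0 < \<mu> \<and> ennreal \<mu> \<le> emeasure lborel E \<and>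
      (\<forall>x\<in>E. v \<le> norm (\<Sum>m\<in>grid k. complex_of_real (b m) * cis (x \<bullet> lat m))) \<and>
      c * 2 powr (real k * (real ?n - min (dim_over TYPE('n) p) (real ?n / 2))) \<le> v * \<mu> powr (1 / ?P)"
      using exponential_sum_lower[OF p, where 'n='n] by (elim exE conjE) (rule that)
    define G where "G k b E v \<mu> \<longleftrightarrow> (\<forall>m. b m = 1 \<or> b m = (- 1 :: real)) \<and> E \<in> sets borel \<and> E \<subseteq> ball (0 :: real^'n::finite) 1 \<and>
      0 \<le> v \<and> 0 < \<mu> \<and> ennreal \<mu> \<le> emeasure lborel E \<and>
      (\<forall>x\<in>E. v \<le> norm (\<Sum>m\<in>grid k. complex_of_real (b m) * cis (x \<bullet> lat m))) \<and>
      c * 2 powr (real k * (real ?n - mn)) \<le> v * \<mu> powr (1 / ?P)" for k b E v \<mu>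
    have "\<forall>k. \<exists>b E v \<mu>. G k b E v \<mu>" using ex0 unfolding G_def mn_def .
    then obtain b E v \<mu> where G: "\<And>k. G k (b k) (E k) (v k) (\<mu> k)" by metis
    \<comment> \<open>The total frequency stays near \<open>- center B k\<close>, in the same
      annulus as the inputs, so these pieces add up to 1 there.\<close>
    let ?F = "\<lambda>k. {k - 1..k + L + 1}"
    have Fsum: "(\<Sum>l\<in>?F k. \<psi> l \<zeta>) = 1" if z: "z \<in> grid k" and \<zeta>: "norm (\<zeta> - (lat z - real 1 *\<^sub>R center B k)) \<le> 1 / 2" for k z \<zeta>
    proof (rule lp_sum[OF \<psi>])
      have "norm (\<zeta> - (- center B k)) \<le> norm (\<zeta> - (lat z - real 1 *\<^sub>R center B k)) + norm (lat z :: real^'n)"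
        using norm_triangle_ineq[of "\<zeta> - (lat z - center B k)" "lat z"] by simp
      also have "\<dots> \<le> 1 * 2 ^ k + real ?n * 2 ^ k" using \<zeta> norm_lat_le[OF z] one_le_power[of "2::real" k] by linarith
      also have "\<dots> = (real ?n + 1) * 2 ^ k" by (simp add: distrib_right)
      also have "\<dots> \<le> (radius TYPE('n) TYPE('N) + 1) * 2 ^ k" using r0 by (intro mult_right_mono) auto
      finally have ball: "norm (\<zeta> - (- center B k)) \<le> (radius TYPE('n) TYPE('N) + 1) * 2 ^ k" .
      have "1 \<le> real ?N" using N by linarith
      note nc = norm_center_bounds[OF this, where 'n='n, of B k]
      have "2 ^ k \<le> norm \<zeta> \<and> norm \<zeta> \<le> 2 ^ (k + L)"
        by (rule annulus_ball[OF B L _ _ ball]) (use nc in simp_all)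
      then show "\<psi> l \<zeta> = 0" if "l \<notin> ?F k" for l using lp_annulus[OF \<psi> _ _ that] by blast
    qed simp
    have Ssum: "(\<Sum>j\<in>insert j1 J. ss j + real ?n - mx j) = (sum ss UNIV - ss j0) + real ?n * (real ?N - 1) - (sum mx UNIV - mx j0)"
    proof -
      have "(\<Sum>j\<in>UNIV - {j0}. ss j + real ?n - mx j) = (\<Sum>j\<in>UNIV. ss j + real ?n - mx j) - (ss j0 + real ?n - mx j0)"
        by (subst sum.remove[of UNIV j0]) auto
      then show ?thesis unfolding insJ by (simp add: sum_subtractf sum.distrib algebra_simps)
    qed
    have "\<exists>C>0. \<forall>k. \<exists>l\<in>?F k. 2 powr (real l * s) *
      (2 powr (real k * m) * 2 powr (real k * (real ?n * real (card J))) * v k / real (card (?F k)) * (\<mu> k / real (card (?F k))) powr (1 / ?P))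
      \<le> C * 2 powr (real k * (\<Sum>j\<in>insert j1 J. ss j + real ?n - max (dim_over TYPE('n) (ps j)) (real ?n / 2)))"
    proof (rule boundedness_estimate[OF \<psi> N p q assms(5,6,8) B L j1J card, where M = "\<lambda>k. grid k" and b = b and E = E])
      show "E k \<in> sets borel" "E k \<subseteq> ball 0 1" "0 \<le> v k" "0 < \<mu> k" "ennreal (\<mu> k) \<le> emeasure lborel (E k)" for k
        using G[of k] unfolding G_def by blast+
      show "b k z = 1 \<or> b k z = - 1" for k z using G[of k] unfolding G_def by blast
      show "v k \<le> norm (\<Sum>z\<in>grid k. complex_of_real (b k z) * cis (x \<bullet> lat z))" if "x \<in> E k" for k x
        using G[of k] that unfolding G_def by blast
      show "?F k \<noteq> {}" for k by simp
    qed (use Fsum in simp_all)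
    from this[folded mx_def] obtain C where C: "0 < C" and est0: "\<forall>k. \<exists>l\<in>?F k. 2 powr (real l * s) *
      (2 powr (real k * m) * 2 powr (real k * (real ?n * real (card J))) * v k / real (card (?F k)) * (\<mu> k / real (card (?F k))) powr (1 / ?P))
      \<le> C * 2 powr (real k * (\<Sum>j\<in>insert j1 J. ss j + real ?n - mx j))"
      by (elim exE conjE) (rule that)
    \<comment> \<open>The unknown index \<open>l\<close> differs from \<open>k\<close> by at most
      \<open>L + 1\<close>, and at most \<open>L + 3\<close> pieces take part in the pigeonhole;
      both losses are constants.\<close>
    define c' where "c' = 2 powr (- ((real L + 1) * \<bar>s\<bar>)) * (c / (real (L + 3) * real (L + 3) powr (1 / ?P)))"
    have c': "0 < c'" unfolding c'_def using c by simp
    have "c' * 2 powr (real k * (s + m + real ?n * real (card J) + (real ?n - mn))) \<le> C * 2 powr (real k * (\<Sum>j\<in>insert j1 J. ss j + real ?n - mx j))" for k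
    proof -
      obtain l where l: "l \<in> ?F k" and le: "2 powr (real l * s) *
        (2 powr (real k * m) * 2 powr (real k * (real ?n * real (card J))) * v k / real (card (?F k)) * (\<mu> k / real (card (?F k))) powr (1 / ?P))
        \<le> C * 2 powr (real k * (\<Sum>j\<in>insert j1 J. ss j + real ?n - mx j))" using est0 by blast
      let ?f = "real (card (?F k))"
      have f: "0 < ?f" "?f \<le> real (L + 3)" by auto
      have vm: "0 \<le> v k" "0 < \<mu> k" and vl: "c * 2 powr (real k * (real ?n - mn)) \<le> v k * \<mu> k powr (1 / ?P)"
        using G[of k] unfolding G_def by blast+
      have sl: "2 powr (- ((real L + 1) * \<bar>s\<bar>)) * 2 powr (real k * s) \<le> 2 powr (real l * s)"
      proof -
        have "\<bar>real k - real l\<bar> \<le> real L + 1" using l by auto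
        then have "\<bar>real k - real l\<bar> * \<bar>s\<bar> \<le> (real L + 1) * \<bar>s\<bar>" by (rule mult_right_mono) simp
        moreover have "(real k - real l) * s \<le> \<bar>real k - real l\<bar> * \<bar>s\<bar>" by (simp flip: abs_mult)
        ultimately have "- ((real L + 1) * \<bar>s\<bar>) + real k * s \<le> real l * s" by (simp add: left_diff_distrib)
        then show ?thesis unfolding powr_add[symmetric] by (intro powr_mono) auto
      qed
      have ml: "c * 2 powr (real k * (real ?n - mn)) / (real (L + 3) * real (L + 3) powr (1 / ?P)) \<le> v k / ?f * (\<mu> k / ?f) powr (1 / ?P)"
      proof -
        have "c * 2 powr (real k * (real ?n - mn)) / (real (L + 3) * real (L + 3) powr (1 / ?P)) \<le> (v k * \<mu> k powr (1 / ?P)) / (real (L + 3) * real (L + 3) powr (1 / ?P))"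
          using vl by (rule divide_right_mono) simp
        also have "\<dots> \<le> (v k * \<mu> k powr (1 / ?P)) / (?f * ?f powr (1 / ?P))"
          using vm f by (intro divide_left_mono mult_mono powr_mono2 mult_pos_pos) auto
        also have "\<dots> = v k / ?f * (\<mu> k / ?f) powr (1 / ?P)" using vm f by (simp add: powr_divide)
        finally show ?thesis .
      qed
      have "c' * 2 powr (real k * (s + m + real ?n * real (card J) + (real ?n - mn))) =
         (2 powr (- ((real L + 1) * \<bar>s\<bar>)) * 2 powr (real k * s)) * ((2 powr (real k * m) * 2 powr (real k * (real ?n * real (card J)))) *
         (c * 2 powr (real k * (real ?n - mn)) / (real (L + 3) * real (L + 3) powr (1 / ?P))))"
      proof -
        have "2 powr (real k * (s + m + real ?n * real (card J) + (real ?n - mn))) =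
          2 powr (real k * s) * 2 powr (real k * m) * 2 powr (real k * (real ?n * real (card J))) * 2 powr (real k * (real ?n - mn))"
          unfolding powr_add[symmetric] by (simp only: distrib_left)
        then show ?thesis unfolding c'_def by (simp only: mult_ac times_divide_eq_left times_divide_eq_right)
      qed
      also have "\<dots> \<le> 2 powr (real l * s) * ((2 powr (real k * m) * 2 powr (real k * (real ?n * real (card J)))) * (v k / ?f * (\<mu> k / ?f) powr (1 / ?P)))"
        using c by (intro mult_mono sl ml) (auto intro!: mult_nonneg_nonneg divide_nonneg_nonneg)
      also have "\<dots> \<le> C * 2 powr (real k * (\<Sum>j\<in>insert j1 J. ss j + real ?n - mx j))"
        using le by (simp only: mult.assoc times_divide_eq_left times_divide_eq_right)
      finally show ?thesis .
    qed
    \<comment> \<open>Since \<open>card J = N - 2\<close>, the choice of \<open>m\<close> cancels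
      every term except \<open>ss j0\<close> and \<open>mx j0\<close>.\<close>
    from exponent_nonpos_if_bounded[OF c' this]
    have "s + m + real ?n * real (card J) + (real ?n - mn) \<le> (sum ss UNIV - ss j0) + real ?n * (real ?N - 1) - (sum mx UNIV - mx j0)"
      unfolding Ssum .
    moreover have "real ?n * real (card J) = real ?n * (real ?N - 1) - real ?n"
    proof -
      have "real (card J) = real ?N - 1 - 1" using card by linarith
      then show ?thesis by (simp only: right_diff_distrib mult_1_right)
    qed
    ultimately show ?thesis unfolding m by linarith
  qed
  have partB: "mn - real ?n \<le> s"
  proof -
    obtain j1 :: 'N where True by blast
    \<comment> \<open>No slot is frozen, and \<open>t = 0\<close> lets the frequencies of all slots
      cancel in the total.\<close>
    define J where "J = UNIV - {j1}"
    have cJ: "card J = ?N - 1" unfolding J_def by (subst card_Diff_subset) auto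
    have insJ: "insert j1 J = UNIV" unfolding J_def by auto
    have j1J: "j1 \<notin> J" unfolding J_def by simp
    have card: "card J + 0 + 1 = ?N" using cJ N by simp
    define V where "V = unit_ball_vol (real ?n)"
    have V: "0 < V" unfolding V_def by simp
    have lat0: "lat (\<lambda>_. 0) = (0 :: real^'n)" by (simp add: lat_def vec_eq_iff)
    have "\<exists>C>0. \<forall>k. \<exists>l\<in>{0::nat}. 2 powr (real l * s) *
      (2 powr (real k * m) * 2 powr (real k * (real ?n * real (card J))) * 1 / real (card {0::nat}) * (V / real (card {0::nat})) powr (1 / ?P))
      \<le> C * 2 powr (real k * (\<Sum>j\<in>insert j1 J. ss j + real ?n - max (dim_over TYPE('n) (ps j)) (real ?n / 2)))"
    \<comment> \<open>The single output frequency 0 is enough: the exponential sum is the constant 1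
      on the unit ball and only the piece \<open>\<psi> 0\<close> occurs, so the output quasi-norm
      carries no factor \<open>2 powr (k * s)\<close>. The growth comes from the coefficient and the
      count alone.\<close>
    proof (rule boundedness_estimate[OF \<psi> N p q assms(5,6,8) B L j1J card, where M = "\<lambda>k. {\<lambda>_. 0}" and b = "\<lambda>_ _. 1" and E = "\<lambda>_. ball 0 1" and v = "\<lambda>_. 1" and \<mu> = "\<lambda>_. V" and F = "\<lambda>_. {0}"])
      show "ennreal V \<le> emeasure lborel (ball (0::real^'n) 1)"
        using emeasure_ball[of 1, where 'a="real^'n"] by (simp add: V_def)
      show "(\<Sum>l\<in>{0}. \<psi> l \<zeta>) = 1" if "z \<in> {\<lambda>_. 0}" "norm (\<zeta> - (lat z - real 0 *\<^sub>R center B k)) \<le> 1 / 2" for k z \<zeta>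
        using that by (simp add: lat0 lp_one[OF \<psi>])
    qed (use V in \<open>auto simp: grid_def lat0\<close>)
    from this[folded mx_def] obtain C where est0: "\<forall>k. \<exists>l\<in>{0::nat}. 2 powr (real l * s) *
      (2 powr (real k * m) * 2 powr (real k * (real ?n * real (card J))) * 1 / real (card {0::nat}) * (V / real (card {0::nat})) powr (1 / ?P))
      \<le> C * 2 powr (real k * (\<Sum>j\<in>insert j1 J. ss j + real ?n - mx j))"
      by (elim exE conjE) (rule that)
    have "V powr (1 / ?P) * 2 powr (real k * (m + real ?n * real (card J))) \<le> C * 2 powr (real k * (\<Sum>j\<in>insert j1 J. ss j + real ?n - mx j))" for k
    proof -
      have "2 powr (real k * (m + real ?n * real (card J))) = 2 powr (real k * m) * 2 powr (real k * (real ?n * real (card J)))"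
        unfolding powr_add[symmetric] by (simp only: distrib_left)
      then show ?thesis using est0[rule_format, of k] by (simp add: mult.commute)
    qed
    \<comment> \<open>With \<open>card J = N - 1\<close>, inserting \<open>m\<close> leaves
      \<open>mn - n \<le> s\<close>.\<close>
    from exponent_nonpos_if_bounded[OF _ this] V
    have "m + real ?n * real (card J) \<le> sum ss UNIV + real ?n * real ?N - sum mx UNIV"
      unfolding insJ by (simp add: sum_subtractf sum.distrib mult.commute)
    moreover have "real ?n * real (card J) = real ?n * real ?N - real ?n"
    proof -
      have "real (card J) = real ?N - 1" using card by linarith
      then show ?thesis by (simp only: right_diff_distrib mult_1_right)
    qed
    ultimately show ?thesis unfolding m by linarith
  qed
  show ?thesis
    using partA partB min_dim_over_conj[OF p, where 'n='n] unfolding mx_def mn_def by simp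
qed

end
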